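(* Let $k$ be a field, $R=k[x_1,\dots,x_n]$, $1\le d\le n$, and let $I_1,\dots,I_r\subseteq[n]$ be subsets of size $d$ with $|I_s\cap I_t|\le d-2$ for all $s\ne t$. Put $\mathcal{I}=\{I_1,\dots,I_r\}$. Let $K'$ be the squarefree equigenerated monomial ideal whose squarefree complementary ideal is $\overline{K'}=(x^{I_1},\dots,x^{I_r})$, i.e. $K'$ is generated by all squarefree monomials of degree $d$ other than $x^{I_1},\dots,x^{I_r}$. Then the minimal free resolution of $R/K'$ is the complex $$F_\bullet^{d,n,\mathcal{I}}:\quad 0\to F_{n-d+1}^{d,n,\mathcal{I}}\xrightarrow{\partial^{d,n}_{n-d+1}}\cdots\xrightarrow{\partial_2^{d,n}}F_1^{d,n,\mathcal{I}}\xrightarrow{\partial_1^{d,n}}R\to0,$$ whose differentials are the restrictions of those of $F_\bullet^{d,n}$.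
   Context: For $I\subseteq[n]$, $x^I=\prod_{i\in I}x_i$. For $A=\{a_1<\dots<a_m\}\subseteq[n]$, $\operatorname{sgn}(a_j\in A)=(-1)^{j-1}$. The complex $F^{d,n}_\bullet$. For $1\le i\le n-d+1$, $F_i^{d,n}=U_{i-1}^{d,n}\otimes_kR(-d-i+1)$, where $U_{i-1}^{d,n}=\operatorname{Ind}_{S_{d+i-1}\times S_{n-d-i+1}}^{S_n}\big(S^{(d,1^{i-1})}\otimes S^{(n-d-i+1)}\big)$, and Specht modules $S^\lambda$ are constructed as spans of column tabloids modulo straightening relations. Concretely, $U_{i-1}^{d,n}$ is the $k$-vector space spanned by symbols $f_{a_1}\wedge\cdots\wedge f_{a_i}\otimes f_{b_1}\cdots f_{b_{d-1}}$ with $a_1,\dots,a_i,b_1,\dots,b_{d-1}$ distinct elements of $[n]$ (the hook tableau with first column $a_1,\dots,a_i$ and first row $a_1,b_1,\dots,b_{d-1}$), alternating in the $a$'s, symmetric in the $b$'s, modulo the relations $$f_{a_1}\wedge\cdots\wedge f_{a_i}\otimes f_{b_1}f_{b_2}\cdots f_{b_{d-1}}=\sum_{m=1}^i f_{a_1}\wedge\cdots\wedge f_{b_1}\wedge\cdots\wedge f_{a_i}\otimes f_{a_m}f_{b_2}\cdots f_{b_{d-1}}$$ ($f_{b_1}$ replacing $f_{a_m}$ in the $m$th summand). For disjoint $A=\{a_1<\dots<a_i\}$ and $L$ with $|L|=d-1$ write $f_A\otimes f^L$; it is called standard if $\min A<\min L$ (no condition if $d=1$). Standard elements form a basis. The differentials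 are $\partial_i^{d,n}(f_A\otimes f^L)=\sum_{j=1}^i(-1)^{i-j}x_{a_j}f_{A\setminus a_j}\otimes f^L$ for $i>1$, and $\partial_1^{d,n}(f_a\otimes f^L)=x_ax^L$. The submodules. Write $I_s=\{i_{s1}<\dots<i_{sd}\}$. For $1\le i\le n-d+1$, $F_i^{d,n,\mathcal{I}}\subseteq F_i^{d,n}$ is the free submodule generated by the following elements (all terms $f_A\otimes f^L$ appearing being standard, $|A|=i$): (1) $f_A\otimes f^L$ with $L\ne I_s\setminus\{i_{sp}\}$ for all $s,p$; (2) $f_A\otimes f^{I_s\setminus\{i_{sp}\}}$ with $i_{sp}\notin A$; (3) $\operatorname{sgn}(i_{sp}\in J\cup\{i_{sp}\})\,f_{J\cup\{i_{sp}\}}\otimes f^{I_s\setminus\{i_{sp}\}}-\operatorname{sgn}(i_{s1}\in J\cup\{i_{s1}\})\,f_{J\cup\{i_{s1}\}}\otimes f^{I_s\setminus\{i_{s1}\}}$, with $|J|=i-1$, $J\cap I_s=\varnothing$, $1<p\le d$, $1\le s\le r$. *)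

theory Defs
  imports
    Complex_Main
    "HOL-Library.Cardinality"
    "HOL-Library.Poly_Mapping"
begin

section \<open>The polynomial ring\<close>

text \<open>
  The index set \<open>[n]\<close> is a finite linearly ordered type \<open>'n\<close> with \<open>n = CARD('n)\<close>.  The ring
  \<open>k[x\<^sub>1, \<dots>, x\<^sub>n]\<close> is the type \<open>('n, 'k) mpoly\<close> of finitely supported functions from exponent
  vectors to \<open>k\<close>, with the convolution product.
\<close>

type_synonym ('n, 'k) mpoly = "('n \<Rightarrow>\<^sub>0 nat) \<Rightarrow>\<^sub>0 'k"

definition X :: "'n \<Rightarrow> ('n, 'k::comm_ring_1) mpoly" where
  "X i = Poly_Mapping.single (Poly_Mapping.single i 1) 1"

definition sqfree_mon :: "'n set \<Rightarrow> ('n, 'k::comm_ring_1) mpoly" where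
  "sqfree_mon A = (\<Prod>i\<in>A. X i)"

definition mon_degree :: "('n::finite \<Rightarrow>\<^sub>0 nat) \<Rightarrow> nat" where
  "mon_degree t = (\<Sum>i\<in>UNIV. Poly_Mapping.lookup t i)"

definition poly_homogeneous :: "nat \<Rightarrow> ('n::finite, 'k::comm_ring_1) mpoly set" where
  "poly_homogeneous m = {p. \<forall>t\<in>Poly_Mapping.keys p. mon_degree t = m}"

definition ideal_generated :: "'r::comm_ring_1 set \<Rightarrow> 'r set" where
  "ideal_generated = module.span (*)"

definition irrelevant_ideal :: "('n, 'k::comm_ring_1) mpoly set" where
  "irrelevant_ideal = ideal_generated (range X)"

lemma module_mult: "module ((*) :: 'r::comm_ring_1 \<Rightarrow> 'r \<Rightarrow> 'r)"
  by standard (auto simp: algebra_simps)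


section \<open>Minimal graded free resolutions\<close>

text \<open>
  \<open>grading scl H\<close>: the sets \<open>H m\<close> are the homogeneous components of a grading of the module with
  scalar multiplication \<open>scl\<close> over the standard graded polynomial ring.
\<close>

definition grading ::
  "(('n::finite, 'k::field) mpoly \<Rightarrow> 'b::ab_group_add \<Rightarrow> 'b) \<Rightarrow> (nat \<Rightarrow> 'b set) \<Rightarrow> bool" where
  "grading scl H \<longleftrightarrow>
     (\<forall>m. 0 \<in> H m \<and> (\<forall>u\<in>H m. \<forall>v\<in>H m. u - v \<in> H m)) \<and>
     (\<forall>e m. \<forall>c\<in>poly_homogeneous e. \<forall>u\<in>H m. scl c u \<in> H (e + m)) \<and>
     (\<forall>u. \<exists>!c :: nat \<Rightarrow>\<^sub>0 'b.
        (\<forall>m. Poly_Mapping.lookup c m \<in> H m) \<and>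
        u = (\<Sum>m\<in>Poly_Mapping.keys c. Poly_Mapping.lookup c m))"

definition graded_free ::
  "(('n::finite, 'k::field) mpoly \<Rightarrow> 'b::ab_group_add \<Rightarrow> 'b) \<Rightarrow> (nat \<Rightarrow> 'b set) \<Rightarrow> 'b set \<Rightarrow> bool" where
  "graded_free scl H M \<longleftrightarrow>
     (\<exists>B. B \<subseteq> (\<Union>m. H m) \<and> \<not> module.dependent scl B \<and> module.span scl B = M)"

text \<open>
  \<open>minimal_free_resolution scl H J N F \<delta> \<epsilon>\<close> says that
  \<open>0 \<rightarrow> F N \<rightarrow> \<dots> \<rightarrow> F 2 \<rightarrow> F 1 \<rightarrow> R \<rightarrow> 0\<close> is a minimal graded free resolution of \<open>R/J\<close>.
  The modules \<open>F i\<close>, for \<open>i \<ge> 1\<close>, are submodules of one ambient graded module, \<open>\<delta> i\<close> restricts to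
  the differential \<open>F i \<rightarrow> F (i - 1)\<close> for \<open>i \<ge> 2\<close>, and \<open>\<epsilon>\<close> restricts to the differential
  \<open>F 1 \<rightarrow> F 0 = R\<close>.  The augmentation is the quotient map \<open>R \<rightarrow> R/J\<close>, so exactness at \<open>R\<close> means
  that \<open>\<epsilon>\<close> maps \<open>F 1\<close> onto \<open>J\<close>.  Some \<open>F i\<close> with \<open>i \<le> N\<close> may be zero.
\<close>

definition minimal_free_resolution ::
  "(('n::finite, 'k::field) mpoly \<Rightarrow> 'b::ab_group_add \<Rightarrow> 'b) \<Rightarrow> (nat \<Rightarrow> 'b set) \<Rightarrow>
   ('n, 'k) mpoly set \<Rightarrow> nat \<Rightarrow> (nat \<Rightarrow> 'b set) \<Rightarrow> (nat \<Rightarrow> 'b \<Rightarrow> 'b) \<Rightarrow> ('b \<Rightarrow> ('n, 'k) mpoly) \<Rightarrow> bool"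
where
  "minimal_free_resolution scl H J N F \<delta> \<epsilon> \<longleftrightarrow>
     \<comment> \<open>graded free modules, concentrated in homological degrees at most \<open>N\<close>\<close>
     module scl \<and> grading scl H \<and>
     (\<forall>i\<ge>1. graded_free scl H (F i)) \<and> (\<forall>i>N. F i = {0}) \<and>
     \<comment> \<open>homogeneous \<open>R\<close>-linear maps of degree 0\<close>
     (\<forall>i\<ge>2. module_hom scl scl (\<delta> i)) \<and> module_hom scl (*) \<epsilon> \<and>
     (\<forall>i\<ge>2. \<forall>m. \<delta> i ` (F i \<inter> H m) \<subseteq> F (i - 1) \<inter> H m) \<and>
     (\<forall>m. \<epsilon> ` (F 1 \<inter> H m) \<subseteq> poly_homogeneous m) \<and>
     \<comment> \<open>exactness\<close>
     \<epsilon> ` F 1 = J \<and>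
     {u \<in> F 1. \<epsilon> u = 0} = \<delta> 2 ` F 2 \<and>
     (\<forall>i\<ge>2. {u \<in> F i. \<delta> i u = 0} = \<delta> (i + 1) ` F (i + 1)) \<and>
     \<comment> \<open>minimality\<close>
     (\<forall>i\<ge>2. \<delta> i ` F i \<subseteq> module.span scl {scl c u | c u. c \<in> irrelevant_ideal \<and> u \<in> F (i - 1)}) \<and>
     \<epsilon> ` F 1 \<subseteq> irrelevant_ideal"


section \<open>Free modules\<close>

definition free_scale :: "'r::comm_ring_1 \<Rightarrow> ('s \<Rightarrow>\<^sub>0 'r) \<Rightarrow> ('s \<Rightarrow>\<^sub>0 'r)" where
  "free_scale c = Poly_Mapping.map ((*) c)"

lemma lookup_free_scale [simp]:
  "Poly_Mapping.lookup (free_scale c v) s = c * Poly_Mapping.lookup v s"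
  by (simp add: free_scale_def Poly_Mapping.map.rep_eq when_def)

interpretation free: module "free_scale :: 'r::comm_ring_1 \<Rightarrow> ('s \<Rightarrow>\<^sub>0 'r) \<Rightarrow> _"
  by standard (auto intro!: poly_mapping_eqI simp: lookup_add algebra_simps)

definition lin_ext ::
  "('r::comm_ring_1 \<Rightarrow> 'b::ab_group_add \<Rightarrow> 'b) \<Rightarrow> ('s \<Rightarrow> 'b) \<Rightarrow> ('s \<Rightarrow>\<^sub>0 'r) \<Rightarrow> 'b" where
  "lin_ext scl g v = (\<Sum>s\<in>Poly_Mapping.keys v. scl (Poly_Mapping.lookup v s) (g s))"

lemma lin_ext_superset:
  assumes "module scl" "finite S" "Poly_Mapping.keys v \<subseteq> S"
  shows "lin_ext scl g v = (\<Sum>s\<in>S. scl (Poly_Mapping.lookup v s) (g s))"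
proof -
  interpret module scl by fact
  show ?thesis
    unfolding lin_ext_def using assms(2,3)
    by (intro sum.mono_neutral_left) (auto simp: in_keys_iff)
qed

lemma module_hom_lin_ext:
  fixes scl :: "'r::comm_ring_1 \<Rightarrow> 'b::ab_group_add \<Rightarrow> 'b" and g :: "'s \<Rightarrow> 'b"
  assumes "module scl"
  shows "module_hom free_scale scl (lin_ext scl g)"
proof -
  interpret module scl by fact
  show ?thesis
  proof (unfold_locales)
    fix u v :: "'s \<Rightarrow>\<^sub>0 'r"
    let ?S = "Poly_Mapping.keys u \<union> Poly_Mapping.keys v"
    show "lin_ext scl g (u + v) = lin_ext scl g u + lin_ext scl g v"
      using Poly_Mapping.keys_add[of u v]
      by (simp add: lin_ext_superset[OF assms, of ?S] lookup_add scale_left_distrib sum.distrib)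
  next
    fix c and v :: "'s \<Rightarrow>\<^sub>0 'r"
    have "Poly_Mapping.keys (free_scale c v) \<subseteq> Poly_Mapping.keys v"
      by (auto simp: in_keys_iff)
    then show "lin_ext scl g (free_scale c v) = scl c (lin_ext scl g v)"
      by (simp add: lin_ext_superset[OF assms, of "Poly_Mapping.keys v"] scale_sum_right)
  qed
qed

lemma lin_ext_single:
  assumes "module scl"
  shows "lin_ext scl g (Poly_Mapping.single s 1) = g s"
proof -
  interpret module scl by fact
  show ?thesis by (simp add: lin_ext_def)
qed


section \<open>The hook modules\<close>

text \<open>
  The pair \<open>(a, L)\<close> of a list \<open>a = [a\<^sub>1, \<dots>, a\<^sub>i]\<close> and a set \<open>L = {b\<^sub>1, \<dots>, b\<^bsub>d-1\<^esub>}\<close> stands for the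
  symbol \<open>f\<^bsub>a\<^sub>1\<^esub> \<and> \<dots> \<and> f\<^bsub>a\<^sub>i\<^esub> \<otimes> f\<^bsub>b\<^sub>1\<^esub> \<cdots> f\<^bsub>b\<^bsub>d-1\<^esub>\<^esub>\<close>.  As the \<open>b\<close>'s are distinct, the symbols
  are symmetric in the \<open>b\<close>'s because \<open>L\<close> is a set.
\<close>

type_synonym 'n symb = "'n list \<times> 'n set"

definition valid_symb :: "'n list \<Rightarrow> 'n set \<Rightarrow> bool" where
  "valid_symb a L \<longleftrightarrow> a \<noteq> [] \<and> distinct a \<and> set a \<inter> L = {}"

definition alternating_relations :: "('n symb \<Rightarrow>\<^sub>0 'r::comm_ring_1) set" where
  "alternating_relations =
     {Poly_Mapping.single (xs @ p # q # ys, L) 1 + Poly_Mapping.single (xs @ q # p # ys, L) 1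
      | xs p q ys L. valid_symb (xs @ p # q # ys) L}"

definition straightening_relations :: "('n symb \<Rightarrow>\<^sub>0 'r::comm_ring_1) set" where
  "straightening_relations =
     {Poly_Mapping.single (a, L) 1
        - (\<Sum>m<length a. Poly_Mapping.single (a[m := b], insert (a ! m) (L - {b})) 1)
      | a b L. valid_symb a L \<and> b \<in> L}"

definition hook_relations :: "('n symb \<Rightarrow>\<^sub>0 'r::comm_ring_1) set" where
  "hook_relations = alternating_relations \<union> straightening_relations"

definition hook_eq :: "('n symb \<Rightarrow>\<^sub>0 'r::comm_ring_1) \<Rightarrow> ('n symb \<Rightarrow>\<^sub>0 'r) \<Rightarrow> bool" where
  "hook_eq u v \<longleftrightarrow> u - v \<in> free.span hook_relations"

lemma equivp_hook_eq: "equivp (hook_eq :: ('n symb \<Rightarrow>\<^sub>0 'r::comm_ring_1) \<Rightarrow> _)"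
proof (rule equivpI)
  show "reflp (hook_eq :: ('n symb \<Rightarrow>\<^sub>0 'r) \<Rightarrow> _)"
    by (simp add: reflp_def hook_eq_def free.span_zero)
  show "symp (hook_eq :: ('n symb \<Rightarrow>\<^sub>0 'r) \<Rightarrow> _)"
    unfolding symp_def hook_eq_def by (metis free.span_neg minus_diff_eq)
  show "transp (hook_eq :: ('n symb \<Rightarrow>\<^sub>0 'r) \<Rightarrow> _)"
    unfolding transp_def hook_eq_def
  proof (intro allI impI)
    fix u v w :: "'n symb \<Rightarrow>\<^sub>0 'r"
    assume "u - v \<in> free.span hook_relations" "v - w \<in> free.span hook_relations"
    from free.span_add[OF this] show "u - w \<in> free.span hook_relations" by simp
  qed
qed

text \<open>
  The relations preserve the shape \<open>(length a, card L)\<close> of a symbol.  The quotient is therefore the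
  direct sum of its parts of the various shapes (see \<open>hook_module\<close>).  The coefficient ring is a
  parameter: over \<open>k\<close> the part of shape \<open>(i, d - 1)\<close> is \<open>U\<^bsub>i-1\<^esub>\<^bsup>d,n\<^esup>\<close>, and over \<open>R\<close> it is the module with
  the same generators and relations, which is \<open>U\<^bsub>i-1\<^esub>\<^bsup>d,n\<^esup> \<otimes>\<^sub>k R\<close>.
\<close>

quotient_type (overloaded) ('n, 'r) hook = "'n symb \<Rightarrow>\<^sub>0 'r::comm_ring_1" / hook_eq
  by (rule equivp_hook_eq)

instantiation hook :: (type, comm_ring_1) ab_group_add
begin

lift_definition zero_hook :: "('a, 'b) hook" is 0 .

lift_definition plus_hook :: "('a, 'b) hook \<Rightarrow> ('a, 'b) hook \<Rightarrow> ('a, 'b) hook" is "(+)"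
  unfolding hook_eq_def by (metis add_diff_add free.span_add)

lift_definition uminus_hook :: "('a, 'b) hook \<Rightarrow> ('a, 'b) hook" is uminus
  unfolding hook_eq_def by (metis free.span_neg minus_diff_minus)

definition minus_hook :: "('a, 'b) hook \<Rightarrow> ('a, 'b) hook \<Rightarrow> ('a, 'b) hook" where
  "minus_hook u v = u + - v"

instance
  by standard
    (unfold minus_hook_def, (transfer, simp add: hook_eq_def algebra_simps free.span_zero)+)

end

lift_definition hook_scale :: "'r::comm_ring_1 \<Rightarrow> ('n, 'r) hook \<Rightarrow> ('n, 'r) hook" is free_scale
  unfolding hook_eq_def by (metis free.scale_right_diff_distrib free.span_scale)

interpretation hook: module "hook_scale :: 'r::comm_ring_1 \<Rightarrow> ('n, 'r) hook \<Rightarrow> _"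
  by standard (transfer, simp add: hook_eq_def algebra_simps free.span_zero)+

definition hook_symb :: "'n list \<Rightarrow> 'n set \<Rightarrow> ('n, 'r::comm_ring_1) hook" where
  "hook_symb a L = abs_hook (Poly_Mapping.single (a, L) 1)"

lemma module_hom_abs_hook: "module_hom free_scale hook_scale abs_hook"
  by unfold_locales (simp_all add: plus_hook.abs_eq hook_scale.abs_eq)

lemma abs_hook_surj: "\<exists>v. u = abs_hook v"
  by (induct u rule: hook.abs_induct) blast

lemma abs_hook_eq_0_iff: "abs_hook v = 0 \<longleftrightarrow> v \<in> free.span hook_relations"
  by (simp add: zero_hook_def hook.abs_eq_iff hook_eq_def)

lemma hook_symb_alternating:
  assumes "valid_symb (xs @ p # q # ys) L"
  shows "(hook_symb (xs @ q # p # ys) L :: ('n, 'r::comm_ring_1) hook) =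
    - hook_symb (xs @ p # q # ys) L"
proof -
  interpret cl: module_hom free_scale hook_scale abs_hook by (rule module_hom_abs_hook)
  let ?v = "Poly_Mapping.single (xs @ p # q # ys, L) (1::'r) + Poly_Mapping.single (xs @ q # p # ys, L) 1"
  have "?v \<in> hook_relations"
    using assms unfolding hook_relations_def alternating_relations_def by blast
  then have "abs_hook ?v = 0" by (simp add: abs_hook_eq_0_iff free.span_base)
  then show ?thesis by (simp add: cl.add hook_symb_def eq_neg_iff_add_eq_0 add.commute)
qed

lemma hook_symb_straightening:
  assumes "valid_symb a L" "b \<in> L"
  shows "(hook_symb a L :: ('n, 'r::comm_ring_1) hook) =
    (\<Sum>m<length a. hook_symb (a[m := b]) (insert (a ! m) (L - {b})))"
proof -
  interpret cl: module_hom free_scale hook_scale abs_hook by (rule module_hom_abs_hook)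
  let ?v = "Poly_Mapping.single (a, L) (1::'r)
    - (\<Sum>m<length a. Poly_Mapping.single (a[m := b], insert (a ! m) (L - {b})) 1)"
  have "?v \<in> hook_relations"
    using assms unfolding hook_relations_def straightening_relations_def by blast
  then have "abs_hook ?v = 0" by (simp add: abs_hook_eq_0_iff free.span_base)
  then show ?thesis by (simp add: cl.diff cl.sum hook_symb_def)
qed

definition hook_lift ::
  "('r::comm_ring_1 \<Rightarrow> 'b::ab_group_add \<Rightarrow> 'b) \<Rightarrow> ('n symb \<Rightarrow> 'b) \<Rightarrow> ('n, 'r) hook \<Rightarrow> 'b" where
  "hook_lift scl g u = lin_ext scl g (rep_hook u)"

lemma hook_lift:
  fixes scl :: "'r::comm_ring_1 \<Rightarrow> 'b::ab_group_add \<Rightarrow> 'b" and g :: "'n symb \<Rightarrow> 'b"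
  assumes scl: "module scl"
    and alt: "\<And>xs p q ys L. valid_symb (xs @ p # q # ys) L \<Longrightarrow>
      g (xs @ q # p # ys, L) = - g (xs @ p # q # ys, L)"
    and str: "\<And>a b L. valid_symb a L \<Longrightarrow> b \<in> L \<Longrightarrow>
      g (a, L) = (\<Sum>m<length a. g (a[m := b], insert (a ! m) (L - {b})))"
  shows module_hom_hook_lift: "module_hom hook_scale scl (hook_lift scl g)"
    and hook_lift_symb: "hook_lift scl g (hook_symb a L) = g (a, L)"
proof -
  interpret m: module scl by fact
  interpret l: module_hom free_scale scl "lin_ext scl g" by (rule module_hom_lin_ext[OF scl])
  have rel: "lin_ext scl g v = 0" if "v \<in> hook_relations" for v
    using that
    unfolding hook_relations_def alternating_relations_def straightening_relations_def Un_iff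
  proof (elim disjE CollectE exE conjE)
    fix xs p q ys L
    assume v: "v = Poly_Mapping.single (xs @ p # q # ys, L) 1
        + Poly_Mapping.single (xs @ q # p # ys, L) 1"
      and valid: "valid_symb (xs @ p # q # ys) L"
    show ?thesis unfolding v l.add lin_ext_single[OF scl] alt[OF valid] by simp
  next
    fix a b L
    assume v: "v = Poly_Mapping.single (a, L) 1
        - (\<Sum>m<length a. Poly_Mapping.single (a[m := b], insert (a ! m) (L - {b})) 1)"
      and valid: "valid_symb a L" "b \<in> L"
    show ?thesis unfolding v l.diff l.sum lin_ext_single[OF scl] str[OF valid] by simp
  qed
  have "hook_relations \<subseteq> {v. lin_ext scl g v = 0}" using rel by auto
  then have *: "lin_ext scl g v = 0" if "v \<in> free.span hook_relations" for v
    using free.span_minimal[OF _ l.subspace_kernel] that by blast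
  have **: "hook_lift scl g (abs_hook v) = lin_ext scl g v" for v
  proof -
    have "hook_eq (rep_hook (abs_hook v)) v"
      by (metis Quotient3_def Quotient3_hook hook.abs_eq_iff)
    then have "rep_hook (abs_hook v) - v \<in> free.span hook_relations" by (simp add: hook_eq_def)
    from *[OF this] show ?thesis by (simp add: hook_lift_def l.diff)
  qed
  show "hook_lift scl g (hook_symb a L) = g (a, L)"
    by (simp add: hook_symb_def ** lin_ext_single[OF scl])
  show "module_hom hook_scale scl (hook_lift scl g)"
  proof unfold_locales
    fix u v :: "('n, 'r) hook" and c
    obtain u' where [simp]: "u = abs_hook u'" using abs_hook_surj by blast
    obtain v' where [simp]: "v = abs_hook v'" using abs_hook_surj by blast
    show "hook_lift scl g (u + v) = hook_lift scl g u + hook_lift scl g v"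
      by (simp add: ** plus_hook.abs_eq l.add)
    show "hook_lift scl g (hook_scale c v) = scl c (hook_lift scl g v)"
      by (simp add: ** hook_scale.abs_eq l.scale)
  qed
qed


definition hook_module :: "nat \<Rightarrow> nat \<Rightarrow> ('n, 'r::comm_ring_1) hook set" where
  "hook_module d i = hook.span {hook_symb a L | a L. valid_symb a L \<and> length a = i \<and> card L = d - 1}"

text \<open>
  The shift \<open>R(-d-i+1)\<close> puts the generators of shape \<open>(i, d - 1)\<close> in degree \<open>i + (d - 1)\<close>.
\<close>

definition hook_homogeneous :: "nat \<Rightarrow> ('n::finite, ('n, 'k::field) mpoly) hook set" where
  "hook_homogeneous m = {abs_hook v | v.
     \<forall>(a, L)\<in>Poly_Mapping.keys v. \<forall>t\<in>Poly_Mapping.keys (Poly_Mapping.lookup v (a, L)).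
       mon_degree t + (length a + card L) = m}"


section \<open>The differentials\<close>

text \<open>
  List positions start at 0, so \<open>(-1)\<^bsup>i-j\<^esup> x\<^bsub>a\<^sub>j\<^esub>\<close> with \<open>1 \<le> j \<le> i\<close> is written
  \<open>(-1) ^ (length a - Suc j) * X (a ! j)\<close> with \<open>j < length a\<close>.  One map \<open>hook_diff\<close> restricts to
  \<open>\<partial>\<^sub>i\<close> for all \<open>i > 1\<close> and all \<open>d\<close>, and \<open>hook_aug\<close> restricts to \<open>\<partial>\<^sub>1\<close>.
\<close>

definition remove_nth :: "nat \<Rightarrow> 'a list \<Rightarrow> 'a list" where
  "remove_nth j a = take j a @ drop (Suc j) a"

definition diff_symb :: "'n symb \<Rightarrow> ('n, ('n, 'k::field) mpoly) hook" where
  "diff_symb = (\<lambda>(a, L).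
     if length a > 1 then
       (\<Sum>j<length a. hook_scale ((-1) ^ (length a - Suc j) * X (a ! j)) (hook_symb (remove_nth j a) L))
     else 0)"

definition aug_symb :: "'n symb \<Rightarrow> ('n, 'k::field) mpoly" where
  "aug_symb = (\<lambda>(a, L). if length a = 1 then X (hd a) * sqfree_mon L else 0)"

definition hook_diff :: "('n, ('n, 'k::field) mpoly) hook \<Rightarrow> ('n, ('n, 'k) mpoly) hook" where
  "hook_diff = hook_lift hook_scale diff_symb"

definition hook_aug :: "('n, ('n, 'k::field) mpoly) hook \<Rightarrow> ('n, 'k) mpoly" where
  "hook_aug = hook_lift (*) aug_symb"

lemma diff_symb_alternating:
  assumes valid: "valid_symb (xs @ p # q # ys) L"
  shows "diff_symb (xs @ q # p # ys, L) =
    - (diff_symb (xs @ p # q # ys, L) :: ('n, ('n, 'k::field) mpoly) hook)"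
proof -
  define a where "a = xs @ p # q # ys"
  define a' where "a' = xs @ q # p # ys"
  define l where "l = length xs"
  define n where "n = length a"
  define \<sigma> where "\<sigma> j = (if j = l then Suc l else if j = Suc l then l else j)" for j
  have n: "length a = n" "length a' = n" "n = l + 2 + length ys"
    by (auto simp: n_def a_def a'_def l_def)
  let ?T = "\<lambda>a j. hook_scale ((-1) ^ (n - Suc j) * X (a ! j)) (hook_symb (remove_nth j a) L)
     :: ('n, ('n, 'k) mpoly) hook"
  have T_swap: "?T a' (\<sigma> j) = - ?T a j" if "j < n" for j
  proof -
    consider "j < l" | "j = l" | "j = Suc l" | "j \<ge> l + 2" by linarith
    then show ?thesis
    proof cases
      case 1
      have r: "remove_nth j a = remove_nth j xs @ p # q # ys"
        "remove_nth j a' = remove_nth j xs @ q # p # ys"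
        using 1 by (auto simp: remove_nth_def a_def a'_def l_def)
      have v: "valid_symb (remove_nth j xs @ p # q # ys) L"
        using valid 1 set_take_subset[of j xs] set_drop_subset[of "Suc j" xs]
          set_take_disj_set_drop_if_distinct[of xs j "Suc j"]
        unfolding valid_symb_def remove_nth_def by auto
      have "a' ! j = a ! j" "\<sigma> j = j"
        using 1 by (auto simp: \<sigma>_def a_def a'_def l_def nth_append)
      then show ?thesis by (simp add: r hook_symb_alternating[OF v])
    next
      case 2
      have "remove_nth (Suc l) a' = xs @ q # ys" "remove_nth l a = xs @ q # ys"
        by (auto simp: remove_nth_def a_def a'_def l_def)
      moreover have "n - Suc l = Suc (n - Suc (Suc l))" using n by simp
      ultimately show ?thesis using 2
        by (simp add: \<sigma>_def a_def a'_def l_def nth_append)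
    next
      case 3
      have "remove_nth l a' = xs @ p # ys" "remove_nth (Suc l) a = xs @ p # ys"
        by (auto simp: remove_nth_def a_def a'_def l_def)
      moreover have "n - Suc l = Suc (n - Suc (Suc l))" using n by simp
      ultimately show ?thesis using 3
        by (simp add: \<sigma>_def a_def a'_def l_def nth_append)
    next
      case 4
      then obtain k where "j = l + 2 + k" using le_Suc_ex by blast
      then have k: "j = l + Suc (Suc k)" by simp
      have r: "remove_nth j a = xs @ p # q # remove_nth k ys"
        "remove_nth j a' = xs @ q # p # remove_nth k ys"
        by (auto simp: k remove_nth_def a_def a'_def l_def numeral_3_eq_3)
      have v: "valid_symb (xs @ p # q # remove_nth k ys) L"
        using valid set_take_subset[of k ys] set_drop_subset[of "Suc k" ys]
          set_take_disj_set_drop_if_distinct[of ys k "Suc k"]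
        unfolding valid_symb_def remove_nth_def by auto
      have "a' ! j = a ! j" "\<sigma> j = j"
        using 4 by (auto simp: k \<sigma>_def a_def a'_def l_def nth_append)
      then show ?thesis by (simp add: r hook_symb_alternating[OF v])
    qed
  qed
  have "(\<Sum>j<n. ?T a' j) = (\<Sum>j<n. ?T a' (\<sigma> j))"
    by (rule sum.reindex_bij_witness[of _ \<sigma> \<sigma>]) (auto simp: \<sigma>_def n)
  also have "\<dots> = - (\<Sum>j<n. ?T a j)" by (simp add: T_swap sum_negf)
  finally show ?thesis using n
    by (simp add: diff_symb_def flip: a_def a'_def)
qed

lemma hook_symb_move_front:
  assumes "valid_symb (xs @ p # ys) L"
  shows "(hook_symb (xs @ p # ys) L :: ('n, 'r::comm_ring_1) hook) =
    hook_scale ((-1) ^ length xs) (hook_symb (p # xs @ ys) L)"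
  using assms
proof (induction xs arbitrary: ys rule: rev_induct)
  case Nil
  then show ?case by simp
next
  case (snoc x xs)
  have v: "valid_symb (xs @ p # x # ys) L" using snoc.prems by (auto simp: valid_symb_def)
  show ?case using hook_symb_alternating[OF v, where 'r='r] snoc.IH[OF v] by simp
qed

lemma valid_symb_exchange:
  assumes "valid_symb a L" "b \<in> L" "m < length a"
  shows "valid_symb (a[m := b]) (insert (a ! m) (L - {b}))"
proof -
  have "a ! m \<in> set a" "b \<notin> set a" using assms by (auto simp: valid_symb_def)
  have "distinct (a[m := b])" using assms by (auto simp: valid_symb_def intro: distinct_list_update)
  moreover have "a ! m \<notin> set (a[m := b])"
    using assms \<open>a ! m \<in> set a\<close> \<open>b \<notin> set a\<close>
    by (auto simp: valid_symb_def in_set_conv_nth[of _ "a[m := b]"] nth_list_update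
        nth_eq_iff_index_eq split: if_splits)
  moreover have "set (a[m := b]) \<subseteq> insert b (set a)" by (rule set_update_subset_insert)
  ultimately show ?thesis using assms by (auto simp: valid_symb_def)
qed

lemma nth_remove_nth:
  "j < length a \<Longrightarrow> m < length a - 1 \<Longrightarrow>
    remove_nth j a ! m = a ! (if m < j then m else Suc m)"
  by (auto simp: remove_nth_def nth_append min_def)

lemma length_remove_nth: "j < length a \<Longrightarrow> length (remove_nth j a) = length a - 1"
  by (auto simp: remove_nth_def)

lemma valid_symb_remove_nth:
  assumes "valid_symb a L" "length a > 1" "j < length a"
  shows "valid_symb (remove_nth j a) L"
  using assms set_take_subset[of j a] set_drop_subset[of "Suc j" a]
    set_take_disj_set_drop_if_distinct[of a j "Suc j"]
  by (auto simp: valid_symb_def remove_nth_def)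

lemma remove_nth_list_update_same: "remove_nth j (a[j := b]) = remove_nth j a"
  by (simp add: remove_nth_def)

lemma remove_nth_list_update:
  assumes "j < length a" "m < length a - 1"
  shows "remove_nth j (a[(if m < j then m else Suc m) := b]) = (remove_nth j a)[m := b]"
  using assms
  by (intro nth_equalityI) (auto simp: length_remove_nth nth_remove_nth nth_list_update)

lemma diff_symb_straightening:
  assumes valid: "valid_symb a L" and b: "b \<in> L"
  shows "diff_symb (a, L) = (\<Sum>m<length a.
    (diff_symb (a[m := b], insert (a ! m) (L - {b})) :: ('n, ('n, 'k::field) mpoly) hook))"
proof (cases "length a > 1")
  case False
  then show ?thesis by (simp add: diff_symb_def)
next
  case True
  define n where "n = length a"
  define c :: "nat \<Rightarrow> ('n, 'k) mpoly" where "c j = (-1) ^ (n - Suc j)" for j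
  define E where "E m = insert (a ! m) (L - {b})" for m
  let ?U = "\<lambda>j m. hook_symb (remove_nth j (a[m := b])) (E m) :: ('n, ('n, 'k) mpoly) hook"
  let ?h = "\<lambda>j m. if m < j then m else Suc m"
  have off: "(\<Sum>m\<in>{..<n} - {j}. ?U j m) = hook_symb (remove_nth j a) L" if j: "j < n" for j
  proof -
    have "hook_symb (remove_nth j a) L =
      (\<Sum>m<n - 1. hook_symb ((remove_nth j a)[m := b]) (insert (remove_nth j a ! m) (L - {b}))
        :: ('n, ('n, 'k) mpoly) hook)"
      using hook_symb_straightening[OF valid_symb_remove_nth[OF valid True] b, of j] j
      by (simp add: length_remove_nth n_def)
    also have "\<dots> = (\<Sum>m<n - 1. ?U j (?h j m))"
    proof (rule sum.cong[OF refl])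
      fix m assume m: "m \<in> {..<n - 1}"
      have 1: "(remove_nth j a)[m := b] = remove_nth j (a[?h j m := b])"
        using remove_nth_list_update[of j a m b] j m by (simp add: n_def)
      have 2: "remove_nth j a ! m = a ! ?h j m"
        using nth_remove_nth[of j a m] j m by (simp add: n_def)
      show "hook_symb ((remove_nth j a)[m := b]) (insert (remove_nth j a ! m) (L - {b})) = ?U j (?h j m)"
        unfolding 1 2 E_def ..
    qed
    also have "\<dots> = (\<Sum>m\<in>{..<n} - {j}. ?U j m)"
      using j by (intro sum.reindex_bij_witness[of _ "\<lambda>m. if m < j then m else m - 1" "?h j"])
        (auto split: if_splits)
    finally show ?thesis by simp
  qed
  have diag: "(\<Sum>m<n. hook_scale (c m) (hook_symb (remove_nth m a) (E m))) = (0 :: ('n, ('n, 'k) mpoly) hook)"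
  proof -
    obtain x a' where a: "a = x # a'" using True by (cases a) auto
    have n: "n = Suc (length a')" by (simp add: n_def a)
    have v: "valid_symb a' (E 0)" using valid True by (auto simp: a valid_symb_def E_def)
    have "hook_symb a' (E 0) = (\<Sum>m<length a'. hook_symb (a'[m := x]) (insert (a' ! m) (E 0 - {x}))
        :: ('n, ('n, 'k) mpoly) hook)"
      by (rule hook_symb_straightening[OF v]) (simp add: E_def a)
    also have "\<dots> = (\<Sum>m<length a'. hook_scale ((-1) ^ m) (hook_symb (remove_nth (Suc m) a) (E (Suc m))))"
    proof (rule sum.cong[OF refl])
      fix m assume m: "m \<in> {..<length a'}"
      have x: "x \<notin> L - {b}" using valid by (auto simp: a valid_symb_def)
      have 1: "insert (a' ! m) (E 0 - {x}) = E (Suc m)" using x by (auto simp: E_def a)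
      have 2: "a'[m := x] = take m a' @ x # drop (Suc m) a'" using m by (simp add: upd_conv_take_nth_drop)
      have "valid_symb (a'[m := x]) (insert (a' ! m) (E 0 - {x}))"
        using m by (intro valid_symb_exchange[OF v]) (auto simp: E_def a)
      then have 3: "valid_symb (take m a' @ x # drop (Suc m) a') (E (Suc m))" unfolding 1 2 .
      show "hook_symb (a'[m := x]) (insert (a' ! m) (E 0 - {x})) =
        (hook_scale ((-1) ^ m) (hook_symb (remove_nth (Suc m) a) (E (Suc m))) :: ('n, ('n, 'k) mpoly) hook)"
        unfolding 1 2 hook_symb_move_front[OF 3] using m by (simp add: remove_nth_def a min_def)
    qed
    finally have *: "hook_symb a' (E 0) = (\<Sum>m<length a'.
        hook_scale ((-1) ^ m) (hook_symb (remove_nth (Suc m) a) (E (Suc m))) :: ('n, ('n, 'k) mpoly) hook)" .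
    have sg: "c 0 * (-1) ^ m = - c (Suc m)" if "m < length a'" for m
    proof -
      have "length a' = Suc (length a' - Suc m) + m" using that by simp
      then have "c 0 = (-1) ^ (Suc (length a' - Suc m) + m)" 
        unfolding c_def n by (metis diff_Suc_Suc diff_zero)
      then have "c 0 * (-1) ^ m = - ((-1) ^ (length a' - Suc m) * ((-1) ^ m * (-1) ^ m))"
        by (simp add: power_add algebra_simps)
      then show ?thesis unfolding c_def n by (simp flip: power_mult_distrib)
    qed
    have "(\<Sum>m<n. hook_scale (c m) (hook_symb (remove_nth m a) (E m)))
      = hook_scale (c 0) (hook_symb a' (E 0)) + (\<Sum>m<length a'. hook_scale (c (Suc m))
         (hook_symb (remove_nth (Suc m) a) (E (Suc m))) :: ('n, ('n, 'k) mpoly) hook)"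
      unfolding n sum.lessThan_Suc_shift by (simp add: remove_nth_def a)
    also have "\<dots> = 0"
      unfolding * hook.scale_sum_right hook.scale_scale
      by (simp add: sg sum_negf)
    finally show ?thesis .
  qed
  have "(\<Sum>m<n. diff_symb (a[m := b], E m) :: ('n, ('n, 'k) mpoly) hook) =
    (\<Sum>m<n. \<Sum>j<n. hook_scale (c j * X (a[m := b] ! j)) (?U j m))"
    using True by (simp add: diff_symb_def n_def c_def)
  also have "\<dots> = (\<Sum>j<n. \<Sum>m<n. hook_scale (c j * X (a[m := b] ! j)) (?U j m))"
    by (rule sum.swap)
  also have "\<dots> = (\<Sum>j<n. hook_scale (c j * X b) (hook_symb (remove_nth j a) (E j))
      + hook_scale (c j * X (a ! j)) (hook_symb (remove_nth j a) L))"
  proof (rule sum.cong[OF refl])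
    fix j assume "j \<in> {..<n}"
    then have j: "j < n" by simp
    have "(\<Sum>m<n. hook_scale (c j * X (a[m := b] ! j)) (?U j m)) =
      hook_scale (c j * X b) (hook_symb (remove_nth j a) (E j)) +
      (\<Sum>m\<in>{..<n} - {j}. hook_scale (c j * X (a[m := b] ! j)) (?U j m))"
      using j by (subst sum.remove[of _ j]) (auto simp: n_def remove_nth_list_update_same)
    also have "(\<Sum>m\<in>{..<n} - {j}. hook_scale (c j * X (a[m := b] ! j)) (?U j m)) =
      (\<Sum>m\<in>{..<n} - {j}. hook_scale (c j * X (a ! j)) (?U j m))"
      by (intro sum.cong) auto
    also have "\<dots> = hook_scale (c j * X (a ! j)) (hook_symb (remove_nth j a) L)"
      using off[OF j] by (simp flip: hook.scale_sum_right)
    finally show "(\<Sum>m<n. hook_scale (c j * X (a[m := b] ! j)) (?U j m)) =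
      hook_scale (c j * X b) (hook_symb (remove_nth j a) (E j))
      + hook_scale (c j * X (a ! j)) (hook_symb (remove_nth j a) L)" .
  qed
  also have "\<dots> = hook_scale (X b) (\<Sum>j<n. hook_scale (c j) (hook_symb (remove_nth j a) (E j)))
      + diff_symb (a, L)"
    using True
    by (simp add: sum.distrib diff_symb_def hook.scale_sum_right mult.commute flip: n_def c_def)
  also have "\<dots> = diff_symb (a, L)" by (simp add: diag)
  finally show ?thesis by (simp add: n_def E_def)
qed

lemma module_hom_hook_diff:
    "module_hom hook_scale hook_scale
       (hook_diff :: ('n, ('n, 'k::field) mpoly) hook \<Rightarrow> ('n, ('n, 'k) mpoly) hook)"
  and hook_diff_symb: "hook_diff (hook_symb a L) = (diff_symb (a, L) :: ('n, ('n, 'k) mpoly) hook)"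
  unfolding hook_diff_def
  by (rule hook_lift[OF hook.module_axioms diff_symb_alternating diff_symb_straightening]; assumption)+

lemma sqfree_mon_exchange:
  fixes L :: "'n::finite set"
  assumes "x \<notin> L" "b \<in> L"
  shows "(X x * sqfree_mon L :: ('n, 'k::field) mpoly) = X b * sqfree_mon (insert x (L - {b}))"
proof -
  have "X x * sqfree_mon L = (\<Prod>i\<in>insert x L. X i :: ('n, 'k) mpoly)"
    using assms by (simp add: sqfree_mon_def)
  also have "insert x L = insert b (insert x (L - {b}))" using assms by auto
  also have "(\<Prod>i\<in>\<dots>. X i :: ('n, 'k) mpoly) = X b * sqfree_mon (insert x (L - {b}))"
    using assms unfolding sqfree_mon_def by (subst prod.insert) auto
  finally show ?thesis .
qed

lemma module_hom_hook_aug: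
    "module_hom hook_scale (*) (hook_aug :: ('n::finite, ('n, 'k::field) mpoly) hook \<Rightarrow> ('n, 'k) mpoly)"
  and hook_aug_symb: "hook_aug (hook_symb a L) = (aug_symb (a, L) :: ('n, 'k) mpoly)"
proof -
  have alt: "aug_symb (xs @ q # p # ys, L) = - (aug_symb (xs @ p # q # ys, L) :: ('n, 'k) mpoly)"
    for xs ys :: "'n list" and p q L by (simp add: aug_symb_def)
  have str: "(aug_symb (a, L) :: ('n, 'k) mpoly) =
      (\<Sum>m<length a. aug_symb (a[m := b], insert (a ! m) (L - {b})))"
    if "valid_symb a L" "b \<in> L" for a L and b :: 'n
  proof (cases "length a = 1")
    case True
    then obtain x where "a = [x]" by (auto simp: length_Suc_conv)
    then show ?thesis using that by (simp add: aug_symb_def valid_symb_def sqfree_mon_exchange)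
  qed (simp add: aug_symb_def)
  show "module_hom hook_scale (*) (hook_aug :: ('n::finite, ('n, 'k::field) mpoly) hook \<Rightarrow> ('n, 'k) mpoly)"
    "hook_aug (hook_symb a L) = (aug_symb (a, L) :: ('n, 'k) mpoly)"
    unfolding hook_aug_def
    by (rule hook_lift[OF module_mult alt str]; assumption)+
qed


section \<open>The subcomplex attached to \<open>I\<^sub>1, \<dots>, I\<^sub>r\<close>\<close>

definition f_symb :: "'n::linorder set \<Rightarrow> 'n set \<Rightarrow> ('n, 'r::comm_ring_1) hook" where
  "f_symb A L = hook_symb (sorted_list_of_set A) L"

definition standard :: "'n::linorder set \<Rightarrow> 'n set \<Rightarrow> bool" where
  "standard A L \<longleftrightarrow> A \<inter> L = {} \<and> (L = {} \<or> Min A < Min L)"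

text \<open>\<open>sgn_in a A\<close> is \<open>sgn (a \<in> A)\<close>: the \<open>j\<close>-th smallest element of \<open>A\<close> has \<open>j - 1\<close> elements below it.\<close>

definition sgn_in :: "'n::linorder \<Rightarrow> 'n set \<Rightarrow> 'r::comm_ring_1" where
  "sgn_in a A = (-1) ^ card {b\<in>A. b < a}"

text \<open>
  In the third set, \<open>x\<close> is \<open>i\<^bsub>sp\<^esub>\<close> with \<open>p > 1\<close>, and \<open>i\<^bsub>s1\<^esub>\<close> is \<open>Min (I s)\<close>.
\<close>

definition sub_generators ::
  "nat \<Rightarrow> nat \<Rightarrow> (nat \<Rightarrow> 'n::{finite,linorder} set) \<Rightarrow> nat \<Rightarrow> ('n, ('n, 'k::field) mpoly) hook set" where
  "sub_generators d r I i =
     {f_symb A L | A L. card A = i \<and> card L = d - 1 \<and> standard A L \<and>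
        (\<forall>s\<in>{1..r}. \<forall>x\<in>I s. L \<noteq> I s - {x})} \<union>
     {f_symb A (I s - {x}) | A s x. s \<in> {1..r} \<and> x \<in> I s \<and> card A = i \<and>
        standard A (I s - {x}) \<and> x \<notin> A} \<union>
     {hook_scale (sgn_in x (insert x J)) (f_symb (insert x J) (I s - {x}))
        - hook_scale (sgn_in (Min (I s)) (insert (Min (I s)) J))
            (f_symb (insert (Min (I s)) J) (I s - {Min (I s)}))
      | J s x. s \<in> {1..r} \<and> x \<in> I s \<and> x \<noteq> Min (I s) \<and> card J = i - 1 \<and> J \<inter> I s = {} \<and>
        standard (insert x J) (I s - {x}) \<and> standard (insert (Min (I s)) J) (I s - {Min (I s)})}"

definition sub_module ::
  "nat \<Rightarrow> nat \<Rightarrow> (nat \<Rightarrow> 'n::{finite,linorder} set) \<Rightarrow> nat \<Rightarrow> ('n, ('n, 'k::field) mpoly) hook set" where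
  "sub_module d r I i = hook.span (sub_generators d r I i)"

lemma sub_module_subset:
  fixes I :: "nat \<Rightarrow> 'n::{finite,linorder} set"
  assumes "1 \<le> i" and "\<forall>s\<in>{1..r}. card (I s) = d"
  shows "(sub_module d r I i :: ('n, ('n, 'k::field) mpoly) hook set) \<subseteq> hook_module d i"
proof -
  have f: "(f_symb A L :: ('n, ('n, 'k) mpoly) hook) \<in> hook_module d i"
    if "card A = i" "card L = d - 1" "standard A L" for A L :: "'n set"
  proof -
    have "A \<noteq> {}" using that(1) assms(1) by auto
    then have "valid_symb (sorted_list_of_set A) L" "length (sorted_list_of_set A) = i"
      using that by (simp_all add: valid_symb_def standard_def)
    with that(2) show ?thesis unfolding hook_module_def f_symb_def
      by (intro hook.span_base) blast
  qed
  have mod: "hook.subspace (hook_module d i :: ('n, ('n, 'k) mpoly) hook set)"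
    unfolding hook_module_def by (rule hook.subspace_span)
  have "sub_generators d r I i \<subseteq> (hook_module d i :: ('n, ('n, 'k) mpoly) hook set)"
    unfolding sub_generators_def
  proof (intro Un_least subsetI; elim CollectE exE conjE)
    fix u :: "('n, ('n, 'k) mpoly) hook" and A s x
    assume "u = f_symb A (I s - {x})" "s \<in> {1..r}" "x \<in> I s" "card A = i" "standard A (I s - {x})"
    moreover from this have "card (I s - {x}) = d - 1" using assms(2) by simp
    ultimately show "u \<in> hook_module d i" by (simp add: f)
  next
    fix u :: "('n, ('n, 'k) mpoly) hook" and J s x
    assume u: "u = hook_scale (sgn_in x (insert x J)) (f_symb (insert x J) (I s - {x}))
        - hook_scale (sgn_in (Min (I s)) (insert (Min (I s)) J))
            (f_symb (insert (Min (I s)) J) (I s - {Min (I s)}))"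
      and s: "s \<in> {1..r}" and x: "x \<in> I s" and J: "card J = i - 1" "J \<inter> I s = {}"
      and st: "standard (insert x J) (I s - {x})" "standard (insert (Min (I s)) J) (I s - {Min (I s)})"
    have m: "Min (I s) \<in> I s" using x by (intro Min_in) auto
    have "card (insert y J) = i" "card (I s - {y}) = d - 1" if "y \<in> I s" for y
      using that J s assms by (auto simp: card_insert_if)
    then show "u \<in> hook_module d i"
      unfolding u using x m st
      by (intro hook.subspace_diff[OF mod] hook.subspace_scale[OF mod] f) auto
  qed (simp add: f)
  then show ?thesis
    unfolding sub_module_def by (intro hook.span_minimal mod)
qed

definition complement_ideal ::
  "nat \<Rightarrow> nat \<Rightarrow> (nat \<Rightarrow> 'n set) \<Rightarrow> ('n, 'k::field) mpoly set" where
  "complement_ideal d r I = ideal_generated {sqfree_mon A | A. card A = d \<and> A \<notin> I ` {1..r}}"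

end

theory Submission
  imports Defs
begin

text \<open>
  Sending \<open>f\<^sub>A \<otimes> f\<^sup>L\<close> to the signed sum of the pairs \<open>(A - y, L \<union> y)\<close> with \<open>y \<in> A\<close> respects the
  straightening relations and embeds the hook module of shape \<open>(i, d - 1)\<close> into the free module on
  the disjoint pairs \<open>(B, M)\<close> with \<open>card B = i - 1\<close> and \<open>card M = d\<close>.  A standard symbol is detected
  by the coordinate at \<open>(A - Min A, L \<union> Min A)\<close>, so the standard symbols form a basis.  The image
  is the kernel of the exchange map, which moves elements of \<open>B\<close> to \<open>M\<close>, and up to sign the
  differential becomes, for each \<open>M\<close>, the Koszul differential of the variables outside \<open>M\<close>.  The
  exchange map and the Koszul differential anticommute and are both exact, each being contracted by
  a cone with apex the smallest vertex; downward induction on \<open>d\<close> shows that the kernel of the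
  exchange map is exact under the Koszul differential.

  The generators (1)--(3) span precisely the elements whose coordinates at \<open>M = I\<^sub>s\<close> vanish for all
  \<open>s\<close>: since \<open>card (I\<^sub>s \<inter> I\<^sub>t) \<le> d - 2\<close>, the set \<open>I\<^sub>s - x\<close> determines \<open>s\<close>, and therefore the symbols
  \<open>f\<^bsub>J \<union> Min I\<^sub>s\<^esub> \<otimes> f\<^bsup>I\<^sub>s - Min I\<^sub>s\<^esup>\<close> realise arbitrary values of these coordinates independently.
  A preimage of a cycle under the differential has a Koszul cycle as its coordinates at \<open>I\<^sub>s\<close>, and
  subtracting a suitable boundary makes them vanish.
\<close>


section \<open>The exchange map and the Koszul differential\<close>

lemma sgn_in_insert:
  fixes b :: "'n::{finite,linorder}"
  assumes "c \<notin> B"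
  shows "(sgn_in b (insert c B) :: 'r::comm_ring_1) = (if c < b then - sgn_in b B else sgn_in b B)"
proof -
  have "{x \<in> insert c B. x < b} = (if c < b then insert c {x \<in> B. x < b} else {x \<in> B. x < b})"
    by auto
  then show ?thesis using assms by (simp add: sgn_in_def)
qed

lemma sgn_in_insert_same [simp]: "sgn_in b (insert b B) = sgn_in b B"
proof -
  have "{x \<in> insert b B. x < b} = {x \<in> B. x < b}" by auto
  then show ?thesis by (simp add: sgn_in_def)
qed

lemma sgn_in_mult_self [simp]: "sgn_in b B * sgn_in b B = (1 :: 'r::comm_ring_1)"
  by (simp add: sgn_in_def flip: power_mult_distrib)

lemma sgn_in_mult_self_left [simp]: "sgn_in b B * (sgn_in b B * c) = (c :: 'r::comm_ring_1)"
  by (simp flip: mult.assoc)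

text \<open>Exactly one of \<open>b\<close> and \<open>c\<close> lies below the other, so exactly
  one of the two insertions flips a sign. The cancellations between the two orders of removing
  elements rest on this identity.\<close>

lemma sgn_in_swap:
  fixes b c :: "'n::{finite,linorder}"
  assumes "b \<noteq> c" "b \<notin> B" "c \<notin> B"
  shows "sgn_in b B * sgn_in c (insert b B) = - (sgn_in c B * sgn_in b (insert c B) :: 'r::comm_ring_1)"
  using assms by (cases "b < c") (auto simp: sgn_in_insert mult.commute)

lemma sgn_in_Min:
  fixes b :: "'n::{finite,linorder}"
  assumes "\<And>c. c \<in> B \<Longrightarrow> b \<le> c"
  shows "sgn_in b B = (1 :: 'r::comm_ring_1)"
proof -
  have "{x \<in> B. x < b} = {}" using assms by force
  then show ?thesis unfolding sgn_in_def by (simp only: card.empty power_0)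
qed

lemma sgn_in_empty [simp]: "sgn_in b {} = 1"
  by (simp add: sgn_in_def)

text \<open>The terms with \<open>c < b\<close> are, after swapping the names, the negatives of
  those with \<open>b < c\<close>. Nothing is divided by 2, so characteristic 2 is covered.\<close>

lemma sum_antisym:
  fixes f :: "'n::linorder \<Rightarrow> 'n \<Rightarrow> 'r::ab_group_add"
  assumes "finite S" "\<And>b c. b \<in> S \<Longrightarrow> c \<in> S \<Longrightarrow> b \<noteq> c \<Longrightarrow> f b c = - f c b"
  shows "(\<Sum>b\<in>S. \<Sum>c\<in>S - {b}. f b c) = 0"
proof -
  have "(\<Sum>c\<in>S - {b}. f b c) = (\<Sum>c\<in>{c \<in> S. b < c}. f b c) + (\<Sum>c\<in>{c \<in> S. c < b}. f b c)" for b
    using assms(1) by (subst sum.union_disjoint[symmetric]) (auto intro!: sum.cong)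
  moreover have "(\<Sum>b\<in>S. \<Sum>c\<in>{c \<in> S. c < b}. f b c) = (\<Sum>c\<in>S. \<Sum>b\<in>{b \<in> S. c < b}. f b c)"
    by (rule sum.swap_restrict) (use assms in auto)
  moreover have "\<dots> = (\<Sum>c\<in>S. \<Sum>b\<in>{b \<in> S. c < b}. - f c b)"
    by (intro sum.cong refl assms(2)) auto
  ultimately show ?thesis by (simp add: sum.distrib sum_negf)
qed

text \<open>\<open>w B M\<close> is the coefficient of \<open>w\<close> at the basis element indexed by \<open>(B, M)\<close>.\<close>

type_synonym ('n, 'r) chain_fun = "'n set \<Rightarrow> 'n set \<Rightarrow> 'r"

text \<open>A total function with a support condition stands for an element of the free module on
  the disjoint pairs of the given sizes; as \<open>'n\<close> is finite, every such function is a
  finite combination of basis elements.\<close>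

definition chain :: "nat \<Rightarrow> nat \<Rightarrow> ('n, 'r::comm_ring_1) chain_fun \<Rightarrow> bool" where
  "chain p d w \<longleftrightarrow> (\<forall>B M. w B M \<noteq> 0 \<longrightarrow> B \<inter> M = {} \<and> card B = p \<and> card M = d)"

text \<open>The coefficient at \<open>(B, M)\<close> collects the sources from which an element
  \<open>b\<close> is moved into \<open>M\<close>. Since \<open>b\<close> ranges only over
  \<open>M - B\<close>, \<open>exch_exch\<close> and \<open>koszul_exch\<close> hold for arbitrary
  functions and not just for chains.\<close>

definition exch :: "('n::{finite,linorder}, 'r::comm_ring_1) chain_fun \<Rightarrow> ('n, 'r) chain_fun" where
  "exch w B M = (\<Sum>b\<in>M - B. sgn_in b B * w (insert b B) (M - {b}))"

definition koszul :: "('n::{finite,linorder}, ('n, 'k::field) mpoly) chain_fun \<Rightarrow> ('n, ('n, 'k) mpoly) chain_fun" where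
  "koszul w B M = (\<Sum>b\<in>- (B \<union> M). sgn_in b B * X b * w (insert b B) M)"

lemma chainD: "chain p d w \<Longrightarrow> w B M \<noteq> 0 \<Longrightarrow> B \<inter> M = {} \<and> card B = p \<and> card M = d"
  by (auto simp: chain_def)

lemma chain_0 [simp]: "chain p d (\<lambda>B M. 0)"
  by (simp add: chain_def)

lemma chain_add: "chain p d w \<Longrightarrow> chain p d v \<Longrightarrow> chain p d (\<lambda>B M. w B M + v B M)"
  unfolding chain_def by (metis add.right_neutral)

lemma exch_0 [simp]: "exch (\<lambda>B M. 0) = (\<lambda>B M. 0)"
  by (simp add: exch_def fun_eq_iff)

lemma koszul_0 [simp]: "koszul (\<lambda>B M. 0) = (\<lambda>B M. 0)"
  by (simp add: koszul_def fun_eq_iff)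

lemma exch_add: "exch (\<lambda>B M. w B M + v B M) B M = exch w B M + exch v B M"
  by (simp add: exch_def algebra_simps sum.distrib)

lemma koszul_add: "koszul (\<lambda>B M. w B M + v B M) B M = koszul w B M + koszul v B M"
  by (simp add: koszul_def algebra_simps sum.distrib)

lemma chain_exch:
  fixes w :: "('n::{finite,linorder}, 'r::comm_ring_1) chain_fun"
  assumes "chain (Suc p) d w"
  shows "chain p (Suc d) (exch w)"
  unfolding chain_def
proof (intro allI impI)
  fix B M
  assume "exch w B M \<noteq> 0"
  then obtain b where b: "b \<in> M - B" "w (insert b B) (M - {b}) \<noteq> 0"
    unfolding exch_def by (metis (mono_tags, lifting) mult_zero_right sum.neutral)
  with chainD[OF assms b(2)] show "B \<inter> M = {} \<and> card B = p \<and> card M = Suc d"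
    using card_Suc_Diff1[of M b] by (auto simp: card_insert_if)
qed

lemma koszul_chain_0:
  fixes w :: "('n::{finite,linorder}, ('n, 'k::field) mpoly) chain_fun"
  assumes "chain 0 d w"
  shows "koszul w = (\<lambda>B M. 0)"
proof -
  have "w (insert b B) M = 0" for b B M using chainD[OF assms, of "insert b B" M] by auto
  then show ?thesis by (simp add: koszul_def fun_eq_iff)
qed

lemma chain_koszul:
  fixes w :: "('n::{finite,linorder}, ('n, 'k::field) mpoly) chain_fun"
  assumes "chain (Suc p) d w"
  shows "chain p d (koszul w)"
  unfolding chain_def
proof (intro allI impI)
  fix B M
  assume "koszul w B M \<noteq> 0"
  then obtain b where b: "b \<in> - (B \<union> M)" "w (insert b B) M \<noteq> 0"
    unfolding koszul_def by (metis (mono_tags, lifting) mult_zero_right sum.neutral)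
  with chainD[OF assms b(2)] show "B \<inter> M = {} \<and> card B = p \<and> card M = d" by auto
qed

text \<open>Moving \<open>b\<close> and then \<open>c\<close> reaches the same pair as the other
  order, with the opposite sign.\<close>

lemma exch_exch:
  fixes w :: "('n::{finite,linorder}, 'r::comm_ring_1) chain_fun"
  shows "exch (exch w) = (\<lambda>B M. 0)"
proof (intro ext)
  fix B M :: "'n set"
  let ?f = "\<lambda>b c. sgn_in b B * (sgn_in c (insert b B) * w (insert c (insert b B)) (M - {b} - {c}))"
  have "exch (exch w) B M = (\<Sum>b\<in>M - B. \<Sum>c\<in>M - B - {b}. ?f b c)"
  proof -
    have "M - {b} - insert b B = M - B - {b}" for b by auto
    then show ?thesis by (simp add: exch_def sum_distrib_left)
  qed
  also have "\<dots> = 0"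
  proof (rule sum_antisym)
    fix b c assume "b \<in> M - B" "c \<in> M - B" "b \<noteq> c"
    then show "?f b c = - ?f c b"
      using sgn_in_swap[of b c B, where 'r='r]
      by (simp add: insert_commute[of b c] Diff_insert2[symmetric] Diff_insert[symmetric] flip: mult.assoc)
  qed simp
  finally show "exch (exch w) B M = 0" .
qed

lemma koszul_koszul:
  fixes w :: "('n::{finite,linorder}, ('n, 'k::field) mpoly) chain_fun"
  shows "koszul (koszul w) = (\<lambda>B M. 0)"
proof (intro ext)
  fix B M :: "'n set"
  let ?f = "\<lambda>b c. sgn_in b B * X b * (sgn_in c (insert b B) * X c * w (insert c (insert b B)) M)"
  have "koszul (koszul w) B M = (\<Sum>b\<in>- (B \<union> M). \<Sum>c\<in>- (B \<union> M) - {b}. ?f b c)"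
  proof -
    have "- (insert b B \<union> M) = - (B \<union> M) - {b}" for b by auto
    then show ?thesis by (simp add: koszul_def sum_distrib_left)
  qed
  also have "\<dots> = 0"
  proof (rule sum_antisym)
    fix b c assume "b \<in> - (B \<union> M)" "c \<in> - (B \<union> M)" "b \<noteq> c"
    then have *: "sgn_in b B * sgn_in c (insert b B) = - (sgn_in c B * sgn_in b (insert c B) :: ('n, 'k) mpoly)"
      by (intro sgn_in_swap) auto
    have "?f b c = (sgn_in b B * sgn_in c (insert b B)) * (X b * X c * w (insert b (insert c B)) M)"
      by (simp add: insert_commute algebra_simps)
    also have "\<dots> = - ?f c b" unfolding * by (simp add: algebra_simps)
    finally show "?f b c = - ?f c b" .
  qed simp
  finally show "koszul (koszul w) B M = 0" .
qed

text \<open>\<open>y\<close> lies outside \<open>M\<close> and \<open>b\<close> inside, so removing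
  \<open>y\<close> and moving \<open>b\<close> do not interfere; the two orders differ only by the
  sign in \<open>sgn_in_swap\<close>.\<close>

lemma koszul_exch:
  fixes w :: "('n::{finite,linorder}, ('n, 'k::field) mpoly) chain_fun"
  shows "koszul (exch w) B M = - exch (koszul w) B M"
proof -
  let ?f = "\<lambda>y b. sgn_in y B * X y * (sgn_in b (insert y B) * w (insert b (insert y B)) (M - {b}))"
  let ?g = "\<lambda>y b. sgn_in b B * (sgn_in y (insert b B) * X y * w (insert y (insert b B)) (M - {b}))"
  have "koszul (exch w) B M = (\<Sum>y\<in>- (B \<union> M). \<Sum>b\<in>M - B. ?f y b)"
  proof -
    have "M - insert y B = M - B" if "y \<in> - (B \<union> M)" for y using that by auto
    then show ?thesis by (simp add: exch_def koszul_def sum_distrib_left)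
  qed
  also have "\<dots> = (\<Sum>y\<in>- (B \<union> M). \<Sum>b\<in>M - B. - ?g y b)"
  proof (intro sum.cong refl)
    fix y b assume "y \<in> - (B \<union> M)" "b \<in> M - B"
    then have *: "sgn_in y B * sgn_in b (insert y B) = - (sgn_in b B * sgn_in y (insert b B) :: ('n, 'k) mpoly)"
      by (intro sgn_in_swap) auto
    have "?f y b = (sgn_in y B * sgn_in b (insert y B)) * (X y * w (insert y (insert b B)) (M - {b}))"
      by (simp add: insert_commute algebra_simps)
    also have "\<dots> = - ?g y b" unfolding * by (simp add: algebra_simps)
    finally show "?f y b = - ?g y b" .
  qed
  also have "\<dots> = - (\<Sum>b\<in>M - B. \<Sum>y\<in>- (B \<union> M). ?g y b)"
    by (subst sum.swap) (simp add: sum_negf)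
  also have "\<dots> = - exch (koszul w) B M"
  proof -
    have "- (insert b B \<union> (M - {b})) = - (B \<union> M)" if "b \<in> M - B" for b using that by auto
    then show ?thesis by (simp add: exch_def koszul_def sum_distrib_left)
  qed
  finally show ?thesis .
qed

text \<open>The preimage is a cone over \<open>w\<close>: a pair whose smallest vertex
  \<open>m B M\<close> lies in \<open>B\<close> gets the value of \<open>w\<close> after this vertex
  is moved to \<open>M\<close>. An apex exists on the support of \<open>w\<close> because
  \<open>M\<close> has \<open>Suc d\<close> elements there.\<close>

lemma exch_exact:
  fixes w :: "('n::{finite,linorder}, 'r::comm_ring_1) chain_fun"
  assumes w: "chain p (Suc d) w" and cyc: "exch w = (\<lambda>B M. 0)"
  shows "\<exists>v. chain (Suc p) d v \<and> exch v = w"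
proof -
  \<comment> \<open>\<open>B \<union> M\<close> is invariant under \<open>exch\<close>, which is the boundary of the full simplex on \<open>B \<union> M\<close>\<close>
  define m where "m B M = Min (B \<union> M)" for B M :: "'n set"
  define v where "v B M = (if m B M \<in> B \<and> B \<inter> M = {} then w (B - {m B M}) (insert (m B M) M) else 0)" for B M
  have "chain (Suc p) d v"
    unfolding chain_def
  proof (intro allI impI)
    fix B M assume "v B M \<noteq> 0"
    then have *: "m B M \<in> B" "B \<inter> M = {}" "w (B - {m B M}) (insert (m B M) M) \<noteq> 0"
      by (auto simp: v_def split: if_splits)
    from chainD[OF w *(3)] *(1,2) show "B \<inter> M = {} \<and> card B = Suc p \<and> card M = d"
      using card_Suc_Diff1[of B "m B M"] by (auto simp: card_insert_if split: if_splits)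
  qed
  moreover have "exch v B M = w B M" for B M
  proof (cases "B \<inter> M = {} \<and> M \<noteq> {}")
    case False
    have 1: "w B M = 0" using chainD[OF w, of B M] False by (cases "w B M = 0") auto
    have 2: "v (insert b B) (M - {b}) = 0" if "b \<in> M - B" for b
      using that False by (auto simp: v_def)
    show ?thesis unfolding exch_def 1 by (simp add: 2)
  next
    case True
    define m' where "m' = m B M"
    have m': "m' \<in> B \<union> M" "\<And>c. c \<in> B \<union> M \<Longrightarrow> m' \<le> c"
      using True Min_in[of "B \<union> M"] unfolding m'_def m_def by (auto intro!: Min_le)
    have mm: "m (insert b B) (M - {b}) = m'" if "b \<in> M" for b
    proof -
      have "insert b B \<union> (M - {b}) = B \<union> M" using that by auto
      then show ?thesis by (simp add: m_def m'_def)
    qed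
    have MB: "M - B = M" using True by auto
    have vv: "v (insert b B) (M - {b}) = (if m' = b \<or> m' \<in> B then w (insert b B - {m'}) (insert m' (M - {b})) else 0)"
      if "b \<in> M" for b using that True by (auto simp: v_def mm)
    show ?thesis
    proof (cases "m' \<in> B")
      \<comment> \<open>Only \<open>b = m'\<close> puts the apex into the first set, and its sign is
        1.\<close>
      case False
      then have "m' \<in> M" using m' by auto
      have "exch v B M = (\<Sum>b\<in>M. if m' = b then w B M else 0)"
        unfolding exch_def MB
      proof (rule sum.cong[OF refl])
        fix b assume b: "b \<in> M"
        show "sgn_in b B * v (insert b B) (M - {b}) = (if m' = b then w B M else 0)"
          using b False m' True
          by (auto simp: vv sgn_in_Min insert_absorb)
      qed
      then show ?thesis using \<open>m' \<in> M\<close> by simp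
    next
      case mB: True
      then have mM: "m' \<notin> M" using True by auto
      let ?T = "\<lambda>b. sgn_in b (B - {m'}) * w (insert b (B - {m'})) (insert m' M - {b})"
      \<comment> \<open>The cycle condition at the pair with the apex moved to \<open>M\<close>
        expresses \<open>w B M\<close> by values with the apex in the second set.\<close>
      have "0 = exch w (B - {m'}) (insert m' M)" by (simp add: cyc)
      also have "\<dots> = (\<Sum>b\<in>insert m' M. ?T b)"
        unfolding exch_def using True mB mM by (intro sum.cong) auto
      also have "\<dots> = ?T m' + (\<Sum>b\<in>M. ?T b)" using mM by simp
      also have "?T m' = w B M"
        using mB mM sgn_in_Min[of "B - {m'}" m', where 'r='r] m'(2) by (simp add: insert_absorb)
      finally have "w B M = - (\<Sum>b\<in>M. ?T b)" by (simp add: eq_neg_iff_add_eq_0)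
      also have "\<dots> = exch v B M"
        unfolding exch_def MB sum_negf[symmetric]
      proof (rule sum.cong[OF refl])
        fix b assume b: "b \<in> M"
        \<comment> \<open>Putting the apex back into \<open>B\<close> places one more element below
          \<open>b\<close>, which supplies the minus sign.\<close>
        have "m' < b" using m'(2)[of b] b mM by (auto simp: order.strict_iff_order)
        then have "sgn_in b B = - (sgn_in b (B - {m'}) :: 'r)"
          using sgn_in_insert[of m' "B - {m'}" b, where 'r='r] mB by (simp add: insert_absorb)
        moreover have "insert b B - {m'} = insert b (B - {m'})" "insert m' (M - {b}) = insert m' M - {b}"
          using \<open>m' < b\<close> by auto
        ultimately show "- ?T b = sgn_in b B * v (insert b B) (M - {b})"
          using b mB by (simp add: vv)
      qed
      finally show ?thesis by simp
    qed
  qed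
  ultimately show ?thesis by blast
qed

section \<open>Coefficients of the Koszul differential in a fixed multidegree\<close>

lemma poly_mapping_eq_sum_single:
  "p = (\<Sum>t\<in>Poly_Mapping.keys p. Poly_Mapping.single t (Poly_Mapping.lookup p t))"
  by (rule poly_mapping_eqI) (auto simp: lookup_sum lookup_single when_def in_keys_iff)

lemma lookup_single_mult:
  fixes p :: "'a::cancel_comm_monoid_add \<Rightarrow>\<^sub>0 'r::comm_ring_1"
  shows "Poly_Mapping.lookup (Poly_Mapping.single s c * p) (s + t) = c * Poly_Mapping.lookup p t"
    and "(\<And>u. t \<noteq> s + u) \<Longrightarrow> Poly_Mapping.lookup (Poly_Mapping.single s c * p) t = 0"
proof -
  have *: "Poly_Mapping.single s c * p =
      (\<Sum>u\<in>Poly_Mapping.keys p. Poly_Mapping.single (s + u) (c * Poly_Mapping.lookup p u))"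
    by (subst poly_mapping_eq_sum_single[of p]) (simp only: sum_distrib_left mult_single)
  show "Poly_Mapping.lookup (Poly_Mapping.single s c * p) (s + t) = c * Poly_Mapping.lookup p t"
    unfolding * by (auto simp: lookup_sum lookup_single when_def in_keys_iff)
  show "(\<And>u. t \<noteq> s + u) \<Longrightarrow> Poly_Mapping.lookup (Poly_Mapping.single s c * p) t = 0"
    unfolding * lookup_sum by (intro sum.neutral) (metis lookup_single_not_eq)
qed

abbreviation unit_exp :: "'n \<Rightarrow> 'n \<Rightarrow>\<^sub>0 nat" where
  "unit_exp b \<equiv> Poly_Mapping.single b 1"

lemma minus_unit_exp_add:
  assumes "b \<in> Poly_Mapping.keys t"
  shows "t - unit_exp b + unit_exp b = t"
  using assms by (intro poly_mapping_eqI) (auto simp: lookup_add lookup_minus lookup_single when_def in_keys_iff)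

lemma lookup_X_mult:
  fixes p :: "('n, 'k::comm_ring_1) mpoly"
  shows "Poly_Mapping.lookup (X b * p) t =
    (if b \<in> Poly_Mapping.keys t then Poly_Mapping.lookup p (t - unit_exp b) else 0)"
proof (cases "b \<in> Poly_Mapping.keys t")
  case True
  have "t = unit_exp b + (t - unit_exp b)" using minus_unit_exp_add[OF True] by (simp add: add.commute)
  then show ?thesis using lookup_single_mult(1)[of "unit_exp b" 1 p "t - unit_exp b"] True
    by (simp add: X_def)
next
  case False
  then have "t \<noteq> unit_exp b + u" for u by (auto simp: in_keys_iff lookup_add)
  then show ?thesis using lookup_single_mult(2)[of t "unit_exp b" 1 p] False by (simp add: X_def)
qed

lemma lookup_sgn_in_mult:
  "Poly_Mapping.lookup (sgn_in b B * p) t = sgn_in b B * Poly_Mapping.lookup (p :: ('n, 'k::comm_ring_1) mpoly) t"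
  unfolding sgn_in_def by (cases "even (card {x \<in> B. x < b})") simp_all

text \<open>Reading off one coefficient replaces the variables by shifts of the exponent, and only
  variables dividing \<open>t\<close> remain. What is left is a simplicial boundary with scalar
  coefficients.\<close>

lemma lookup_koszul:
  fixes w :: "('n::{finite,linorder}, ('n, 'k::field) mpoly) chain_fun"
  shows "Poly_Mapping.lookup (koszul w B M) t =
    (\<Sum>b\<in>Poly_Mapping.keys t - (B \<union> M). sgn_in b B * Poly_Mapping.lookup (w (insert b B) M) (t - unit_exp b))"
proof -
  have "Poly_Mapping.lookup (koszul w B M) t =
    (\<Sum>b\<in>- (B \<union> M). sgn_in b B * Poly_Mapping.lookup (X b * w (insert b B) M) t)"
    by (simp add: koszul_def lookup_sum mult.assoc lookup_sgn_in_mult)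
  also have "\<dots> = (\<Sum>b\<in>Poly_Mapping.keys t - (B \<union> M).
      sgn_in b B * Poly_Mapping.lookup (w (insert b B) M) (t - unit_exp b))"
    by (rule sum.mono_neutral_cong_right) (auto simp: lookup_X_mult)
  finally show ?thesis .
qed

text \<open>In each multidegree the Koszul complex is the augmented chain complex of the simplex on
  \<open>S B M t\<close>, and the cone with apex \<open>m B M t\<close> contracts it. Only the empty
  simplex has homology: there \<open>B\<close> is empty and the exponent is supported on
  \<open>M\<close>, which \<open>aug\<close> excludes.\<close>

lemma koszul_exact:
  fixes z :: "('n::{finite,linorder}, ('n, 'k::field) mpoly) chain_fun"
  assumes z: "chain p d z" and cyc: "koszul z = (\<lambda>B M. 0)"
    and aug: "p = 0 \<Longrightarrow> (\<And>M t. Poly_Mapping.keys t \<subseteq> M \<Longrightarrow> Poly_Mapping.lookup (z {} M) t = 0)"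
  shows "\<exists>w. chain (Suc p) d w \<and> koszul w = z"
proof -
  \<comment> \<open>\<open>S B M t\<close> is the set of variables outside \<open>M\<close> dividing the multidegree of \<open>x\<^sup>t e\<^sub>B\<close>; it is
    invariant under the differential\<close>
  define S where "S B M t = (B \<union> Poly_Mapping.keys t) - M" for B M and t :: "'n \<Rightarrow>\<^sub>0 nat"
  define m where "m B M t = Min (S B M t)" for B M and t :: "'n \<Rightarrow>\<^sub>0 nat"
  define c where "c B M t = (if m B M t \<in> B \<and> B \<inter> M = {}
    then Poly_Mapping.lookup (z (B - {m B M t}) M) (t + unit_exp (m B M t)) else 0)" for B M t
  define w where "w B M = Abs_poly_mapping (c B M)" for B M
  have c: "Poly_Mapping.lookup (w B M) = c B M" for B M
    unfolding w_def
  \<comment> \<open>Shifting exponents by \<open>unit_exp b\<close> is injective, so the finitely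
    many polynomials \<open>z (B - {b}) M\<close> leave only finitely many \<open>t\<close>.\<close>
  proof (rule Abs_poly_mapping_inverse, rule CollectI, rule finite_subset)
    let ?V = "\<lambda>b. (\<lambda>t. t + unit_exp b) -` Poly_Mapping.keys (z (B - {b}) M)"
    show "{t. c B M t \<noteq> 0} \<subseteq> (\<Union>b. ?V b)" by (auto simp: c_def in_keys_iff split: if_splits)
    show "finite (\<Union>b. ?V b)" by (auto intro!: finite_vimageI injI)
  qed
  have "chain (Suc p) d w"
    unfolding chain_def
  proof (intro allI impI)
    fix B M assume "w B M \<noteq> 0"
    then obtain t where "c B M t \<noteq> 0" unfolding c[symmetric] by (metis lookup_zero poly_mapping_eqI)
    then have *: "m B M t \<in> B" "B \<inter> M = {}" "z (B - {m B M t}) M \<noteq> 0"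
      by (auto simp: c_def split: if_splits)
    from chainD[OF z *(3)] *(1,2) show "B \<inter> M = {} \<and> card B = Suc p \<and> card M = d"
      using card_Suc_Diff1[of B "m B M t"] by auto
  qed
  moreover have "Poly_Mapping.lookup (koszul w B M) t = Poly_Mapping.lookup (z B M) t" for B M t
  proof (cases "B \<inter> M = {} \<and> S B M t \<noteq> {}")
    case False
    have "Poly_Mapping.lookup (z B M) t = 0"
    proof (cases "z B M = 0")
      case nz: False
      then have "B = {}" "Poly_Mapping.keys t \<subseteq> M"
        using chainD[OF z nz] False by (auto simp: S_def)
      then show ?thesis using aug chainD[OF z nz] by auto
    qed simp
    moreover have "Poly_Mapping.lookup (koszul w B M) t = 0"
      unfolding lookup_koszul c using False
      by (intro sum.neutral) (auto simp: c_def S_def)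
    ultimately show ?thesis by simp
  next
    case True
    define m' where "m' = m B M t"
    have m': "m' \<in> S B M t" "\<And>b. b \<in> S B M t \<Longrightarrow> m' \<le> b"
      using True Min_in[of "S B M t"] unfolding m'_def m_def by (auto intro!: Min_le simp: S_def)
    let ?K = "Poly_Mapping.keys t - (B \<union> M)"
    \<comment> \<open>Trading a factor \<open>X b\<close> for the vertex \<open>b\<close> keeps the
      vertex set \<open>S\<close>, also when the exponent of \<open>b\<close> exceeds 1.\<close>
    have mm: "m (insert b B) M (t - unit_exp b) = m'" if "b \<in> ?K" for b
    proof -
      have "insert b (Poly_Mapping.keys (t - unit_exp b)) = Poly_Mapping.keys t"
        using that by (auto simp: in_keys_iff lookup_minus lookup_single when_def split: if_splits)
      then have "S (insert b B) M (t - unit_exp b) = S B M t" unfolding S_def by auto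
      then show ?thesis by (simp add: m_def m'_def)
    qed
    have cc: "c (insert b B) M (t - unit_exp b) =
      (if m' = b \<or> m' \<in> B then Poly_Mapping.lookup (z (insert b B - {m'}) M) (t - unit_exp b + unit_exp m') else 0)"
      if "b \<in> ?K" for b using that True unfolding c_def mm[OF that] by auto
    show ?thesis
    proof (cases "m' \<in> B")
      case False
      then have mK: "m' \<in> ?K" using m' by (auto simp: S_def)
      have "Poly_Mapping.lookup (koszul w B M) t = (\<Sum>b\<in>?K. if m' = b then Poly_Mapping.lookup (z B M) t else 0)"
        unfolding lookup_koszul c
      proof (rule sum.cong[OF refl])
        fix b assume b: "b \<in> ?K"
        have "sgn_in m' B = (1 :: 'k)"
          using m'(2) True by (intro sgn_in_Min) (auto simp: S_def)
        then show "sgn_in b B * c (insert b B) M (t - unit_exp b) = (if m' = b then Poly_Mapping.lookup (z B M) t else 0)"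
          unfolding cc[OF b] using b False minus_unit_exp_add[of b t] by auto
      qed
      then show ?thesis using mK by simp
    next
      case mB: True
      then have mM: "m' \<notin> M" using True by auto
      have sm: "sgn_in m' (B - {m'}) = (1 :: 'k)"
          using m'(2) True by (intro sgn_in_Min) (auto simp: S_def)
      \<comment> \<open>Removing the vertex \<open>m'\<close> from \<open>B\<close> is compensated
        in the exponent, so the multidegree stays the same.\<close>
      let ?t = "t + unit_exp m'"
      let ?T = "\<lambda>b. sgn_in b (B - {m'}) * Poly_Mapping.lookup (z (insert b (B - {m'})) M) (?t - unit_exp b)"
      have "0 = Poly_Mapping.lookup (koszul z (B - {m'}) M) ?t" by (simp add: cyc)
      also have "\<dots> = (\<Sum>b\<in>insert m' ?K. ?T b)"
        unfolding lookup_koszul using mB mM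
        by (intro sum.cong) (auto simp: in_keys_iff lookup_add lookup_single when_def split: if_splits)
      also have "\<dots> = ?T m' + (\<Sum>b\<in>?K. ?T b)" using mB by simp
      also have "?T m' = Poly_Mapping.lookup (z B M) t"
        using mB by (simp add: sm insert_absorb)
      finally have "Poly_Mapping.lookup (z B M) t = - (\<Sum>b\<in>?K. ?T b)" by (simp add: eq_neg_iff_add_eq_0)
      also have "\<dots> = Poly_Mapping.lookup (koszul w B M) t"
        unfolding lookup_koszul c sum_negf[symmetric]
      proof (rule sum.cong[OF refl])
        fix b assume b: "b \<in> ?K"
        have "m' < b" using m'(2)[of b] b mB by (auto simp: order.strict_iff_order S_def)
        then have "sgn_in b B = - (sgn_in b (B - {m'}) :: 'k)"
          using sgn_in_insert[of m' "B - {m'}" b, where 'r='k] mB by (simp add: insert_absorb)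
        moreover have "insert b B - {m'} = insert b (B - {m'})"
          using \<open>m' < b\<close> by auto
        moreover have "t - unit_exp b + unit_exp m' = ?t - unit_exp b"
          using \<open>m' < b\<close> by (intro poly_mapping_eqI) (auto simp: lookup_add lookup_minus lookup_single when_def)
        ultimately show "- ?T b = sgn_in b B * c (insert b B) M (t - unit_exp b)"
          unfolding cc[OF b] using mB by simp
      qed
      finally show ?thesis by simp
    qed
  qed
  then have "koszul w = z" by (intro ext poly_mapping_eqI)
  ultimately show ?thesis by blast
qed

section \<open>The augmentation and exactness on the kernel of the exchange map\<close>

definition aug_chain :: "('n::{finite,linorder}, ('n, 'k::field) mpoly) chain_fun \<Rightarrow> ('n, 'k) mpoly" where
  "aug_chain z = (\<Sum>M\<in>UNIV. sqfree_mon M * z {} M)"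

lemma sqfree_mon_insert:
  "b \<notin> M \<Longrightarrow> (sqfree_mon (insert b M) :: ('n::finite, 'k::comm_ring_1) mpoly) = X b * sqfree_mon M"
  by (simp add: sqfree_mon_def)

text \<open>Inserting \<open>b\<close> into \<open>M\<close> matches the terms: the factor
  \<open>X b\<close> of the Koszul differential completes the monomial of \<open>M\<close> to that
  of \<open>insert b M\<close>. Hence \<open>exch w\<close> inherits a vanishing augmentation from
  \<open>koszul w\<close>.\<close>

lemma aug_chain_koszul: "aug_chain (koszul w) = aug_chain (exch w)"
proof -
  let ?f = "\<lambda>M b. sqfree_mon (insert b M) * w {b} M"
  have "aug_chain (koszul w) = (\<Sum>M\<in>UNIV. \<Sum>b\<in>-M. ?f M b)"
    by (simp add: aug_chain_def koszul_def sum_distrib_left sqfree_mon_insert algebra_simps)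
  also have "\<dots> = (\<Sum>(M, b)\<in>(SIGMA M:UNIV. -M). ?f M b)"
    by (simp add: sum.Sigma)
  also have "\<dots> = (\<Sum>(M, b)\<in>(SIGMA M:UNIV. M). sqfree_mon M * w {b} (M - {b}))"
    by (rule sum.reindex_bij_witness[of _ "\<lambda>(M, b). (M - {b}, b)" "\<lambda>(M, b). (insert b M, b)"]) (auto simp: insert_absorb)
  also have "\<dots> = (\<Sum>M\<in>UNIV. \<Sum>b\<in>M. sqfree_mon M * w {b} (M - {b}))"
    by (simp add: sum.Sigma)
  also have "\<dots> = aug_chain (exch w)"
    by (simp add: aug_chain_def exch_def sum_distrib_left)
  finally show ?thesis .
qed

definition set_exp :: "'n::finite set \<Rightarrow> 'n \<Rightarrow>\<^sub>0 nat" where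
  "set_exp A = (\<Sum>i\<in>A. unit_exp i)"

lemma lookup_set_exp: "Poly_Mapping.lookup (set_exp A) i = (if i \<in> A then 1 else 0)"
  by (simp add: set_exp_def lookup_sum lookup_single when_def)

lemma sqfree_mon_eq_single: "sqfree_mon A = Poly_Mapping.single (set_exp A) 1"
proof (induction A rule: infinite_finite_induct)
  case (insert x F)
  then show ?case by (simp add: sqfree_mon_insert set_exp_def X_def mult_single del: single_one)
qed (simp_all add: sqfree_mon_def set_exp_def)

text \<open>Compare the coefficients at \<open>set_exp M + t\<close>, whose support is
  \<open>M\<close>. Another set \<open>N\<close> of the same size is not contained in
  \<open>M\<close>, so its monomial does not divide this one; only the summand of \<open>M\<close>
  contributes.\<close>

lemma lookup_zero_of_aug_chain:
  fixes z :: "('n::{finite,linorder}, ('n, 'k::field) mpoly) chain_fun"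
  assumes z: "chain 0 d z" and aug: "aug_chain z = 0" and t: "Poly_Mapping.keys t \<subseteq> M"
  shows "Poly_Mapping.lookup (z {} M) t = 0"
proof (cases "z {} M = 0")
  case False
  then have M: "card M = d" using chainD[OF z] by auto
  have *: "Poly_Mapping.lookup (sqfree_mon N * z {} N) (set_exp M + t) = 0" if "N \<noteq> M" for N
  proof (cases "z {} N = 0")
    case False
    then have "card N = card M" using M chainD[OF z] by auto
    then have "\<not> N \<subseteq> M" using that by (metis card_subset_eq finite)
    then obtain i where i: "i \<in> N" "i \<notin> M" by auto
    then have "i \<notin> Poly_Mapping.keys t" using t by auto
    then have "set_exp M + t \<noteq> set_exp N + u" for u
      using i by (auto simp: poly_mapping_eq_iff fun_eq_iff lookup_add lookup_set_exp in_keys_iff intro!: exI[of _ i])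
    then show ?thesis unfolding sqfree_mon_eq_single by (rule lookup_single_mult(2))
  qed simp
  have "0 = Poly_Mapping.lookup (aug_chain z) (set_exp M + t)" using aug by simp
  also have "\<dots> = (\<Sum>N\<in>UNIV. if N = M then Poly_Mapping.lookup (z {} M) t else 0)"
    unfolding aug_chain_def lookup_sum
    by (intro sum.cong) (auto simp: *, simp add: sqfree_mon_eq_single lookup_single_mult(1))
  finally show ?thesis by simp
qed simp

text \<open>A Koszul preimage \<open>w\<close> of \<open>z\<close> may leave the kernel of
  \<open>exch\<close>. Its defect \<open>exch w\<close> is a cycle for both maps with
  \<open>d\<close> raised by one, hence by induction equal to \<open>koszul v\<close> with
  \<open>v = exch v'\<close>. Adding \<open>koszul v'\<close> to \<open>w\<close> removes the defect
  without changing the boundary.\<close>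

lemma exch_kernel_exact:
  fixes z :: "('n::{finite,linorder}, ('n, 'k::field) mpoly) chain_fun"
  assumes "chain p d z" "exch z = (\<lambda>B M. 0)" "koszul z = (\<lambda>B M. 0)" "p = 0 \<Longrightarrow> aug_chain z = 0"
  shows "\<exists>w. chain (Suc p) d w \<and> exch w = (\<lambda>B M. 0) \<and> koszul w = z"
  using assms
proof (induction "Suc CARD('n) - d" arbitrary: d z)
  \<comment> \<open>Here \<open>d\<close> exceeds \<open>CARD('n)\<close>, so no set
    \<open>M\<close> has \<open>d\<close> elements and \<open>z\<close> is zero.\<close>
  case 0
  have "z B M = 0" for B M
    using chainD[OF 0(2), of B M] 0(1) card_mono[of UNIV M] by fastforce
  then show ?case by (intro exI[of _ "\<lambda>B M. 0"]) (auto simp: fun_eq_iff)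
next
  case (Suc k)
  obtain w where w: "chain (Suc p) d w" "koszul w = z"
    using koszul_exact[OF Suc.prems(1,3)] lookup_zero_of_aug_chain Suc.prems by metis
  have "\<exists>v. chain (Suc p) (Suc d) v \<and> exch v = (\<lambda>B M. 0) \<and> koszul v = exch w"
  proof (rule Suc.hyps(1))
    show "k = Suc CARD('n) - Suc d" using Suc.hyps by simp
    show "koszul (exch w) = (\<lambda>B M. 0)" by (simp add: fun_eq_iff koszul_exch w Suc.prems)
    show "aug_chain (exch w) = 0" if "p = 0" using that by (simp add: w Suc.prems flip: aug_chain_koszul)
  qed (use chain_exch w exch_exch in auto)
  then obtain v where v: "chain (Suc p) (Suc d) v" "exch v = (\<lambda>B M. 0)" "koszul v = exch w" by blast
  obtain v' where v': "chain (Suc (Suc p)) d v'" "exch v' = v" using exch_exact[OF v(1,2)] by blast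
  let ?w = "\<lambda>B M. w B M + koszul v' B M"
  have "chain (Suc p) d ?w" by (intro chain_add w chain_koszul v')
  moreover have "exch ?w = (\<lambda>B M. 0)"
  proof (intro ext)
    fix B M
    \<comment> \<open>Anticommutation gives the minus sign, so the sum, and not the difference, is
      the corrected chain.\<close>
    have "exch (koszul v') B M = - koszul v B M" by (simp add: koszul_exch flip: v'(2))
    then show "exch ?w B M = 0" by (simp add: exch_add v(3))
  qed
  moreover have "koszul ?w = z" by (simp add: fun_eq_iff koszul_add koszul_koszul w)
  ultimately show ?case by blast
qed


section \<open>Coordinates on the hook modules\<close>

text \<open>For a distinct list this is the sign of its sorting permutation: the factor of
  \<open>x\<close> counts the later entries below \<open>x\<close>, that is, the inversions starting
  there.\<close>

fun perm_sgn :: "'n::linorder list \<Rightarrow> 'r::comm_ring_1" where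
  "perm_sgn [] = 1"
| "perm_sgn (x # xs) = sgn_in x (set xs) * perm_sgn xs"

lemma set_remove_nth:
  assumes "distinct a" "j < length a"
  shows "set (remove_nth j a) = set a - {a ! j}"
proof -
  have a: "a = take j a @ a ! j # drop (Suc j) a" using assms by (simp add: id_take_nth_drop)
  then have "distinct (take j a @ a ! j # drop (Suc j) a)" using assms by simp
  moreover have "set a = set (take j a @ a ! j # drop (Suc j) a)" using a by simp
  ultimately show ?thesis by (auto simp: remove_nth_def)
qed

text \<open>Bringing entry \<open>j\<close> to the front costs \<open>j\<close> transpositions,
  after which it contributes its own factor. In the induction, \<open>sgn_in_swap\<close> moves it
  past the head \<open>x\<close>.\<close>

lemma perm_sgn_remove_nth:
  fixes a :: "'n::{finite,linorder} list"
  assumes "distinct a" "j < length a"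
  shows "(perm_sgn a :: 'r::comm_ring_1) =
    (-1) ^ j * sgn_in (a ! j) (set a - {a ! j}) * perm_sgn (remove_nth j a)"
  using assms
proof (induction a arbitrary: j)
  case (Cons x xs)
  show ?case
  proof (cases j)
    case 0
    then show ?thesis using Cons.prems by (simp add: remove_nth_def)
  next
    case (Suc i)
    define y where "y = xs ! i"
    define S where "S = set xs - {y}"
    have i: "i < length xs" "distinct xs" using Cons.prems Suc by auto
    have y: "y \<in> set xs" using i by (simp add: y_def)
    then have xy: "x \<noteq> y" "x \<notin> S" "y \<notin> S" "set xs = insert y S" using Cons.prems by (auto simp: S_def)
    have r: "remove_nth j (x # xs) = x # remove_nth i xs" by (simp add: remove_nth_def Suc)
    have "perm_sgn (x # xs) = (sgn_in y S * sgn_in x (insert y S)) * ((-1) ^ i * perm_sgn (remove_nth i xs) :: 'r)"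
      using Cons.IH[OF i(2,1)] xy by (simp add: y_def[symmetric] S_def[symmetric] algebra_simps)
    also have "sgn_in y S * sgn_in x (insert y S) = - (sgn_in x S * sgn_in y (insert x S) :: 'r)"
      using xy by (intro sgn_in_swap) auto
    also have "\<dots> * ((-1) ^ i * perm_sgn (remove_nth i xs)) =
        (-1) ^ j * sgn_in y (insert x S) * (sgn_in x S * perm_sgn (remove_nth i xs))"
      by (simp add: Suc algebra_simps)
    also have "insert x S = set (x # xs) - {(x # xs) ! j}" using xy by (auto simp: Suc y_def[symmetric])
    also have "y = (x # xs) ! j" by (simp add: Suc y_def)
    also have "S = set (remove_nth i xs)" using i by (simp add: set_remove_nth S_def y_def)
    finally show ?thesis unfolding r by simp
  qed
qed simp

lemma perm_sgn_alternating:
  fixes xs :: "'n::{finite,linorder} list"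
  assumes "distinct (xs @ p # q # ys)"
  shows "perm_sgn (xs @ q # p # ys) = - (perm_sgn (xs @ p # q # ys) :: 'r::comm_ring_1)"
  using assms
proof (induction xs)
  case Nil
  then have "sgn_in p (set ys) * sgn_in q (insert p (set ys)) =
    - (sgn_in q (set ys) * sgn_in p (insert q (set ys)) :: 'r)" by (intro sgn_in_swap) auto
  then show ?case by (simp add: algebra_simps)
next
  case (Cons x xs)
  then show ?case by (simp add: insert_commute)
qed

lemma perm_sgn_sorted:
  "sorted a \<Longrightarrow> perm_sgn (a :: 'n::{finite,linorder} list) = (1 :: 'r::comm_ring_1)"
  by (induction a) (auto simp: sgn_in_Min)

text \<open>The two lists agree once position \<open>m\<close> is removed, so expanding both there
  leaves only the signs of \<open>a ! m\<close> and \<open>b\<close>.\<close>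

lemma perm_sgn_list_update:
  fixes a :: "'n::{finite,linorder} list"
  assumes "distinct a" "m < length a" "b \<notin> set a"
  shows "(perm_sgn (a[m := b]) :: 'r::comm_ring_1) =
    sgn_in (a ! m) (set a - {a ! m}) * sgn_in b (set a - {a ! m}) * perm_sgn a"
proof -
  have d: "distinct (a[m := b])" using assms by (auto intro: distinct_list_update)
  have s: "set (a[m := b]) - {b} = set a - {a ! m}"
    using assms by (auto simp: set_update_distinct)
  show ?thesis
    using perm_sgn_remove_nth[OF d, of m, where 'r='r] perm_sgn_remove_nth[OF assms(1,2), where 'r='r] assms s
    by (simp add: remove_nth_list_update_same algebra_simps)
qed

section \<open>Basis chains and the coordinates of symbols\<close>

lemma sum_nth_eq_sum_set: "distinct a \<Longrightarrow> (\<Sum>j<length a. f (a ! j)) = sum f (set a)"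
  by (intro sum.reindex_bij_betw bij_betw_nth) auto

definition basis_chain :: "'n set \<Rightarrow> 'n set \<Rightarrow> ('n, 'r::comm_ring_1) chain_fun" where
  "basis_chain A L B M = (if B = A \<and> M = L then 1 else 0)"

lemma chain_basis_chain: "A \<inter> L = {} \<Longrightarrow> chain (card A) (card L) (basis_chain A L)"
  by (simp add: chain_def basis_chain_def)

lemma exch_sum:
  "exch (\<lambda>B M. \<Sum>i\<in>S. c i * f i B M) B M = (\<Sum>i\<in>S. c i * exch (f i) B M)"
proof -
  have "exch (\<lambda>B M. \<Sum>i\<in>S. c i * f i B M) B M =
      (\<Sum>b\<in>M - B. \<Sum>i\<in>S. c i * (sgn_in b B * f i (insert b B) (M - {b})))"
    by (simp add: exch_def sum_distrib_left algebra_simps)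
  also have "\<dots> = (\<Sum>i\<in>S. c i * exch (f i) B M)"
    by (subst sum.swap) (simp add: exch_def sum_distrib_left)
  finally show ?thesis .
qed

lemma exch_scale: "exch (\<lambda>B M. c * f B M) B M = c * exch f B M"
  using exch_sum[of "\<lambda>_. c" "\<lambda>_. f" "{()}" B M] by simp

lemma exch_basis_chain:
  fixes A L :: "'n::{finite,linorder} set"
  assumes "A \<inter> L = {}"
  shows "exch (basis_chain A L) B M =
    (\<Sum>y\<in>A. sgn_in y (A - {y}) * basis_chain (A - {y}) (insert y L) B M :: 'r::comm_ring_1)"
proof -
  let ?f = "\<lambda>y. if y \<in> M - B \<and> insert y B = A \<and> M - {y} = L then sgn_in y B else (0 :: 'r)"
  have "exch (basis_chain A L) B M = (\<Sum>y\<in>UNIV. ?f y)"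
    unfolding exch_def by (rule sum.mono_neutral_cong_left) (auto simp: basis_chain_def)
  also have "\<dots> = (\<Sum>y\<in>A. sgn_in y (A - {y}) * basis_chain (A - {y}) (insert y L) B M)"
  proof (rule sum.mono_neutral_cong_right)
    show "?f y = sgn_in y (A - {y}) * basis_chain (A - {y}) (insert y L) B M" if y: "y \<in> A" for y
    proof -
      have "(y \<in> M - B \<and> insert y B = A \<and> M - {y} = L) \<longleftrightarrow> (B = A - {y} \<and> M = insert y L)"
        using assms y by auto
      then show ?thesis by (simp add: basis_chain_def)
    qed
  qed auto
  finally show ?thesis .
qed

lemma koszul_basis_chain:
  fixes A L :: "'n::{finite,linorder} set"
  assumes "A \<inter> L = {}"
  shows "koszul (basis_chain A L) B M =
    (\<Sum>y\<in>A. sgn_in y (A - {y}) * X y * basis_chain (A - {y}) L B M :: ('n, 'k::field) mpoly)"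
proof -
  let ?f = "\<lambda>y. if y \<in> - (B \<union> M) \<and> insert y B = A \<and> M = L then sgn_in y B * X y else (0 :: ('n, 'k) mpoly)"
  have "koszul (basis_chain A L) B M = (\<Sum>y\<in>UNIV. ?f y)"
    unfolding koszul_def by (rule sum.mono_neutral_cong_left) (auto simp: basis_chain_def)
  also have "\<dots> = (\<Sum>y\<in>A. sgn_in y (A - {y}) * X y * basis_chain (A - {y}) L B M)"
  proof (rule sum.mono_neutral_cong_right)
    show "?f y = sgn_in y (A - {y}) * X y * basis_chain (A - {y}) L B M" if y: "y \<in> A" for y
    proof -
      have "(y \<in> - (B \<union> M) \<and> insert y B = A \<and> M = L) \<longleftrightarrow> (B = A - {y} \<and> M = L)"
        using assms y by auto
      then show ?thesis by (simp add: basis_chain_def)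
    qed
  qed auto
  finally show ?thesis .
qed

text \<open>Coefficient at \<open>(B, M)\<close> of the image of a symbol; \<open>perm_sgn\<close>
  accounts for sorting the list. The relations involve only valid symbols, and an invalid one is
  sent to 0.\<close>

definition coord_symb :: "'n::{finite,linorder} set \<Rightarrow> 'n set \<Rightarrow> 'n symb \<Rightarrow> 'r::comm_ring_1" where
  "coord_symb B M = (\<lambda>(a, L).
     if valid_symb a L then perm_sgn a * exch (basis_chain (set a) L) B M else 0)"

definition coord :: "('n::{finite,linorder}, 'r::comm_ring_1) hook \<Rightarrow> ('n, 'r) chain_fun" where
  "coord u B M = hook_lift (*) (coord_symb B M) u"

text \<open>The straightening relation is \<open>exch \<circ> exch = 0\<close>, evaluated at the chain \<open>(A \<union> {b}, L - {b})\<close>.\<close>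

lemma exch_basis_chain_straightening:
  fixes A L :: "'n::{finite,linorder} set"
  assumes "A \<inter> L = {}" "b \<in> L"
  shows "(exch (basis_chain A L) B M :: 'r::comm_ring_1) =
    (\<Sum>y\<in>A. sgn_in y (A - {y}) * sgn_in b (A - {y}) *
      exch (basis_chain (insert b (A - {y})) (insert y (L - {b}))) B M)"
proof -
  let ?E = "\<lambda>A L. exch (basis_chain A L) B M :: 'r"
  let ?A = "insert b A" and ?L = "L - {b}"
  have b: "b \<notin> A" using assms by auto
  have E: "exch (basis_chain ?A ?L) =
      (\<lambda>B M. \<Sum>y\<in>?A. sgn_in y (?A - {y}) * basis_chain (?A - {y}) (insert y ?L) B M :: 'r)"
    using assms by (intro ext exch_basis_chain) auto
  have "(0 :: 'r) = exch (exch (basis_chain ?A ?L)) B M" by (simp only: exch_exch)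
  also have "\<dots> = exch (\<lambda>B M. \<Sum>y\<in>?A. sgn_in y (?A - {y}) * basis_chain (?A - {y}) (insert y ?L) B M) B M"
    by (simp only: E)
  also have "\<dots> = (\<Sum>y\<in>?A. sgn_in y (?A - {y}) * ?E (?A - {y}) (insert y ?L))"
    by (rule exch_sum)
  also have "\<dots> = sgn_in b A * ?E A L + (\<Sum>y\<in>A. sgn_in y (?A - {y}) * ?E (?A - {y}) (insert y ?L))"
    using b assms by (simp add: insert_absorb)
  finally have *: "sgn_in b A * ?E A L = - (\<Sum>y\<in>A. sgn_in y (?A - {y}) * ?E (?A - {y}) (insert y ?L))"
    by (simp add: eq_neg_iff_add_eq_0)
  have "?E A L = sgn_in b A * (sgn_in b A * ?E A L)" by simp
  also have "\<dots> = (\<Sum>y\<in>A. - (sgn_in b A * sgn_in y (?A - {y})) * ?E (?A - {y}) (insert y ?L))"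
    unfolding * by (simp add: sum_distrib_left sum_negf mult.assoc)
  also have "\<dots> = (\<Sum>y\<in>A. sgn_in y (A - {y}) * sgn_in b (A - {y}) *
      ?E (insert b (A - {y})) (insert y (L - {b})))"
  proof (rule sum.cong[OF refl])
    fix y assume y: "y \<in> A"
    have e: "?A - {y} = insert b (A - {y})" using b y by auto
    have "sgn_in y (A - {y}) * sgn_in b (insert y (A - {y})) =
        - (sgn_in b (A - {y}) * sgn_in y (insert b (A - {y})) :: 'r)"
      using b y by (intro sgn_in_swap) auto
    then have "sgn_in y (A - {y}) * sgn_in b A = - (sgn_in b (A - {y}) * sgn_in y (?A - {y}) :: 'r)"
      using y by (simp add: insert_absorb e)
    then have "sgn_in y (A - {y}) * (sgn_in y (A - {y}) * sgn_in b A) * sgn_in y (?A - {y}) =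
      - (sgn_in y (A - {y}) * sgn_in b (A - {y}) * (sgn_in y (?A - {y}) * sgn_in y (?A - {y})) :: 'r)"
      by (simp add: algebra_simps)
    then have "- (sgn_in b A * sgn_in y (?A - {y})) = (sgn_in y (A - {y}) * sgn_in b (A - {y}) :: 'r)"
      by simp
    then show "- (sgn_in b A * sgn_in y (?A - {y})) * ?E (?A - {y}) (insert y ?L) =
      sgn_in y (A - {y}) * sgn_in b (A - {y}) * ?E (insert b (A - {y})) (insert y (L - {b}))"
      by (simp only: e)
  qed
  finally show ?thesis .
qed

lemma coord_symb_straightening:
  fixes a :: "'n::{finite,linorder} list"
  assumes v: "valid_symb a L" and b: "b \<in> L"
  shows "(coord_symb B M (a, L) :: 'r::comm_ring_1) =
    (\<Sum>m<length a. coord_symb B M (a[m := b], insert (a ! m) (L - {b})))"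
proof -
  let ?A = "set a"
  have d: "distinct a" "?A \<inter> L = {}" "b \<notin> ?A" using v b by (auto simp: valid_symb_def)
  define f :: "'n \<Rightarrow> 'r" where "f y = perm_sgn a * (sgn_in y (?A - {y}) * sgn_in b (?A - {y}) *
      exch (basis_chain (insert b (?A - {y})) (insert y (L - {b}))) B M)" for y
  have "(\<Sum>m<length a. coord_symb B M (a[m := b], insert (a ! m) (L - {b}))) = (\<Sum>m<length a. f (a ! m))"
    by (intro sum.cong refl)
      (simp add: f_def coord_symb_def valid_symb_exchange[OF v b] perm_sgn_list_update set_update_distinct d algebra_simps)
  also have "\<dots> = perm_sgn a * exch (basis_chain ?A L) B M"
    unfolding sum_nth_eq_sum_set[OF d(1)] exch_basis_chain_straightening[OF d(2) b]
    by (simp add: sum_distrib_left f_def)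
  finally show ?thesis using v by (simp add: coord_symb_def)
qed

lemma coord_symb_alternating:
  fixes p :: "'n::{finite,linorder}"
  assumes v: "valid_symb (xs @ p # q # ys) L"
  shows "coord_symb B M (xs @ q # p # ys, L) = - (coord_symb B M (xs @ p # q # ys, L) :: 'r::comm_ring_1)"
proof -
  have "valid_symb (xs @ q # p # ys) L" using v by (auto simp: valid_symb_def)
  with v show ?thesis
    by (simp add: coord_symb_def perm_sgn_alternating[of xs p q ys] valid_symb_def insert_commute)
qed

lemma module_hom_coord: "module_hom hook_scale (*) (\<lambda>u. coord u B M)"
  and coord_hook_symb: "coord (hook_symb a L) B M = coord_symb B M (a, L)"
  unfolding coord_def
  by (rule hook_lift[OF module_mult coord_symb_alternating coord_symb_straightening]; assumption)+

lemma coord_0 [simp]: "coord 0 B M = 0"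
  and coord_add: "coord (u + v) B M = coord u B M + coord v B M"
  and coord_diff: "coord (u - v) B M = coord u B M - coord v B M"
  and coord_scale: "coord (hook_scale c u) B M = c * coord u B M"
  and coord_sum: "coord (sum f S) B M = (\<Sum>i\<in>S. coord (f i) B M)"
proof -
  interpret h: module_hom hook_scale "(*)" "\<lambda>u. coord u B M" by (rule module_hom_coord)
  show "coord 0 B M = 0" "coord (u + v) B M = coord u B M + coord v B M"
    "coord (u - v) B M = coord u B M - coord v B M"
    "coord (hook_scale c u) B M = c * coord u B M"
    "coord (sum f S) B M = (\<Sum>i\<in>S. coord (f i) B M)"
    by (rule h.zero h.add h.diff h.scale h.sum)+
qed

lemma coord_f_symb:
  assumes "A \<inter> L = {}" "A \<noteq> {}"
  shows "coord (f_symb A L) = exch (basis_chain A L)"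
  using assms
  by (intro ext) (simp add: f_symb_def coord_hook_symb coord_symb_def valid_symb_def perm_sgn_sorted)

text \<open>The coordinates of a generator are a signed \<open>exch\<close> of a basis chain. This
  raises the second size from \<open>d - 1\<close> to \<open>d\<close>, where
  \<open>1 \<le> d\<close> makes the subtraction exact, and \<open>exch_exch\<close> gives the
  second claim.\<close>

lemma chain_coord:
  assumes "1 \<le> d" "u \<in> hook_module d (Suc p)"
  shows "chain p d (coord u)" and "exch (coord u) = (\<lambda>B M. 0)"
proof -
  have E: "chain p d (exch (basis_chain (set a) L) :: ('a, 'b) chain_fun)"
    if "valid_symb a L" "length a = Suc p" "card L = d - 1" for a and L :: "'a set"
  proof -
    have "chain (card (set a)) (card L) (basis_chain (set a) L :: ('a, 'b) chain_fun)"
      using that by (intro chain_basis_chain) (simp add: valid_symb_def)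
    moreover have "card (set a) = Suc p" using that by (simp add: valid_symb_def distinct_card)
    ultimately show ?thesis using chain_exch[of p "d - 1"] assms(1) that by simp
  qed
  show "chain p d (coord u)"
    using assms(2) unfolding hook_module_def
  proof (induction rule: hook.span_induct_alt)
    case base
    then show ?case by (simp add: chain_def)
  next
    case (step c x y)
    then obtain a L where "x = hook_symb a L" "valid_symb a L" "length a = Suc p" "card L = d - 1" by blast
    with E[of a L] step.IH show ?case
      unfolding chain_def coord_add coord_scale
      by (simp add: coord_hook_symb coord_symb_def) (metis add.right_neutral mult_zero_right)
  qed
  show "exch (coord u) = (\<lambda>B M. 0)"
    using assms(2) unfolding hook_module_def
  proof (induction rule: hook.span_induct_alt)
    case base
    then show ?case by (simp add: exch_def)
  next
    case (step c x y)
    then obtain a L where x: "x = hook_symb a L" "valid_symb a L" by blast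
    let ?E = "exch (basis_chain (set a) L) :: ('a, 'b) chain_fun"
    have "coord (hook_scale c x + y) =
      (\<lambda>B M. (c * perm_sgn a) * ?E B M + coord y B M)"
      by (intro ext) (simp add: coord_add coord_scale x coord_hook_symb coord_symb_def mult.assoc)
    then show ?case by (simp only: exch_add exch_scale exch_exch step.IH fun_eq_iff) simp
  qed
qed

section \<open>The basis of standard symbols\<close>

lemma hook_symb_insort:
  assumes "valid_symb (xs @ y # zs) L"
  shows "\<exists>c. (hook_symb (xs @ y # zs) L :: ('n::linorder, 'r::comm_ring_1) hook) =
    hook_scale c (hook_symb (xs @ insort y zs) L)"
  using assms
proof (induction zs arbitrary: xs)
  case Nil
  show ?case by (intro exI[of _ 1]) simp
next
  case (Cons z zs)
  show ?case
  proof (cases "y \<le> z")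
    case True
    then show ?thesis by (intro exI[of _ 1]) simp
  next
    case False
    have "valid_symb ((xs @ [z]) @ y # zs) L" using Cons.prems by (auto simp: valid_symb_def)
    from Cons.IH[OF this] obtain c where
      c: "(hook_symb (xs @ z # y # zs) L :: ('n, 'r) hook) = hook_scale c (hook_symb (xs @ z # insort y zs) L)"
      by auto
    have "valid_symb (xs @ z # y # zs) L" using Cons.prems by (auto simp: valid_symb_def)
    from hook_symb_alternating[OF this, where 'r='r] c False show ?thesis
      by (intro exI[of _ "- c"]) simp
  qed
qed

text \<open>Insertion sort by adjacent transpositions, behind a fixed prefix \<open>xs\<close> so
  that the alternating relation can act inside the list. For spans the existence of the scalar is
  enough.\<close>

lemma hook_symb_sort:
  assumes "valid_symb (xs @ a) L"
  shows "\<exists>c. (hook_symb (xs @ a) L :: ('n::linorder, 'r::comm_ring_1) hook) =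
    hook_scale c (hook_symb (xs @ sort a) L)"
  using assms
proof (induction a arbitrary: xs)
  case Nil
  show ?case by (intro exI[of _ 1]) simp
next
  case (Cons y ys)
  have "valid_symb ((xs @ [y]) @ ys) L" using Cons.prems by simp
  from Cons.IH[OF this] obtain c where
    c: "(hook_symb (xs @ y # ys) L :: ('n, 'r) hook) = hook_scale c (hook_symb (xs @ y # sort ys) L)" by auto
  have "valid_symb (xs @ y # sort ys) L" using Cons.prems by (auto simp: valid_symb_def)
  from hook_symb_insort[OF this, where 'r='r] c show ?case by auto
qed

lemma hook_symb_eq_f_symb:
  assumes "valid_symb a L"
  shows "\<exists>c. (hook_symb a L :: ('n::linorder, 'r::comm_ring_1) hook) = hook_scale c (f_symb (set a) L)"
  using hook_symb_sort[of "[]" a L, where 'r='r] assms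
  by (simp add: f_symb_def valid_symb_def sorted_list_of_set_sort_remdups distinct_remdups_id)

definition std_pairs :: "nat \<Rightarrow> nat \<Rightarrow> ('n::{finite,linorder} set \<times> 'n set) set" where
  "std_pairs d i = {(A, L). card A = i \<and> card L = d - 1 \<and> standard A L}"

definition std_symb :: "'n::{finite,linorder} set \<times> 'n set \<Rightarrow> ('n, 'r::comm_ring_1) hook" where
  "std_symb = (\<lambda>(A, L). f_symb A L)"

text \<open>These functionals are dual to the standard symbols, by
  \<open>lead_coord_std_symb\<close>.\<close>

definition lead_coord :: "'n::{finite,linorder} set \<times> 'n set \<Rightarrow> ('n, 'r::comm_ring_1) hook \<Rightarrow> 'r" where
  "lead_coord = (\<lambda>(A, L) u. coord u (A - {Min A}) (insert (Min A) L))"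

lemma f_symb_mem_hook_module:
  assumes "card A = i" "card L = d - 1" "A \<inter> L = {}" "1 \<le> i"
  shows "f_symb A L \<in> hook_module d i"
proof -
  have "A \<noteq> {}" "finite A" using assms by (auto intro: card_ge_0_finite)
  then have "valid_symb (sorted_list_of_set A) L" "length (sorted_list_of_set A) = i"
    using assms by (simp_all add: valid_symb_def)
  with assms(2) show ?thesis unfolding hook_module_def f_symb_def
    by (intro hook.span_base) blast
qed

text \<open>One straightening suffices. If \<open>b = Min L\<close> lies below the whole list, each
  exchange puts \<open>b\<close> into the list and leaves only larger elements in the second set, so
  every term is standard after sorting.\<close>

lemma hook_module_eq_span_std:
  assumes "1 \<le> i"
  shows "(hook_module d i :: ('n::{finite,linorder}, 'r::comm_ring_1) hook set) = hook.span (std_symb ` std_pairs d i)"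
proof
  show "hook.span (std_symb ` std_pairs d i) \<subseteq> (hook_module d i :: ('n, 'r) hook set)"
  proof (rule hook.span_minimal)
    show "std_symb ` std_pairs d i \<subseteq> (hook_module d i :: ('n, 'r) hook set)"
      using assms by (auto simp: std_symb_def std_pairs_def standard_def intro!: f_symb_mem_hook_module)
    show "hook.subspace (hook_module d i :: ('n, 'r) hook set)"
      unfolding hook_module_def by (rule hook.subspace_span)
  qed
  let ?S = "hook.span (std_symb ` std_pairs d i) :: ('n, 'r) hook set"
  have std: "hook_symb a L \<in> ?S"
    if v: "valid_symb a L" "length a = i" "card L = d - 1" and "L = {} \<or> Min (set a) < Min L" for a L
  proof -
    have "(set a, L) \<in> std_pairs d i"
      using that by (simp add: std_pairs_def standard_def valid_symb_def distinct_card)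
    then have "f_symb (set a) L \<in> ?S"
      by (intro hook.span_base image_eqI[of _ _ "(set a, L)"]) (simp_all add: std_symb_def)
    with hook_symb_eq_f_symb[OF v(1), where 'r='r] show ?thesis by (metis hook.span_scale)
  qed
  show "hook_module d i \<subseteq> ?S"
    unfolding hook_module_def
  proof (rule hook.span_minimal[OF _ hook.subspace_span], safe)
    fix a :: "'n list" and L
    assume v: "valid_symb a L" "card L = d - 1" and i: "i = length a"
    show "(hook_symb a L :: ('n, 'r) hook) \<in> hook.span (std_symb ` std_pairs d (length a))"
    proof (cases "L = {} \<or> Min (set a) < Min L")
      case True
      then show ?thesis using std[of a L] v i by simp
    next
      case False
      define b where "b = Min L"
      have b: "b \<in> L" "\<And>x. x \<in> L \<Longrightarrow> b \<le> x" using False by (auto simp: b_def)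
      have a: "b < x" if "x \<in> set a" for x
      proof -
        have "b \<le> Min (set a)" using False by (auto simp: b_def not_less)
        also have "\<dots> \<le> x" using that by simp
        finally show ?thesis using that b v(1) by (auto simp: valid_symb_def order.strict_iff_order)
      qed
      show ?thesis
        unfolding hook_symb_straightening[OF v(1) b(1)]
      proof (rule hook.span_sum)
        fix m assume "m \<in> {..<length a}"
        then have m: "m < length a" by simp
        have am: "a ! m \<in> set a" using m by simp
        then have "a ! m \<notin> L" using v(1) by (auto simp: valid_symb_def)
        let ?a = "a[m := b]" and ?L = "insert (a ! m) (L - {b})"
        have "b \<in> set ?a" using m by (rule set_update_memI)
        then have "Min (set ?a) \<le> b" by simp
        also have "b < Min ?L"
          using a[OF am] b by (subst Min_gr_iff) (auto simp: order.strict_iff_order)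
        finally have "Min (set ?a) < Min ?L" .
        moreover have "card ?L = d - 1"
          using \<open>a ! m \<notin> L\<close> b(1) v(2) card_Suc_Diff1[of L b] by simp
        ultimately show "(hook_symb ?a ?L :: ('n, 'r) hook) \<in> hook.span (std_symb ` std_pairs d (length a))"
          using std[of ?a ?L] valid_symb_exchange[OF v(1) b(1) m] i by simp
      qed
    qed
  qed
qed

text \<open>The sources of the coordinate at \<open>(A - {m}, insert m L)\<close> arise by moving
  some \<open>b\<close> back. For \<open>b = m\<close> this is \<open>(A, L)\<close>; for
  \<open>b \<in> L\<close> the element \<open>m\<close> stays in the second set and lies below the
  whole first set, so the source is not standard.\<close>

lemma lead_coord_std_symb:
  fixes P Q :: "'n::{finite,linorder} set \<times> 'n set"
  assumes "P \<in> std_pairs d i" "Q \<in> std_pairs d i" "1 \<le> i"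
  shows "lead_coord P (std_symb Q :: ('n, 'r::comm_ring_1) hook) = (if P = Q then 1 else 0)"
proof -
  obtain A L where P: "P = (A, L)" by force
  obtain A' L' where Q: "Q = (A', L')" by force
  define m where "m = Min A"
  have ne: "A \<noteq> {}" "A' \<noteq> {}" and st: "standard A L" "standard A' L'" and card: "card L = card L'"
    using assms P Q by (auto simp: std_pairs_def)
  have m: "m \<in> A" "\<And>x. x \<in> A \<Longrightarrow> m \<le> x" "\<And>x. x \<in> L \<Longrightarrow> m < x"
    using st(1) ne order.strict_trans2[OF _ Min_le[of L], of m] by (auto simp: m_def standard_def)
  have mL: "m \<notin> L" "L - A = L" using m st by (auto simp: standard_def)
  have "lead_coord P (std_symb Q :: ('n, 'r) hook) = exch (basis_chain A' L') (A - {m}) (insert m L)"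
    using st ne by (simp add: P Q lead_coord_def std_symb_def m_def coord_f_symb standard_def)
  also have "\<dots> = (\<Sum>b\<in>insert m L. sgn_in b (A - {m}) * basis_chain A' L' (insert b (A - {m})) (insert m L - {b}))"
    unfolding exch_def using mL by (intro sum.cong) auto
  also have "\<dots> = sgn_in m (A - {m}) * basis_chain A' L' A L +
      (\<Sum>b\<in>L. sgn_in b (A - {m}) * basis_chain A' L' (insert b (A - {m})) (insert m L - {b}))"
    using mL m by (simp add: insert_absorb)
  also have "(\<Sum>b\<in>L. sgn_in b (A - {m}) * basis_chain A' L' (insert b (A - {m})) (insert m L - {b}) :: 'r) = 0"
  proof (rule sum.neutral, rule ballI)
    fix b assume b: "b \<in> L"
    have "\<not> (insert b (A - {m}) = A' \<and> insert m L - {b} = L')"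
    proof
      assume *: "insert b (A - {m}) = A' \<and> insert m L - {b} = L'"
      have "Min A' \<in> A'" using ne by simp
      then have "m < Min A'" using * m b by (auto simp: order.strict_iff_order)
      moreover have "m \<in> L'" using * b mL by auto
      ultimately show False using st(2) by (auto simp: standard_def dest: Min_le[OF finite])
    qed
    then show "sgn_in b (A - {m}) * basis_chain A' L' (insert b (A - {m})) (insert m L - {b}) = (0 :: 'r)"
      by (auto simp: basis_chain_def)
  qed
  also have "sgn_in m (A - {m}) = (1 :: 'r)" using m by (intro sgn_in_Min) auto
  finally show ?thesis by (auto simp: P Q basis_chain_def)
qed

lemma module_hom_lead_coord: "module_hom hook_scale (*) (lead_coord P)"
  using module_hom_coord by (cases P) (simp add: lead_coord_def)

text \<open>Dual functionals read off coefficients. Index set and functionals are kept abstract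
  because three systems occur: standard symbols, generators of the submodule, and the symbols
  \<open>min_facet_symb\<close>.\<close>

lemma dual_expansion:
  fixes g :: "'i \<Rightarrow> ('n, 'r::comm_ring_1) hook" and \<phi> :: "'i \<Rightarrow> ('n, 'r) hook \<Rightarrow> 'r"
  assumes "finite K" "\<And>i. i \<in> K \<Longrightarrow> module_hom hook_scale (*) (\<phi> i)"
    and "\<And>i j. i \<in> K \<Longrightarrow> j \<in> K \<Longrightarrow> \<phi> i (g j) = (if i = j then 1 else 0)"
    and "u \<in> hook.span (g ` K)"
  shows "u = (\<Sum>i\<in>K. hook_scale (\<phi> i u) (g i))"
  using assms(4)
proof (induction rule: hook.span_induct_alt)
  case base
  show ?case using module_hom.zero[OF assms(2)] by simp
next
  case (step c x y)
  then obtain j where j: "j \<in> K" "x = g j" by blast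
  have "(\<Sum>i\<in>K. hook_scale (\<phi> i (hook_scale c x + y)) (g i)) =
    (\<Sum>i\<in>K. (if i = j then hook_scale c (g i) else 0) + hook_scale (\<phi> i y) (g i))"
  proof (rule sum.cong[OF refl])
    fix i assume i: "i \<in> K"
    interpret module_hom hook_scale "(*)" "\<phi> i" by (rule assms(2)[OF i])
    show "hook_scale (\<phi> i (hook_scale c x + y)) (g i) =
      (if i = j then hook_scale c (g i) else 0) + hook_scale (\<phi> i y) (g i)"
      using assms(3)[OF i j(1)] by (simp add: add scale j(2) hook.scale_left_distrib)
  qed
  also have "\<dots> = hook_scale c x + (\<Sum>i\<in>K. hook_scale (\<phi> i y) (g i))"
    using assms(1) j by (simp add: sum.distrib)
  finally show ?case using step.IH by simp
qed

lemma dual_independent: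
  fixes g :: "'i \<Rightarrow> ('n, 'r::comm_ring_1) hook" and \<phi> :: "'i \<Rightarrow> ('n, 'r) hook \<Rightarrow> 'r"
  assumes hom: "\<And>i. i \<in> K \<Longrightarrow> module_hom hook_scale (*) (\<phi> i)"
    and dual: "\<And>i j. i \<in> K \<Longrightarrow> j \<in> K \<Longrightarrow> \<phi> i (g j) = (if i = j then 1 else 0)"
  shows "hook.independent (g ` K)"
  unfolding hook.independent_explicit_module
proof (intro allI impI)
  fix t c v
  assume t: "finite t" "t \<subseteq> g ` K" "(\<Sum>v\<in>t. hook_scale (c v) v) = 0" "v \<in> t"
  then obtain i where i: "i \<in> K" "v = g i" by blast
  interpret module_hom hook_scale "(*)" "\<phi> i" by (rule hom[OF i(1)])
  have "0 = (\<Sum>x\<in>t. c x * \<phi> i x)" using t(3) by (metis (no_types, lifting) sum scale sum.cong zero)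
  also have "\<dots> = (\<Sum>x\<in>t. if x = v then c v else 0)"
  proof (rule sum.cong[OF refl])
    fix x assume "x \<in> t"
    then obtain j where j: "j \<in> K" "x = g j" using t by blast
    \<comment> \<open>Duality makes \<open>g\<close> injective: \<open>x = v\<close> gives
      \<open>\<phi> i x = 1\<close>, hence \<open>j = i\<close>.\<close>
    have "\<phi> i v = 1" using dual[OF i(1) i(1)] i by simp
    then show "c x * \<phi> i x = (if x = v then c v else 0)"
      using dual[OF i(1) j(1)] j i by auto
  qed
  finally show "c v = 0" using t by simp
qed

lemma std_expansion:
  fixes u :: "('n::{finite,linorder}, 'r::comm_ring_1) hook"
  assumes "u \<in> hook_module d i" "1 \<le> i"
  shows "u = (\<Sum>P\<in>std_pairs d i. hook_scale (lead_coord P u) (std_symb P))"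
  using assms hook_module_eq_span_std[OF assms(2)]
  by (intro dual_expansion module_hom_lead_coord lead_coord_std_symb) auto

text \<open>The coordinates include the leading ones, which are the coefficients of \<open>u\<close>
  in the standard symbols; so the embedding is injective.\<close>

lemma eq_0_of_coord_eq_0:
  fixes u :: "('n::{finite,linorder}, 'r::comm_ring_1) hook"
  assumes "u \<in> hook_module d i" "1 \<le> i" "\<And>B M. coord u B M = 0"
  shows "u = 0"
  using std_expansion[OF assms(1,2)] assms(3) by (simp add: lead_coord_def split_def)

lemma subspace_hook_module: "hook.subspace (hook_module d i)"
  unfolding hook_module_def by (rule hook.subspace_span)

text \<open>With \<open>w = exch v\<close> by \<open>exch_exact\<close>, the symbols combined with
  coefficients \<open>v\<close> form a preimage, because \<open>coord\<close> sends
  \<open>f_symb A L\<close> to \<open>exch (basis_chain A L)\<close>.\<close>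

lemma coord_surj:
  fixes w :: "('n::{finite,linorder}, 'r::comm_ring_1) chain_fun"
  assumes "1 \<le> d" "chain p d w" "exch w = (\<lambda>B M. 0)"
  shows "\<exists>u\<in>hook_module d (Suc p). coord u = w"
proof -
  obtain v where v: "chain (Suc p) (d - 1) v" "exch v = w"
    using exch_exact[of p "d - 1" w] assms by auto
  define u where "u = (\<Sum>P\<in>UNIV. hook_scale (v (fst P) (snd P)) (f_symb (fst P) (snd P)))"
  have "hook_scale (v A L) (f_symb A L) \<in> hook_module d (Suc p)" for A L
  proof (cases "v A L = 0")
    case True
    then show ?thesis by (simp add: hook.subspace_0 subspace_hook_module)
  next
    case False
    with chainD[OF v(1) False] show ?thesis
      by (intro hook.subspace_scale[OF subspace_hook_module] f_symb_mem_hook_module) auto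
  qed
  then have "u \<in> hook_module d (Suc p)"
    unfolding u_def by (intro hook.subspace_sum[OF subspace_hook_module])
  moreover have "coord u = w"
  proof (intro ext)
    fix B M
    have "coord u B M = (\<Sum>P\<in>UNIV. v (fst P) (snd P) * exch (basis_chain (fst P) (snd P)) B M)"
      unfolding u_def coord_sum coord_scale
    proof (rule sum.cong[OF refl])
      fix P :: "'n set \<times> 'n set"
      show "v (fst P) (snd P) * coord (f_symb (fst P) (snd P)) B M =
        v (fst P) (snd P) * exch (basis_chain (fst P) (snd P)) B M"
      proof (cases "v (fst P) (snd P) = 0")
        case False
        with chainD[OF v(1) False] show ?thesis by (subst coord_f_symb) auto
      qed simp
    qed
    also have "\<dots> = exch (\<lambda>B M. \<Sum>P\<in>UNIV. v (fst P) (snd P) * basis_chain (fst P) (snd P) B M) B M"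
      by (rule exch_sum[symmetric])
    also have "(\<lambda>B M. \<Sum>P\<in>UNIV. v (fst P) (snd P) * basis_chain (fst P) (snd P) B M) = v"
    proof (intro ext)
      fix B M
      have "(\<Sum>P\<in>UNIV. v (fst P) (snd P) * basis_chain (fst P) (snd P) B M) =
          (\<Sum>P\<in>UNIV. if P = (B, M) then v B M else 0)"
        by (intro sum.cong) (auto simp: basis_chain_def)
      then show "(\<Sum>P\<in>UNIV. v (fst P) (snd P) * basis_chain (fst P) (snd P) B M) = v B M" by simp
    qed
    finally show "coord u B M = w B M" by (simp add: v)
  qed
  ultimately show ?thesis by blast
qed

section \<open>The differentials in coordinates\<close>

lemma hook_diff_mem_hook_module:
  fixes u :: "('n::{finite,linorder}, ('n, 'k::field) mpoly) hook"
  assumes "u \<in> hook_module d (Suc i)" "1 \<le> i"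
  shows "hook_diff u \<in> hook_module d i"
  using assms(1) unfolding hook_module_def[of d "Suc i"]
proof (induction rule: hook.span_induct_alt)
  case base
  show ?case by (simp add: module_hom.zero[OF module_hom_hook_diff] hook.subspace_0 subspace_hook_module)
next
  case (step c x y)
  interpret module_hom hook_scale hook_scale "hook_diff :: ('n, ('n, 'k) mpoly) hook \<Rightarrow> _"
    by (rule module_hom_hook_diff)
  obtain a L where x: "x = hook_symb a L" "valid_symb a L" "length a = Suc i" "card L = d - 1"
    using step.hyps by blast
  have "hook_symb (remove_nth j a) L \<in> (hook_module d i :: ('n, ('n, 'k) mpoly) hook set)" if "j < length a" for j
    using valid_symb_remove_nth[OF x(2) _ that] length_remove_nth[OF that] x assms(2)
    unfolding hook_module_def by (intro hook.span_base) auto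
  moreover have "hook_diff x = (\<Sum>j<length a. hook_scale ((-1) ^ (length a - Suc j) * X (a ! j)) (hook_symb (remove_nth j a) L))"
    using x assms(2) by (simp add: hook_diff_symb diff_symb_def)
  ultimately have "hook_diff x \<in> hook_module d i"
    by (simp only:) (intro hook.subspace_sum hook.subspace_scale subspace_hook_module, simp)
  then show ?case unfolding add scale using step.IH
    by (intro hook.subspace_add hook.subspace_scale subspace_hook_module)
qed

lemma koszul_sum:
  fixes f :: "'i \<Rightarrow> ('n::{finite,linorder}, ('n, 'k::field) mpoly) chain_fun"
  shows "koszul (\<lambda>B M. \<Sum>i\<in>S. c i * f i B M) B M = (\<Sum>i\<in>S. c i * koszul (f i) B M)"
proof -
  have "koszul (\<lambda>B M. \<Sum>i\<in>S. c i * f i B M) B M =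
      (\<Sum>b\<in>- (B \<union> M). \<Sum>i\<in>S. c i * (sgn_in b B * X b * f i (insert b B) M))"
    by (simp add: koszul_def sum_distrib_left algebra_simps)
  also have "\<dots> = (\<Sum>i\<in>S. c i * koszul (f i) B M)"
    by (subst sum.swap) (simp add: koszul_def sum_distrib_left)
  finally show ?thesis .
qed

lemma koszul_scale:
  fixes f :: "('n::{finite,linorder}, ('n, 'k::field) mpoly) chain_fun"
  shows "koszul (\<lambda>B M. c * f B M) B M = c * koszul f B M"
  using koszul_sum[of "\<lambda>_. c" "\<lambda>_. f" "{()}" B M] by simp

text \<open>Expanding \<open>perm_sgn\<close> at position \<open>j\<close> merges
  \<open>(-1) ^ (i - Suc j)\<close> and \<open>(-1) ^ j\<close> into the constant
  \<open>(-1) ^ (i - 1)\<close>. The result is \<open>exch\<close> of a Koszul boundary, and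
  anticommuting the two maps turns the sign into \<open>(-1) ^ i\<close>.\<close>

lemma coord_hook_diff:
  fixes u :: "('n::{finite,linorder}, ('n, 'k::field) mpoly) hook"
  assumes "u \<in> hook_module d i" "2 \<le> i"
  shows "coord (hook_diff u) B M = (-1) ^ i * koszul (coord u) B M"
  using assms(1) unfolding hook_module_def
proof (induction rule: hook.span_induct_alt)
  case base
  show ?case by (simp add: module_hom.zero[OF module_hom_hook_diff] koszul_def)
next
  case (step c x y)
  interpret module_hom hook_scale hook_scale "hook_diff :: ('n, ('n, 'k) mpoly) hook \<Rightarrow> _"
    by (rule module_hom_hook_diff)
  obtain a L where x: "x = hook_symb a L" "valid_symb a L" "length a = i"
    using step.hyps by blast
  let ?A = "set a"
  let ?E = "\<lambda>A L. exch (basis_chain A L) :: ('n, ('n, 'k) mpoly) chain_fun"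
  have d: "distinct a" "?A \<inter> L = {}" using x(2) by (auto simp: valid_symb_def)
  have cx: "coord x = (\<lambda>B M. perm_sgn a * ?E ?A L B M)"
    by (intro ext) (simp add: x coord_hook_symb coord_symb_def)
  define f where "f y = (-1) ^ (i - 1) * perm_sgn a * (sgn_in y (?A - {y}) * X y * ?E (?A - {y}) L B M)" for y
  have "coord (hook_diff x) B M = (\<Sum>j<length a. (-1) ^ (i - Suc j) * X (a ! j) * coord_symb B M (remove_nth j a, L))"
    using assms(2) by (simp add: x hook_diff_symb diff_symb_def coord_sum coord_scale coord_hook_symb)
  also have "\<dots> = (\<Sum>j<length a. f (a ! j))"
  proof (rule sum.cong[OF refl])
    fix j assume "j \<in> {..<length a}"
    then have j: "j < length a" by simp
    have v: "valid_symb (remove_nth j a) L" using valid_symb_remove_nth[OF x(2) _ j] x assms(2) by simp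
    have "(-1) ^ (i - 1) = (-1) ^ (i - Suc j) * (-1 :: ('n, 'k) mpoly) ^ j"
      using j x(3) by (simp flip: power_add)
    then show "(-1) ^ (i - Suc j) * X (a ! j) * coord_symb B M (remove_nth j a, L) = f (a ! j)"
      unfolding f_def perm_sgn_remove_nth[OF d(1) j]
      by (simp add: coord_symb_def v set_remove_nth[OF d(1) j] algebra_simps flip: power_mult_distrib)
  qed
  also have "\<dots> = (-1) ^ (i - 1) * perm_sgn a * (\<Sum>y\<in>?A. sgn_in y (?A - {y}) * X y * ?E (?A - {y}) L B M)"
    unfolding sum_nth_eq_sum_set[OF d(1)] by (simp add: sum_distrib_left f_def)
  also have "(\<Sum>y\<in>?A. sgn_in y (?A - {y}) * X y * ?E (?A - {y}) L B M) = - koszul (?E ?A L) B M"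
  proof -
    have "koszul (basis_chain ?A L) =
      (\<lambda>B M. \<Sum>y\<in>?A. (sgn_in y (?A - {y}) * X y) * basis_chain (?A - {y}) L B M :: ('n, 'k) mpoly)"
      by (intro ext koszul_basis_chain d)
    then show ?thesis by (simp only: koszul_exch exch_sum minus_minus)
  qed
  also have "(-1) ^ (i - 1) * perm_sgn a * - koszul (?E ?A L) B M = (-1) ^ i * koszul (coord x) B M"
    unfolding cx koszul_scale using assms(2) by (cases i) (auto simp: algebra_simps)
  finally have "coord (hook_diff x) B M = (-1) ^ i * koszul (coord x) B M" .
  moreover have "coord (hook_scale c x + y) = (\<lambda>B M. c * coord x B M + coord y B M)"
    by (intro ext) (simp add: coord_add coord_scale)
  ultimately show ?case
    by (simp add: add scale coord_add coord_scale step.IH koszul_add koszul_scale algebra_simps)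
qed

text \<open>A symbol with the single entry \<open>e\<close> has just one nonzero coordinate, namely
  1 at \<open>({}, insert e L)\<close>, whose monomial is the value of
  \<open>hook_aug\<close>.\<close>

lemma hook_aug_eq_aug_chain:
  fixes u :: "('n::{finite,linorder}, ('n, 'k::field) mpoly) hook"
  assumes "u \<in> hook_module d 1"
  shows "hook_aug u = aug_chain (coord u)"
  using assms unfolding hook_module_def
proof (induction rule: hook.span_induct_alt)
  case base
  show ?case by (simp add: module_hom.zero[OF module_hom_hook_aug] aug_chain_def)
next
  case (step c x y)
  interpret module_hom hook_scale "(*)" "hook_aug :: ('n, ('n, 'k) mpoly) hook \<Rightarrow> _"
    by (rule module_hom_hook_aug)
  obtain e L where x: "x = hook_symb [e] L" "valid_symb [e] L"
    using step.hyps by (auto simp: length_Suc_conv)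
  have e: "{e} \<inter> L = {}" "e \<notin> L" using x(2) by (auto simp: valid_symb_def)
  have "aug_chain (coord x) = (\<Sum>M\<in>UNIV. if M = insert e L then sqfree_mon (insert e L) else 0)"
    unfolding aug_chain_def using x(2)
    by (intro sum.cong refl)
      (simp add: x(1) coord_hook_symb coord_symb_def exch_basis_chain[OF e(1)] basis_chain_def)
  also have "\<dots> = hook_aug x"
    using e by (simp add: x hook_aug_symb aug_symb_def sqfree_mon_insert)
  finally have "aug_chain (coord x) = hook_aug x" .
  moreover have "sqfree_mon M * coord (hook_scale c x + y) {} M =
      c * (sqfree_mon M * coord x {} M) + sqfree_mon M * coord y {} M" for M
    by (simp only: coord_add coord_scale distrib_left mult.left_commute)
  then have "aug_chain (coord (hook_scale c x + y)) = c * aug_chain (coord x) + aug_chain (coord y)"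
    by (simp only: aug_chain_def sum.distrib sum_distrib_left)
  ultimately show ?case by (simp only: add scale step.IH)
qed


section \<open>The grading\<close>

lemma mon_degree_add: "mon_degree (s + t) = mon_degree s + mon_degree t"
  by (simp add: mon_degree_def lookup_add sum.distrib)

lemma poly_homogeneous_mult:
  "p \<in> poly_homogeneous a \<Longrightarrow> q \<in> poly_homogeneous b \<Longrightarrow> p * q \<in> poly_homogeneous (a + b)"
  using keys_mult[of p q] by (fastforce simp: poly_homogeneous_def mon_degree_add)

lemma poly_homogeneous_uminus: "p \<in> poly_homogeneous a \<Longrightarrow> - p \<in> poly_homogeneous a"
  by (simp add: poly_homogeneous_def)

lemma poly_homogeneous_minus_one_power: "p \<in> poly_homogeneous a \<Longrightarrow> (-1) ^ k * p \<in> poly_homogeneous a"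
  by (cases "even k") (simp_all add: poly_homogeneous_uminus)

lemma poly_homogeneous_sum:
  "(\<And>i. i \<in> S \<Longrightarrow> f i \<in> poly_homogeneous a) \<Longrightarrow> sum f S \<in> poly_homogeneous a"
  using keys_sum[of f S] by (fastforce simp: poly_homogeneous_def)

lemma poly_homogeneous_X: "X i \<in> poly_homogeneous 1"
  by (simp add: poly_homogeneous_def X_def mon_degree_def lookup_single when_def)

lemma poly_homogeneous_sqfree_mon: "sqfree_mon A \<in> poly_homogeneous (card A)"
  by (simp add: poly_homogeneous_def sqfree_mon_eq_single mon_degree_def lookup_set_exp sum.If_cases)

section \<open>Projections onto the homogeneous components\<close>

definition symb_degree :: "'n symb \<Rightarrow> nat" where
  "symb_degree s = length (fst s) + card (snd s)"

lift_definition filter_mon :: "('a \<Rightarrow> bool) \<Rightarrow> ('a \<Rightarrow>\<^sub>0 'b) \<Rightarrow> ('a \<Rightarrow>\<^sub>0 'b::zero)" is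
  "\<lambda>P f t. if P t then f t else 0"
  by (erule rev_finite_subset) auto

lemma filter_mon_0 [simp]: "filter_mon P 0 = 0"
  by transfer auto

lift_definition hom_part :: "nat \<Rightarrow> ('n::finite symb \<Rightarrow>\<^sub>0 ('n, 'k::field) mpoly) \<Rightarrow> ('n symb \<Rightarrow>\<^sub>0 ('n, 'k) mpoly)" is
  "\<lambda>m f s. filter_mon (\<lambda>t. mon_degree t + symb_degree s = m) (f s)"
  by (erule rev_finite_subset) auto

lemma lookup_hom_part:
  "Poly_Mapping.lookup (Poly_Mapping.lookup (hom_part m v) s) t =
    (if mon_degree t + symb_degree s = m then Poly_Mapping.lookup (Poly_Mapping.lookup v s) t else 0)"
  by (simp add: hom_part.rep_eq filter_mon.rep_eq)

lemma hom_part_0 [simp]: "hom_part m 0 = 0"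
  by (intro poly_mapping_eqI) (simp add: lookup_hom_part)

lemma hom_part_add: "hom_part m (u + v) = hom_part m u + hom_part m v"
  by (intro poly_mapping_eqI) (simp add: lookup_hom_part lookup_add)

lemma hom_part_diff: "hom_part m (u - v) = hom_part m u - hom_part m v"
  by (intro poly_mapping_eqI) (simp add: lookup_hom_part lookup_minus)

lemma hom_part_sum: "hom_part m (sum f S) = (\<Sum>i\<in>S. hom_part m (f i))"
  by (induction S rule: infinite_finite_induct) (simp_all add: hom_part_add)

lemma hom_part_single:
  "hom_part m (free_scale c (Poly_Mapping.single s 1)) =
    free_scale (filter_mon (\<lambda>t. mon_degree t + symb_degree s = m) c) (Poly_Mapping.single s 1)"
  by (intro poly_mapping_eqI)
    (auto simp: lookup_hom_part lookup_single when_def filter_mon.rep_eq)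

text \<open>All symbols in one relation have the same degree \<open>e\<close>, so projecting a
  multiple of the relation only filters its coefficient. Therefore the projections descend to the
  quotient.\<close>

lemma hom_part_hook_relations:
  assumes "\<rho> \<in> hook_relations"
  shows "\<exists>e. \<forall>c. hom_part m (free_scale c \<rho>) = free_scale (filter_mon (\<lambda>t. mon_degree t + e = m) c) \<rho>"
  using assms unfolding hook_relations_def alternating_relations_def straightening_relations_def Un_iff
proof (elim disjE CollectE exE conjE)
  fix xs p q ys L
  assume \<rho>: "\<rho> = Poly_Mapping.single (xs @ p # q # ys, L) 1 + Poly_Mapping.single (xs @ q # p # ys, L) 1"
  have "symb_degree (xs @ q # p # ys, L) = symb_degree (xs @ p # q # ys, L)" by (simp add: symb_degree_def)
  then show ?thesis unfolding \<rho> free.scale_right_distrib hom_part_add hom_part_single by metis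
next
  fix a b L
  assume \<rho>: "\<rho> = Poly_Mapping.single (a, L) 1
        - (\<Sum>m<length a. Poly_Mapping.single (a[m := b], insert (a ! m) (L - {b})) 1)"
    and v: "valid_symb a L" "b \<in> L"
  have deg: "symb_degree (a[j := b], insert (a ! j) (L - {b})) = symb_degree (a, L)" if "j < length a" for j
  proof -
    have "a ! j \<notin> L" using v nth_mem[OF that] unfolding valid_symb_def by blast
    then show ?thesis using card_Suc_Diff1[of L b] v(2) by (simp add: symb_degree_def)
  qed
  show ?thesis
    unfolding \<rho> free.scale_right_diff_distrib hom_part_diff hom_part_single free.scale_sum_right hom_part_sum
    by (intro exI[of _ "symb_degree (a, L)"] allI arg_cong2[of _ _ _ _ "(-)"] refl sum.cong) (simp only: deg lessThan_iff)
qed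

lemma hom_part_span:
  assumes "v \<in> free.span hook_relations"
  shows "hom_part m v \<in> free.span hook_relations"
  using assms
proof (induction rule: free.span_induct_alt)
  case base
  show ?case by (simp add: free.span_zero)
next
  case (step c x y)
  obtain e where "hom_part m (free_scale c x) = free_scale (filter_mon (\<lambda>t. mon_degree t + e = m) c) x"
    using hom_part_hook_relations[OF step.hyps] by blast
  then show ?case unfolding hom_part_add
    using step by (metis free.span_add free.span_scale free.span_base)
qed

lift_definition hook_part :: "nat \<Rightarrow> ('n::finite, ('n, 'k::field) mpoly) hook \<Rightarrow> ('n, ('n, 'k) mpoly) hook" is hom_part
  unfolding hook_eq_def by (simp add: hom_part_span flip: hom_part_diff)

lemma hook_part_0 [simp]: "hook_part m 0 = 0"
  by (simp add: zero_hook_def hook_part.abs_eq)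

lemma hook_part_add: "hook_part m (u + v) = hook_part m u + hook_part m v"
  by transfer (simp add: hom_part_add hook_eq_def free.span_zero)

lemma hook_part_sum: "hook_part m (sum f S) = (\<Sum>i\<in>S. hook_part m (f i))"
  by (induction S rule: infinite_finite_induct) (simp_all add: hook_part_add)

text \<open>Together with \<open>hom_part_hom_part\<close>, this description by fixed points of a
  projection gives membership the equational form \<open>hook_homogeneous_iff\<close>.\<close>

lemma hook_homogeneous_altdef:
  "hook_homogeneous m = {abs_hook v | v. hom_part m v = v}"
proof -
  have "(\<forall>(a, L)\<in>Poly_Mapping.keys v. \<forall>t\<in>Poly_Mapping.keys (Poly_Mapping.lookup v (a, L)).
      mon_degree t + (length a + card L) = m) \<longleftrightarrow> hom_part m v = v" (is "?l \<longleftrightarrow> ?r") for v :: "'a symb \<Rightarrow>\<^sub>0 ('a, 'b) mpoly"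
  proof
    assume l: ?l
    show ?r
    proof (intro poly_mapping_eqI)
      fix s t
      show "Poly_Mapping.lookup (Poly_Mapping.lookup (hom_part m v) s) t = Poly_Mapping.lookup (Poly_Mapping.lookup v s) t"
        using bspec[OF l, of s] unfolding lookup_hom_part
        by (cases s; cases "Poly_Mapping.lookup v s = 0") (auto simp: symb_degree_def in_keys_iff)
    qed
  next
    assume r: ?r
    show ?l
    proof (intro ballI, clarify)
      fix a L t
      assume "t \<in> Poly_Mapping.keys (Poly_Mapping.lookup v (a, L))"
      then show "mon_degree t + (length a + card L) = m"
        using lookup_hom_part[of m v "(a, L)" t] r by (auto simp: symb_degree_def in_keys_iff split: if_splits)
    qed
  qed
  then show ?thesis by (simp add: hook_homogeneous_def)
qed

lemma hom_part_hom_part: "hom_part m (hom_part m' v) = (if m = m' then hom_part m v else 0)"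
  by (intro poly_mapping_eqI) (auto simp: lookup_hom_part)

lemma hook_part_homogeneous:
  "u \<in> hook_homogeneous m' \<Longrightarrow> hook_part m u = (if m = m' then u else 0)"
  unfolding hook_homogeneous_altdef
  by (clarsimp simp: hook_part.abs_eq) (metis hom_part_hom_part zero_hook.abs_eq)

lemma hook_part_mem: "hook_part m u \<in> hook_homogeneous m"
proof -
  obtain v where "u = abs_hook v" using abs_hook_surj by blast
  then show ?thesis unfolding hook_homogeneous_altdef
    by (intro CollectI exI[of _ "hom_part m v"]) (simp add: hook_part.abs_eq hom_part_hom_part)
qed

lemma hook_homogeneous_iff: "u \<in> hook_homogeneous m \<longleftrightarrow> hook_part m u = u"
  using hook_part_homogeneous[of u m m] hook_part_mem[of m u] by auto

lemma hook_homogeneous_0: "0 \<in> hook_homogeneous m"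
  by (simp add: hook_homogeneous_iff)

lemma hook_homogeneous_add:
  "u \<in> hook_homogeneous m \<Longrightarrow> v \<in> hook_homogeneous m \<Longrightarrow> u + v \<in> hook_homogeneous m"
  by (simp add: hook_homogeneous_iff hook_part_add)

lemma hook_homogeneous_sum:
  "(\<And>i. i \<in> S \<Longrightarrow> f i \<in> hook_homogeneous m) \<Longrightarrow> sum f S \<in> hook_homogeneous m"
  by (simp add: hook_homogeneous_iff hook_part_sum)

lemma hook_homogeneous_scale:
  assumes c: "c \<in> poly_homogeneous e" and u: "u \<in> hook_homogeneous m"
  shows "hook_scale c u \<in> hook_homogeneous (e + m)"
proof -
  obtain v where v: "u = abs_hook v" "\<forall>(a, L)\<in>Poly_Mapping.keys v. \<forall>t\<in>Poly_Mapping.keys (Poly_Mapping.lookup v (a, L)).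
      mon_degree t + (length a + card L) = m" using u by (auto simp: hook_homogeneous_def)
  have "\<forall>(a, L)\<in>Poly_Mapping.keys (free_scale c v). \<forall>t\<in>Poly_Mapping.keys (Poly_Mapping.lookup (free_scale c v) (a, L)).
      mon_degree t + (length a + card L) = e + m"
  proof (intro ballI, clarify)
    fix a L t
    assume "t \<in> Poly_Mapping.keys (Poly_Mapping.lookup (free_scale c v) (a, L))"
    then obtain t1 t2 where t: "t = t1 + t2" "t1 \<in> Poly_Mapping.keys c" "t2 \<in> Poly_Mapping.keys (Poly_Mapping.lookup v (a, L))"
      using keys_mult[of c "Poly_Mapping.lookup v (a, L)"] by auto
    moreover from this have "(a, L) \<in> Poly_Mapping.keys v" by (auto simp: in_keys_iff)
    ultimately show "mon_degree t + (length a + card L) = e + m"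
      using v(2) c by (fastforce simp: poly_homogeneous_def mon_degree_add)
  qed
  then show ?thesis unfolding hook_homogeneous_def v(1) hook_scale.abs_eq by blast
qed

lemma hook_homogeneous_neg: "u \<in> hook_homogeneous m \<Longrightarrow> - u \<in> hook_homogeneous m"
  using hook_homogeneous_scale[of "-1" 0 u m]
  by (simp add: poly_homogeneous_def mon_degree_def)

lemma hook_homogeneous_symb: "hook_symb a L \<in> hook_homogeneous (length a + card L)"
  unfolding hook_homogeneous_def hook_symb_def
  by (intro CollectI exI[of _ "Poly_Mapping.single (a, L) 1"]) (auto simp: mon_degree_def)

text \<open>A representative has finitely many terms; \<open>D\<close> collects their
  degrees.\<close>

lemma sum_hook_part:
  "\<exists>D. finite D \<and> (\<forall>m. hook_part m u \<noteq> 0 \<longrightarrow> m \<in> D) \<and> u = (\<Sum>m\<in>D. hook_part m u)"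
proof -
  obtain v where v: "u = abs_hook v" using abs_hook_surj by blast
  interpret cl: module_hom free_scale hook_scale abs_hook by (rule module_hom_abs_hook)
  define D where "D = (\<Union>s\<in>Poly_Mapping.keys v. (\<lambda>t. mon_degree t + symb_degree s) ` Poly_Mapping.keys (Poly_Mapping.lookup v s))"
  have D: "mon_degree t + symb_degree s \<in> D" if "Poly_Mapping.lookup (Poly_Mapping.lookup v s) t \<noteq> 0" for s t
  proof -
    have "s \<in> Poly_Mapping.keys v" using that by (auto simp: in_keys_iff)
    moreover have "t \<in> Poly_Mapping.keys (Poly_Mapping.lookup v s)" using that by (simp add: in_keys_iff)
    ultimately show ?thesis unfolding D_def by (intro UN_I[of s] image_eqI[of _ _ t]) simp_all
  qed
  have fin: "finite D" by (simp add: D_def)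
  have "hom_part m v = 0" if "m \<notin> D" for m
    using D that by (intro poly_mapping_eqI) (auto simp: lookup_hom_part)
  then have "hook_part m u = 0" if "m \<notin> D" for m
    using that by (simp add: v hook_part.abs_eq flip: zero_hook_def)
  moreover have "v = (\<Sum>m\<in>D. hom_part m v)"
  proof (intro poly_mapping_eqI)
    fix s t
    show "Poly_Mapping.lookup (Poly_Mapping.lookup v s) t = Poly_Mapping.lookup (Poly_Mapping.lookup (\<Sum>m\<in>D. hom_part m v) s) t"
      using fin D[of s t] by (auto simp: lookup_sum lookup_hom_part)
  qed
  then have "u = (\<Sum>m\<in>D. hook_part m u)"
    unfolding v hook_part.abs_eq by (metis cl.sum)
  ultimately show ?thesis using fin by blast
qed

text \<open>The components can only be the \<open>hook_part m u\<close>: applying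
  \<open>hook_part m\<close> to any decomposition singles out its summand of degree
  \<open>m\<close>.\<close>

lemma grading_hook: "grading hook_scale hook_homogeneous"
  unfolding grading_def
proof (intro conjI allI ballI)
  fix m and u v :: "('a, ('a, 'b) mpoly) hook"
  assume "u \<in> hook_homogeneous m" "v \<in> hook_homogeneous m"
  then show "u - v \<in> hook_homogeneous m"
    using hook_homogeneous_add[of u m "- v", OF _ hook_homogeneous_neg[of v m]] by simp
next
  fix u :: "('a, ('a, 'b) mpoly) hook"
  show "\<exists>!c. (\<forall>m. Poly_Mapping.lookup c m \<in> hook_homogeneous m) \<and>
    u = (\<Sum>m\<in>Poly_Mapping.keys c. Poly_Mapping.lookup c m)"
  proof (rule ex_ex1I)
    obtain D where D: "finite D" "\<And>m. hook_part m u \<noteq> 0 \<Longrightarrow> m \<in> D" "u = (\<Sum>m\<in>D. hook_part m u)"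
      using sum_hook_part by blast
    define c where "c = Abs_poly_mapping (\<lambda>m. hook_part m u)"
    have "finite {m. hook_part m u \<noteq> 0}" using D by (auto intro: finite_subset[of _ D])
    then have c: "Poly_Mapping.lookup c m = hook_part m u" for m
      by (simp add: c_def Abs_poly_mapping_inverse)
    have "u = (\<Sum>m\<in>Poly_Mapping.keys c. Poly_Mapping.lookup c m)"
      unfolding c using D by (subst D(3), intro sum.mono_neutral_right) (auto simp: in_keys_iff c)
    then show "\<exists>c. (\<forall>m. Poly_Mapping.lookup c m \<in> hook_homogeneous m) \<and>
        u = (\<Sum>m\<in>Poly_Mapping.keys c. Poly_Mapping.lookup c m)"
      by (intro exI[of _ c]) (simp add: c hook_part_mem)
  next
    fix c c'
    have *: "Poly_Mapping.lookup c m = hook_part m u"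
      if "(\<forall>m. Poly_Mapping.lookup c m \<in> hook_homogeneous m) \<and>
        u = (\<Sum>m\<in>Poly_Mapping.keys c. Poly_Mapping.lookup c m)" for c m
    proof -
      have "hook_part m u = (\<Sum>m'\<in>Poly_Mapping.keys c. if m = m' then Poly_Mapping.lookup c m' else 0)"
        unfolding conjunct2[OF that] hook_part_sum
        by (simp add: hook_part_homogeneous[OF spec[OF conjunct1[OF that]]])
      then show ?thesis by (auto simp: in_keys_iff)
    qed
    assume "(\<forall>m. Poly_Mapping.lookup c m \<in> hook_homogeneous m) \<and>
        u = (\<Sum>m\<in>Poly_Mapping.keys c. Poly_Mapping.lookup c m)"
      "(\<forall>m. Poly_Mapping.lookup c' m \<in> hook_homogeneous m) \<and>
        u = (\<Sum>m\<in>Poly_Mapping.keys c'. Poly_Mapping.lookup c' m)"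
    from *[OF this(1)] *[OF this(2)] show "c = c'" by (intro poly_mapping_eqI) simp
  qed
qed (simp_all add: hook_homogeneous_0 hook_homogeneous_scale)

text \<open>This reduces homogeneity of a linear map to its values on symbols. The bound by
  \<open>m\<close> is recorded because subtraction on \<open>nat\<close> truncates.\<close>

lemma hook_homogeneous_eq_sum:
  assumes "u \<in> hook_homogeneous m"
  shows "\<exists>S c. finite S \<and> u = (\<Sum>(a, L)\<in>S. hook_scale (c (a, L)) (hook_symb a L)) \<and>
    (\<forall>(a, L)\<in>S. length a + card L \<le> m \<and> c (a, L) \<in> poly_homogeneous (m - (length a + card L)))"
proof -
  obtain v where v: "u = abs_hook v" "\<forall>(a, L)\<in>Poly_Mapping.keys v. \<forall>t\<in>Poly_Mapping.keys (Poly_Mapping.lookup v (a, L)).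
      mon_degree t + (length a + card L) = m" using assms by (auto simp: hook_homogeneous_def)
  interpret cl: module_hom free_scale hook_scale abs_hook by (rule module_hom_abs_hook)
  have "v = (\<Sum>s\<in>Poly_Mapping.keys v. free_scale (Poly_Mapping.lookup v s) (Poly_Mapping.single s 1))"
    by (intro poly_mapping_eqI) (auto simp: lookup_sum lookup_single when_def in_keys_iff if_distrib cong: if_cong)
  then have "u = (\<Sum>s\<in>Poly_Mapping.keys v. hook_scale (Poly_Mapping.lookup v s) (abs_hook (Poly_Mapping.single s 1)))"
    unfolding v(1) by (metis (no_types, lifting) cl.scale cl.sum sum.cong)
  then have 1: "u = (\<Sum>(a, L)\<in>Poly_Mapping.keys v. hook_scale (Poly_Mapping.lookup v (a, L)) (hook_symb a L))"
    by (simp add: hook_symb_def split_def)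
  have 2: "length a + card L \<le> m \<and> Poly_Mapping.lookup v (a, L) \<in> poly_homogeneous (m - (length a + card L))"
    if "(a, L) \<in> Poly_Mapping.keys v" for a L
  proof -
    have *: "\<forall>t\<in>Poly_Mapping.keys (Poly_Mapping.lookup v (a, L)). mon_degree t + (length a + card L) = m"
      using v(2) that by auto
    have "Poly_Mapping.keys (Poly_Mapping.lookup v (a, L)) \<noteq> {}" using that by (simp add: in_keys_iff)
    then obtain t where "t \<in> Poly_Mapping.keys (Poly_Mapping.lookup v (a, L))" by blast
    with * show ?thesis by (auto simp: poly_homogeneous_def)
  qed
  show ?thesis
    using 1 2 by (intro exI[of _ "Poly_Mapping.keys v"] exI[of _ "Poly_Mapping.lookup v"]) auto
qed

section \<open>Homogeneity of the differentials\<close>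

lemma hook_homogeneous_diff_symb: "diff_symb (a, L) \<in> hook_homogeneous (length a + card L)"
proof -
  have "hook_scale ((-1) ^ (length a - Suc j) * X (a ! j)) (hook_symb (remove_nth j a) L)
      \<in> hook_homogeneous (length a + card L)" if "length a > 1" "j < length a" for j
  proof -
    have "length a + card L = 1 + (length (remove_nth j a) + card L)"
      using that by (simp add: length_remove_nth)
    then show ?thesis
      using hook_homogeneous_scale[OF poly_homogeneous_minus_one_power[OF poly_homogeneous_X]
        hook_homogeneous_symb[of "remove_nth j a" L], of "length a - Suc j" "a ! j"]
      by (simp only:)
  qed
  then show ?thesis by (auto simp: diff_symb_def hook_homogeneous_0 intro!: hook_homogeneous_sum)
qed

lemma hook_diff_homogeneous:
  assumes "u \<in> hook_homogeneous m"
  shows "hook_diff u \<in> hook_homogeneous m"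
proof -
  obtain S c where S: "u = (\<Sum>(a, L)\<in>S. hook_scale (c (a, L)) (hook_symb a L))"
    "\<forall>(a, L)\<in>S. length a + card L \<le> m \<and> c (a, L) \<in> poly_homogeneous (m - (length a + card L))"
    using hook_homogeneous_eq_sum[OF assms] by blast
  interpret module_hom hook_scale hook_scale "hook_diff :: ('a, ('a, 'b) mpoly) hook \<Rightarrow> _"
    by (rule module_hom_hook_diff)
  have "hook_scale (c (a, L)) (diff_symb (a, L)) \<in> hook_homogeneous m" if "(a, L) \<in> S" for a L
  proof -
    have "m - (length a + card L) + (length a + card L) = m" using S(2) that by auto
    moreover have "c (a, L) \<in> poly_homogeneous (m - (length a + card L))" using S(2) that by auto
    ultimately show ?thesis
      using hook_homogeneous_scale[OF _ hook_homogeneous_diff_symb[of a L], of "c (a, L)" "m - (length a + card L)"]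
      by (simp only:)
  qed
  then have "hook_diff (case s of (a, L) \<Rightarrow> hook_scale (c (a, L)) (hook_symb a L)) \<in> hook_homogeneous m"
    if "s \<in> S" for s using that by (cases s) (simp only: prod.case scale hook_diff_symb)
  then show ?thesis unfolding S(1) sum by (rule hook_homogeneous_sum)
qed

lemma hook_aug_homogeneous:
  fixes u :: "('n::finite, ('n, 'k::field) mpoly) hook"
  assumes "u \<in> hook_homogeneous m"
  shows "hook_aug u \<in> poly_homogeneous m"
proof -
  obtain S c where S: "u = (\<Sum>(a, L)\<in>S. hook_scale (c (a, L)) (hook_symb a L))"
    "\<forall>(a, L)\<in>S. length a + card L \<le> m \<and> c (a, L) \<in> poly_homogeneous (m - (length a + card L))"
    using hook_homogeneous_eq_sum[OF assms] by blast
  interpret module_hom hook_scale "(*)" "hook_aug :: ('n, ('n, 'k) mpoly) hook \<Rightarrow> _"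
    by (rule module_hom_hook_aug)
  have "aug_symb (a, L) \<in> (poly_homogeneous (length a + card L) :: ('n, 'k) mpoly set)" for a :: "'n list" and L
  proof (cases "length a = 1")
    case True
    then have "aug_symb (a, L) = (X (hd a) * sqfree_mon L :: ('n, 'k) mpoly)" by (simp add: aug_symb_def)
    then show ?thesis
      unfolding True by (simp only: poly_homogeneous_mult poly_homogeneous_X poly_homogeneous_sqfree_mon)
  next
    case False
    then show ?thesis by (simp add: aug_symb_def poly_homogeneous_def)
  qed
  note aug = this
  have "c (a, L) * aug_symb (a, L) \<in> poly_homogeneous m" if "(a, L) \<in> S" for a L
  proof -
    have "m - (length a + card L) + (length a + card L) = m" using S(2) that by auto
    moreover have "c (a, L) \<in> poly_homogeneous (m - (length a + card L))" using S(2) that by auto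
    ultimately show ?thesis using poly_homogeneous_mult[OF _ aug[of a L], of "c (a, L)" "m - (length a + card L)"]
      by (simp only:)
  qed
  then have "hook_aug (case s of (a, L) \<Rightarrow> hook_scale (c (a, L)) (hook_symb a L)) \<in> poly_homogeneous m"
    if "s \<in> S" for s using that by (cases s) (simp only: prod.case scale hook_aug_symb)
  then show ?thesis unfolding S(1) sum by (rule poly_homogeneous_sum)
qed


section \<open>The subcomplex\<close>

text \<open>Writing \<open>+ 2 \<le> d\<close> keeps the condition faithful for
  \<open>d = 1\<close>, where the truncated \<open>d - 2\<close> would be 0 and would admit disjoint
  members.\<close>

locale separated_family =
  fixes I :: "nat \<Rightarrow> 'n::{finite,linorder} set" and d r :: nat
  assumes d_pos: "1 \<le> d"
    and card_I: "s \<in> {1..r} \<Longrightarrow> card (I s) = d"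
    and separated: "s \<in> {1..r} \<Longrightarrow> t \<in> {1..r} \<Longrightarrow> s \<noteq> t \<Longrightarrow> card (I s \<inter> I t) + 2 \<le> d"
begin

text \<open>A facet common to two members would put \<open>d - 1\<close> elements into their
  intersection.\<close>

lemma facet_unique:
  assumes "s \<in> {1..r}" "t \<in> {1..r}" "x \<in> I s" "y \<in> I t" "I s - {x} = I t - {y}"
  shows "s = t \<and> x = y"
proof (cases "s = t")
  case True
  then show ?thesis using assms by auto
next
  case False
  have "I s - {x} \<subseteq> I s \<inter> I t" using assms by auto
  then have "card (I s - {x}) \<le> card (I s \<inter> I t)" by (intro card_mono) auto
  then show ?thesis using separated[OF assms(1,2) False] card_I[OF assms(1)] assms(3) d_pos by simp
qed

lemma Min_I: "s \<in> {1..r} \<Longrightarrow> Min (I s) \<in> I s"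
  using card_I[of s] d_pos by (intro Min_in) auto

lemma standard_Min:
  assumes "s \<in> {1..r}" "J \<inter> I s = {}"
  shows "standard (insert (Min (I s)) J) (I s - {Min (I s)})"
proof -
  let ?m = "Min (I s)"
  have "?m < y" if "y \<in> I s - {?m}" for y using that by (auto simp: order.strict_iff_order)
  then have "I s - {?m} = {} \<or> ?m < Min (I s - {?m})" by (cases "I s - {?m} = {}") auto
  moreover have "Min (insert ?m J) \<le> ?m" by simp
  ultimately have "I s - {?m} = {} \<or> Min (insert ?m J) < Min (I s - {?m})" by (metis le_less_trans)
  then show ?thesis using assms unfolding standard_def by blast
qed

text \<open>Covers the first two families of generators at once: if \<open>L\<close> is no facet the
  condition is empty, and for \<open>L = I s - {x}\<close> it reads \<open>x \<notin> A\<close>, by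
  \<open>facet_unique\<close>.\<close>

definition facet_free :: "'n set \<Rightarrow> 'n set \<Rightarrow> bool" where
  "facet_free A L \<longleftrightarrow> (\<forall>s\<in>{1..r}. \<forall>x\<in>I s. L = I s - {x} \<longrightarrow> x \<notin> A)"

text \<open>The sign normalises the coordinate at \<open>(J, I s)\<close> to 1 for every
  \<open>x\<close>; a generator of the third family is a difference of two such symbols.\<close>

definition facet_symb :: "nat \<Rightarrow> 'n \<Rightarrow> 'n set \<Rightarrow> ('n, ('n, 'k::field) mpoly) hook" where
  "facet_symb s x J = hook_scale (sgn_in x J) (f_symb (insert x J) (I s - {x}))"

lemma sub_generators_altdef:
  "sub_generators d r I i =
     {f_symb A L | A L. (A, L) \<in> std_pairs d i \<and> facet_free A L} \<union>
     {facet_symb s x J - facet_symb s (Min (I s)) J | s x J. s \<in> {1..r} \<and> x \<in> I s \<and> x \<noteq> Min (I s) \<and>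
        card J = i - 1 \<and> J \<inter> I s = {} \<and> standard (insert x J) (I s - {x})}"
  (is "?G = ?A \<union> ?B")
proof -
  have 1: "facet_free A L" if "\<forall>s\<in>{1..r}. \<forall>x\<in>I s. L \<noteq> I s - {x}" for A L
    using that by (simp add: facet_free_def)
  have 2: "facet_free A (I s - {x})" if "s \<in> {1..r}" "x \<in> I s" "x \<notin> A" for A s x
    unfolding facet_free_def using facet_unique that by metis
  have 3: "card (I s - {x}) = d - 1" if "s \<in> {1..r}" "x \<in> I s" for s x
    using card_I[OF that(1)] that(2) by simp
  have A: "{f_symb A L | A L. card A = i \<and> card L = d - 1 \<and> standard A L \<and>
        (\<forall>s\<in>{1..r}. \<forall>x\<in>I s. L \<noteq> I s - {x})} \<union>
     {f_symb A (I s - {x}) | A s x. s \<in> {1..r} \<and> x \<in> I s \<and> card A = i \<and>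
        standard A (I s - {x}) \<and> x \<notin> A} = ?A" (is "?L1 \<union> ?L2 = _")
  proof (intro equalityI subsetI)
    fix u assume "u \<in> ?L1 \<union> ?L2"
    then show "u \<in> ?A"
    proof
      assume "u \<in> ?L1"
      then show ?thesis using 1 unfolding std_pairs_def by blast
    next
      assume "u \<in> ?L2"
      then obtain A s x where "u = f_symb A (I s - {x})" "s \<in> {1..r}" "x \<in> I s" "card A = i"
        "standard A (I s - {x})" "x \<notin> A" by blast
      then show ?thesis using 2[of s x A] 3[of s x] unfolding std_pairs_def by blast
    qed
  next
    fix u assume "u \<in> ?A"
    then obtain A L where u: "u = f_symb A L" "card A = i" "card L = d - 1" "standard A L" "facet_free A L"
      unfolding std_pairs_def by blast
    show "u \<in> ?L1 \<union> ?L2"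
    proof (cases "\<forall>s\<in>{1..r}. \<forall>x\<in>I s. L \<noteq> I s - {x}")
      case True
      then show ?thesis using u by blast
    next
      case False
      then obtain s x where "s \<in> {1..r}" "x \<in> I s" "L = I s - {x}" by blast
      then show ?thesis using u unfolding facet_free_def by blast
    qed
  qed
  show ?thesis
    unfolding sub_generators_def A
    by (intro arg_cong2[of _ _ _ _ "(\<union>)"] refl Collect_cong)
      (simp only: sgn_in_insert_same facet_symb_def, metis standard_Min)
qed

text \<open>By \<open>facet_unique\<close>, adding an element to \<open>I s - {x}\<close> produces a
  member of the family only if the element is \<open>x\<close>.\<close>

lemma coord_facet_symb:
  assumes "s \<in> {1..r}" "t \<in> {1..r}" "x \<in> I s" "J \<inter> I s = {}"
  shows "coord (facet_symb s x J :: ('n, ('n, 'k::field) mpoly) hook) B (I t) = (if s = t \<and> B = J then 1 else 0)"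
proof -
  let ?A = "insert x J" and ?L = "I s - {x}"
  have x: "x \<notin> J" using assms by auto
  have "coord (f_symb ?A ?L) B (I t) = (\<Sum>b\<in>I t - B. sgn_in b B * basis_chain ?A ?L (insert b B) (I t - {b}) :: ('n, 'k) mpoly)"
    using assms by (subst coord_f_symb) (auto simp: exch_def)
  also have "\<dots> = (\<Sum>b\<in>I t - B. if b = x then (if s = t \<and> B = J then sgn_in x J else 0) else 0)"
  proof (rule sum.cong[OF refl])
    fix b assume b: "b \<in> I t - B"
    have "(insert b B = ?A \<and> I t - {b} = ?L) \<longleftrightarrow> (b = x \<and> s = t \<and> B = J)"
    proof
      assume *: "insert b B = ?A \<and> I t - {b} = ?L"
      then have bx: "s = t" "b = x" using facet_unique[OF assms(1,2,3), of b] b by auto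
      then have "insert x B = insert x J" "x \<notin> B" using * b by auto
      then show "b = x \<and> s = t \<and> B = J" using bx x by (simp add: insert_ident)
    qed simp
    then show "sgn_in b B * basis_chain ?A ?L (insert b B) (I t - {b}) =
      (if b = x then (if s = t \<and> B = J then sgn_in x J else 0) else 0 :: ('n, 'k) mpoly)"
      by (auto simp: basis_chain_def)
  qed
  also have "\<dots> = (if s = t \<and> B = J then sgn_in x J else 0)" using assms x by auto
  finally show ?thesis by (simp add: facet_symb_def coord_scale)
qed

text \<open>A description by linear conditions: stability under the differential and exactness are
  proved with it, freeness with the generators. \<open>sub_module_eq_vanishing_module\<close> shows
  that both give the same module.\<close>

definition vanishing_module :: "nat \<Rightarrow> ('n, ('n, 'k::field) mpoly) hook set" where
  "vanishing_module i = {u \<in> hook_module d i. \<forall>s\<in>{1..r}. \<forall>B. coord u B (I s) = 0}"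

lemma subspace_vanishing_module: "hook.subspace (vanishing_module i)"
  unfolding vanishing_module_def hook.subspace_def
  by (simp add: coord_add coord_scale hook.subspace_0[OF subspace_hook_module]
      hook.subspace_add[OF subspace_hook_module] hook.subspace_scale[OF subspace_hook_module])

lemma facet_symb_mem_hook_module:
  assumes "s \<in> {1..r}" "x \<in> I s" "card J = i - 1" "J \<inter> I s = {}" "1 \<le> i"
  shows "facet_symb s x J \<in> hook_module d i"
  using assms card_I[OF assms(1)] unfolding facet_symb_def
  by (intro hook.subspace_scale[OF subspace_hook_module] f_symb_mem_hook_module) (auto simp: card_insert_if)

text \<open>A nonzero coordinate of a facet-free symbol at \<open>I s\<close> would need
  \<open>L = I s - {b}\<close> with \<open>b \<in> A\<close>. In a difference of facet symbols the
  two ones at \<open>(J, I s)\<close> cancel.\<close>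

lemma sub_generators_subset_vanishing_module:
  assumes "1 \<le> i"
  shows "sub_generators d r I i \<subseteq> (vanishing_module i :: ('n, ('n, 'k::field) mpoly) hook set)"
proof
  fix u :: "('n, ('n, 'k) mpoly) hook"
  assume "u \<in> sub_generators d r I i"
  then show "u \<in> vanishing_module i"
    unfolding sub_generators_altdef
  proof (elim UnE CollectE exE conjE)
    fix A L assume u: "u = f_symb A L" "(A, L) \<in> std_pairs d i" "facet_free A L"
    have AL: "A \<inter> L = {}" "A \<noteq> {}" using u(2) assms by (auto simp: std_pairs_def standard_def)
    have "coord u B (I s) = 0" if "s \<in> {1..r}" for s B
    proof -
      have "sgn_in b B * basis_chain A L (insert b B) (I s - {b}) = (0 :: ('n, 'k) mpoly)" if "b \<in> I s - B" for b
        using u(3) that \<open>s \<in> {1..r}\<close> by (auto simp: facet_free_def basis_chain_def)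
      then show ?thesis unfolding u(1) coord_f_symb[OF AL] exch_def by (intro sum.neutral ballI)
    qed
    moreover have "u \<in> hook_module d i"
      using u AL assms by (auto simp: std_pairs_def intro!: f_symb_mem_hook_module)
    ultimately show ?thesis by (simp add: vanishing_module_def)
  next
    fix s x J
    assume u: "u = facet_symb s x J - facet_symb s (Min (I s)) J"
      and s: "s \<in> {1..r}" and x: "x \<in> I s" and J: "card J = i - 1" "J \<inter> I s = {}"
    have "coord u B (I t) = 0" if "t \<in> {1..r}" for t B
      using s that x J Min_I[OF s] by (simp add: u coord_diff coord_facet_symb)
    moreover have "u \<in> hook_module d i"
      unfolding u using s x J Min_I[OF s] assms
      by (intro hook.subspace_diff[OF subspace_hook_module] facet_symb_mem_hook_module)
    ultimately show ?thesis by (simp add: vanishing_module_def)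
  qed
qed

section \<open>Dual functionals and freeness of the submodule\<close>

lemma std_pairs_facet:
  assumes "s \<in> {1..r}" "x \<in> I s" "card J = i - 1" "J \<inter> I s = {}" "1 \<le> i" "standard (insert x J) (I s - {x})"
  shows "(insert x J, I s - {x}) \<in> std_pairs d i"
proof -
  have "x \<notin> J" using assms by auto
  then show ?thesis using assms card_I[OF assms(1)] by (simp add: std_pairs_def)
qed

text \<open>A generator is detected by the leading coordinate of its own standard symbol; for the
  third family this is the one with \<open>x \<noteq> Min (I s)\<close>, since the symbol with
  \<open>Min (I s)\<close> can be shared by several generators. The factor \<open>c\<close> corrects
  the sign.\<close>

lemma sub_generators_dual:
  assumes "1 \<le> i" "g \<in> sub_generators d r I i"
  shows "\<exists>c P. \<forall>h\<in>sub_generators d r I i. c * lead_coord P h = (if g = h then 1 else (0 :: ('n, 'k::field) mpoly))"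
proof -
  let ?G = "sub_generators d r I i :: ('n, ('n, 'k) mpoly) hook set"
  have f: "lead_coord P (f_symb A L) = (if P = (A, L) then 1 else (0 :: ('n, 'k) mpoly))"
    if "P \<in> std_pairs d i" "(A, L) \<in> std_pairs d i" for P A L
    using lead_coord_std_symb[OF that assms(1), where 'r="('n, 'k) mpoly"] by (simp add: std_symb_def)
  have s: "lead_coord P (facet_symb s x J) =
      (if P = (insert x J, I s - {x}) then sgn_in x J else (0 :: ('n, 'k) mpoly))"
    if "P \<in> std_pairs d i" "s \<in> {1..r}" "x \<in> I s" "card J = i - 1" "J \<inter> I s = {}"
      "standard (insert x J) (I s - {x})" for P s x J
    using f[OF that(1) std_pairs_facet[OF that(2-5) assms(1) that(6)]]
    by (simp add: facet_symb_def module_hom.scale[OF module_hom_lead_coord])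
  have diff: "lead_coord P (facet_symb s x J - facet_symb s (Min (I s)) J) =
      (if P = (insert x J, I s - {x}) then sgn_in x J else 0) -
      (if P = (insert (Min (I s)) J, I s - {Min (I s)}) then sgn_in (Min (I s)) J else (0 :: ('n, 'k) mpoly))"
    if "P \<in> std_pairs d i" "s \<in> {1..r}" "x \<in> I s" "card J = i - 1" "J \<inter> I s = {}"
      "standard (insert x J) (I s - {x})" for P s x J
    using that by (simp add: module_hom.diff[OF module_hom_lead_coord] s Min_I standard_Min)
  from assms(2)[unfolded sub_generators_altdef]
  have "\<exists>c P. c * lead_coord P g = (1 :: ('n, 'k) mpoly) \<and> (\<forall>h\<in>?G. h \<noteq> g \<longrightarrow> lead_coord P h = (0 :: ('n, 'k) mpoly))"
  proof (elim UnE CollectE exE conjE)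
    fix A L assume g: "g = f_symb A L" and AL: "(A, L) \<in> std_pairs d i" "facet_free A L"
    have nf: "(A, L) \<noteq> (insert x J, I s - {x})" if "s \<in> {1..r}" "x \<in> I s" for s x J
      using AL(2) that by (auto simp: facet_free_def)
    have "lead_coord (A, L) h = (0 :: ('n, 'k) mpoly)" if "h \<in> ?G" "h \<noteq> g" for h
      using that(1) unfolding sub_generators_altdef
    proof (elim UnE CollectE exE conjE)
      fix A' L' assume "h = f_symb A' L'" "(A', L') \<in> std_pairs d i"
      then show ?thesis using f[OF AL(1)] that(2) g by auto
    next
      fix s x J assume h: "h = facet_symb s x J - facet_symb s (Min (I s)) J" "s \<in> {1..r}" "x \<in> I s"
        "card J = i - 1" "J \<inter> I s = {}" "standard (insert x J) (I s - {x})"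
      show ?thesis
        unfolding h(1) diff[OF AL(1) h(2-6)] if_not_P[OF nf[OF h(2,3), of J]]
          if_not_P[OF nf[OF h(2) Min_I[OF h(2)], of J]] by simp
    qed
    then show ?thesis using f[OF AL(1) AL(1)] g
      by (intro exI[of _ 1] exI[of _ "(A, L)"]) auto
  next
    fix s x J assume g: "g = facet_symb s x J - facet_symb s (Min (I s)) J" and
      sx: "s \<in> {1..r}" "x \<in> I s" "card J = i - 1" "J \<inter> I s = {}" "standard (insert x J) (I s - {x})"
      and xm: "x \<noteq> Min (I s)"
    define P where "P = (insert x J, I s - {x})"
    have P: "P \<in> std_pairs d i" unfolding P_def by (intro std_pairs_facet sx assms)
    \<comment> \<open>The pair determines \<open>s\<close>, \<open>x\<close> and \<open>J\<close> by
      \<open>facet_unique\<close>, so it occurs in no other generator of this family and never as a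
      symbol with the minimum.\<close>
    have eq: "t = s \<and> y = x \<and> J' = J"
      if "P = (insert y J', I t - {y})" "t \<in> {1..r}" "y \<in> I t" "J' \<inter> I t = {}" for t y J'
    proof -
      have ty: "s = t" "x = y" using that(1) facet_unique[OF sx(1) that(2) sx(2) that(3)] by (simp_all add: P_def)
      then have "insert x J = insert x J'" "x \<notin> J" "x \<notin> J'" using that sx(2,4) by (auto simp: P_def)
      then show ?thesis using ty by (metis insert_ident)
    qed
    have "lead_coord P h = (0 :: ('n, 'k) mpoly)" if "h \<in> ?G" "h \<noteq> g" for h
      using that(1) unfolding sub_generators_altdef
    proof (elim UnE CollectE exE conjE)
      fix A' L' assume "h = f_symb A' L'" "(A', L') \<in> std_pairs d i" "facet_free A' L'"
      moreover from this have "P \<noteq> (A', L')" using sx by (auto simp: facet_free_def P_def)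
      ultimately show ?thesis using f[OF P] by auto
    next
      fix t y J' assume h: "h = facet_symb t y J' - facet_symb t (Min (I t)) J'" "t \<in> {1..r}" "y \<in> I t"
        "card J' = i - 1" "J' \<inter> I t = {}" "standard (insert y J') (I t - {y})"
      have "P \<noteq> (insert y J', I t - {y})" using eq[OF _ h(2,3,5)] that(2) h(1) g by auto
      moreover have "P \<noteq> (insert (Min (I t)) J', I t - {Min (I t)})"
        using eq[OF _ h(2) Min_I[OF h(2)] h(5)] xm by auto
      ultimately show ?thesis using diff[OF P h(2-6)] h(1) by simp
    qed
    moreover have "lead_coord P g = (sgn_in x J :: ('n, 'k) mpoly)"
    proof -
      have ne: "P \<noteq> (insert (Min (I s)) J, I s - {Min (I s)})"
        using eq[OF _ sx(1) Min_I[OF sx(1)] sx(4)] xm by auto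
      show ?thesis unfolding g diff[OF P sx] if_not_P[OF ne] by (simp add: P_def)
    qed
    ultimately show ?thesis
      by (intro exI[of _ "sgn_in x J"] exI[of _ P]) auto
  qed
  then show ?thesis by (metis mult_zero_right)
qed

lemma finite_sub_generators: "finite (sub_generators d r I i :: ('n, ('n, 'k::field) mpoly) hook set)"
proof -
  have "(sub_generators d r I i :: ('n, ('n, 'k) mpoly) hook set) \<subseteq>
    (\<lambda>(A, L). f_symb A L) ` UNIV \<union>
    (\<lambda>(s, x, J). facet_symb s x J - facet_symb s (Min (I s)) J) ` ({1..r} \<times> UNIV \<times> UNIV :: (nat \<times> 'n \<times> 'n set) set)"
    (is "_ \<subseteq> ?U")
  proof
    fix u :: "('n, ('n, 'k) mpoly) hook"
    assume "u \<in> sub_generators d r I i"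
    then show "u \<in> ?U"
      unfolding sub_generators_altdef
    proof (elim UnE CollectE exE conjE)
      fix A L assume "u = f_symb A L"
      then show ?thesis by (intro UnI1 image_eqI[of _ _ "(A, L)"]) simp_all
    next
      fix s x J assume "u = facet_symb s x J - facet_symb s (Min (I s)) J" "s \<in> {1..r}"
      then show ?thesis by (intro UnI2 image_eqI[of _ _ "(s, x, J)"]) simp_all
    qed
  qed
  then show ?thesis by (rule finite_subset) simp
qed

lemma sub_generators_dual_family:
  assumes "1 \<le> i"
  obtains c P where "\<And>g. module_hom hook_scale (*) (\<lambda>h. c g * lead_coord (P g) h :: ('n, 'k::field) mpoly)"
    and "\<And>g h. g \<in> sub_generators d r I i \<Longrightarrow> h \<in> sub_generators d r I i \<Longrightarrow>
      c g * lead_coord (P g) h = (if g = h then 1 else (0 :: ('n, 'k) mpoly))"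
proof -
  have "\<forall>g\<in>sub_generators d r I i. \<exists>p. \<forall>h\<in>sub_generators d r I i.
      fst p * lead_coord (snd p) h = (if g = h then 1 else (0 :: ('n, 'k) mpoly))"
  proof
    fix g :: "('n, ('n, 'k) mpoly) hook"
    assume "g \<in> sub_generators d r I i"
    from sub_generators_dual[OF assms this] obtain c P where
      "\<forall>h\<in>sub_generators d r I i. c * lead_coord P h = (if g = h then 1 else (0 :: ('n, 'k) mpoly))" by blast
    then show "\<exists>p. \<forall>h\<in>sub_generators d r I i.
        fst p * lead_coord (snd p) h = (if g = h then 1 else (0 :: ('n, 'k) mpoly))"
      by (intro exI[of _ "(c, P)"]) (simp only: fst_conv snd_conv)
  qed
  then obtain p where p: "\<forall>g\<in>sub_generators d r I i. \<forall>h\<in>sub_generators d r I i.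
      fst (p g) * lead_coord (snd (p g)) h = (if g = h then 1 else (0 :: ('n, 'k) mpoly))"
    by metis
  have "module_hom hook_scale (*) (\<lambda>h. fst (p g) * lead_coord (snd (p g)) h :: ('n, 'k) mpoly)" for g
  proof -
    interpret module_pair hook_scale "(*) :: ('n, 'k) mpoly \<Rightarrow> _"
      by (intro module_pair.intro hook.module_axioms module_mult)
    show ?thesis by (rule module_hom_scale[OF module_hom_lead_coord])
  qed
  with p show ?thesis using that[of "\<lambda>g. fst (p g)" "\<lambda>g. snd (p g)"] by blast
qed

lemma independent_sub_generators:
  assumes "1 \<le> i"
  shows "hook.independent (sub_generators d r I i :: ('n, ('n, 'k::field) mpoly) hook set)"
proof -
  obtain c P where *: "\<And>g. module_hom hook_scale (*) (\<lambda>h. c g * lead_coord (P g) h :: ('n, 'k) mpoly)"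
    "\<And>g h. g \<in> sub_generators d r I i \<Longrightarrow> h \<in> sub_generators d r I i \<Longrightarrow>
      c g * lead_coord (P g) h = (if g = h then 1 else (0 :: ('n, 'k) mpoly))"
    using sub_generators_dual_family[OF assms, where 'k='k] by blast
  \<comment> \<open>The generators are indexed by themselves to fit the form of
    \<open>dual_independent\<close>.\<close>
  have "hook.independent ((\<lambda>g. g) ` (sub_generators d r I i :: ('n, ('n, 'k) mpoly) hook set))"
    by (rule dual_independent[where \<phi> = "\<lambda>g h. c g * lead_coord (P g) h"]) (use * in auto)
  then show ?thesis by simp
qed

section \<open>Reference symbols and the equality with the vanishing module\<close>

definition facet_index :: "nat \<Rightarrow> (nat \<times> 'n set) set" where
  "facet_index p = {(s, J). s \<in> {1..r} \<and> J \<inter> I s = {} \<and> card J = p}"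

text \<open>The reference symbols, subtracted in the third family; their coordinates at the
  \<open>I s\<close> form an identity matrix.\<close>

definition min_facet_symb :: "nat \<times> 'n set \<Rightarrow> ('n, ('n, 'k::field) mpoly) hook" where
  "min_facet_symb = (\<lambda>(s, J). facet_symb s (Min (I s)) J)"

lemma finite_facet_index: "finite (facet_index p)"
  by (rule finite_subset[of _ "{1..r} \<times> UNIV"]) (auto simp: facet_index_def)

lemma coord_min_facet_symb:
  assumes "P \<in> facet_index p" "t \<in> {1..r}"
  shows "coord (min_facet_symb P :: ('n, ('n, 'k::field) mpoly) hook) B (I t) = (if P = (t, B) then 1 else 0)"
  using assms by (cases P) (auto simp: min_facet_symb_def facet_index_def coord_facet_symb Min_I)

text \<open>A standard symbol that is not facet-free is, up to sign, a facet symbol, and this either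
  is a reference symbol or differs from one by a generator.\<close>

lemma std_symb_mem_span:
  assumes "1 \<le> i" "(A, L) \<in> std_pairs d i"
  shows "(std_symb (A, L) :: ('n, ('n, 'k::field) mpoly) hook) \<in>
    hook.span (sub_generators d r I i \<union> min_facet_symb ` facet_index (i - 1))" (is "_ \<in> hook.span ?S")
proof (cases "facet_free A L")
  case True
  then show ?thesis using assms(2) unfolding sub_generators_altdef std_symb_def
    by (intro hook.span_base) auto
next
  case False
  then obtain s x where s: "s \<in> {1..r}" "x \<in> I s" "L = I s - {x}" "x \<in> A"
    by (auto simp: facet_free_def)
  define J where "J = A - {x}"
  have A: "A = insert x J" "x \<notin> J" using s by (auto simp: J_def)
  have st: "standard A L" "card A = i" using assms by (auto simp: std_pairs_def)
  have J: "J \<inter> I s = {}" "card J = i - 1" using st s A by (auto simp: standard_def)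
  let ?e = "min_facet_symb (s, J) :: ('n, ('n, 'k) mpoly) hook"
  have e: "?e \<in> hook.span ?S"
    using s J by (intro hook.span_base) (auto simp: facet_index_def)
  have "(facet_symb s x J :: ('n, ('n, 'k) mpoly) hook) \<in> hook.span ?S"
  proof (cases "x = Min (I s)")
    case True
    then show ?thesis using e by (simp add: min_facet_symb_def)
  next
    case False
    have "facet_symb s x J - ?e \<in> ?S"
      unfolding sub_generators_altdef min_facet_symb_def using s J st A False by auto
    from hook.span_add[OF hook.span_base[OF this] e] show ?thesis by simp
  qed
  then have "hook_scale (sgn_in x J) (facet_symb s x J :: ('n, ('n, 'k) mpoly) hook) \<in> hook.span ?S"
    by (rule hook.span_scale)
  then show ?thesis using s A by (simp add: facet_symb_def std_symb_def)
qed

text \<open>Split \<open>u\<close> into a part \<open>g\<close> in the submodule and a combination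
  \<open>v\<close> of reference symbols. The coordinates of \<open>u\<close> and \<open>g\<close> at
  the \<open>I s\<close> vanish, hence so do those of \<open>v\<close>; but these are the
  coefficients of \<open>v\<close>, so \<open>v = 0\<close>.\<close>

lemma sub_module_eq_vanishing_module:
  assumes "1 \<le> i"
  shows "sub_module d r I i = (vanishing_module i :: ('n, ('n, 'k::field) mpoly) hook set)"
proof
  show "sub_module d r I i \<subseteq> (vanishing_module i :: ('n, ('n, 'k) mpoly) hook set)"
    unfolding sub_module_def
    by (intro hook.span_minimal sub_generators_subset_vanishing_module subspace_vanishing_module assms)
  show "(vanishing_module i :: ('n, ('n, 'k) mpoly) hook set) \<subseteq> sub_module d r I i"
  proof
    fix u :: "('n, ('n, 'k) mpoly) hook"
    assume u: "u \<in> vanishing_module i"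
    let ?E = "min_facet_symb ` facet_index (i - 1) :: ('n, ('n, 'k) mpoly) hook set"
    have "u \<in> hook.span (std_symb ` std_pairs d i)"
      using u hook_module_eq_span_std[OF assms] by (auto simp: vanishing_module_def)
    moreover have "hook.span (std_symb ` std_pairs d i) \<subseteq> hook.span (sub_generators d r I i \<union> ?E)"
      using std_symb_mem_span[OF assms] by (intro hook.span_minimal hook.subspace_span) auto
    ultimately obtain g v where gv: "u = g + v" "g \<in> sub_module d r I i" "v \<in> hook.span ?E"
      unfolding hook.span_Un sub_module_def by blast
    have "coord g B (I s) = 0" if "s \<in> {1..r}" for s B
      using gv(2) \<open>sub_module d r I i \<subseteq> vanishing_module i\<close> that by (auto simp: vanishing_module_def)
    then have v0: "coord v B (I s) = 0" if "s \<in> {1..r}" for s B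
      using u that by (auto simp: gv(1) coord_add vanishing_module_def)
    have "v = (\<Sum>P\<in>facet_index (i - 1). hook_scale (coord v (snd P) (I (fst P))) (min_facet_symb P))"
    proof (rule dual_expansion[where \<phi> = "\<lambda>P u. coord u (snd P) (I (fst P))"])
      fix P Q assume P: "P \<in> facet_index (i - 1)" and Q: "Q \<in> facet_index (i - 1)"
      have "fst P \<in> {1..r}" using P by (auto simp: facet_index_def)
      from coord_min_facet_symb[OF Q this, of "snd P", where 'k='k]
      show "coord (min_facet_symb Q) (snd P) (I (fst P)) = (if P = Q then 1 else (0 :: ('n, 'k) mpoly))"
        by (auto simp: prod_eq_iff)
    qed (use gv(3) in \<open>simp_all add: finite_facet_index module_hom_coord\<close>)
    also have "\<dots> = 0"
      by (intro sum.neutral ballI) (auto simp: facet_index_def v0)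
    finally show "u \<in> sub_module d r I i" using gv by simp
  qed
qed

text \<open>The reference symbols interpolate: they prescribe all coordinates at the
  \<open>I s\<close> simultaneously, while the other coordinates remain uncontrolled.\<close>

lemma facet_coord_surj:
  fixes v :: "('n, ('n, 'k::field) mpoly) chain_fun"
  assumes v: "chain p d v"
  shows "\<exists>y\<in>hook_module d (Suc p). \<forall>s\<in>{1..r}. \<forall>B. coord y B (I s) = v B (I s)"
proof
  let ?y = "\<Sum>P\<in>facet_index p. hook_scale (v (snd P) (I (fst P))) (min_facet_symb P)"
  show "?y \<in> hook_module d (Suc p)"
    by (intro hook.subspace_sum[OF subspace_hook_module] hook.subspace_scale[OF subspace_hook_module])
      (auto simp: min_facet_symb_def facet_index_def intro!: facet_symb_mem_hook_module Min_I)
  show "\<forall>s\<in>{1..r}. \<forall>B. coord ?y B (I s) = v B (I s)"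
  proof (intro ballI allI)
    fix s B assume s: "s \<in> {1..r}"
    have "coord ?y B (I s) = (\<Sum>P\<in>facet_index p. if P = (s, B) then v B (I s) else 0)"
      unfolding coord_sum coord_scale using s
      by (intro sum.cong refl) (simp add: coord_min_facet_symb)
    also have "\<dots> = (if (s, B) \<in> facet_index p then v B (I s) else 0)"
      using finite_facet_index by simp
    also have "\<dots> = v B (I s)"
      using chainD[OF v, of B "I s"] s by (auto simp: facet_index_def)
    finally show "coord ?y B (I s) = v B (I s)" .
  qed
qed

text \<open>The Koszul differential never changes \<open>M\<close>, so the coordinates at the
  \<open>I s\<close> can be treated on their own.\<close>

lemma koszul_eq_at:
  "(\<And>B. w B M = v B M) \<Longrightarrow> koszul w B M = koszul v B M"
  by (simp add: koszul_def)

section \<open>Stability under the differential and exactness\<close>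

lemma hook_diff_vanishing_module:
  assumes "u \<in> vanishing_module (Suc i)" "1 \<le> i"
  shows "hook_diff u \<in> (vanishing_module i :: ('n, ('n, 'k::field) mpoly) hook set)"
proof -
  have u: "u \<in> hook_module d (Suc i)" using assms by (simp add: vanishing_module_def)
  have "koszul (coord u) B (I s) = 0" if "s \<in> {1..r}" for s B
    using assms(1) that by (simp add: koszul_def vanishing_module_def)
  then show ?thesis
    using hook_diff_mem_hook_module[OF u assms(2)] coord_hook_diff[OF u] assms(2)
    by (simp add: vanishing_module_def)
qed

lemma hook_diff_exact:
  fixes u :: "('n, ('n, 'k::field) mpoly) hook"
  assumes u: "u \<in> vanishing_module (Suc p)"
    and cyc: "if p = 0 then hook_aug u = 0 else hook_diff u = 0"
  shows "u \<in> hook_diff ` vanishing_module (Suc (Suc p))"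
proof -
  define z where "z = coord u"
  have u0: "z B (I s) = 0" if "s \<in> {1..r}" for s B
    using u that by (auto simp: vanishing_module_def z_def)
  have uM: "u \<in> hook_module d (Suc p)" using u by (simp add: vanishing_module_def)
  have z: "chain p d z" "exch z = (\<lambda>B M. 0)"
    unfolding z_def using chain_coord[OF d_pos uM] by auto
  have kz: "koszul z = (\<lambda>B M. 0)"
  proof (cases p)
    case 0
    then show ?thesis using koszul_chain_0 z by simp
  next
    case (Suc q)
    have "(-1) ^ Suc p * koszul z B M = 0" for B M
      using coord_hook_diff[OF uM, of B M] cyc Suc by (simp add: z_def)
    moreover have "koszul z B M = (-1) ^ Suc p * ((-1) ^ Suc p * koszul z B M)" for B M
      by (simp flip: mult.assoc power_mult_distrib)
    ultimately show ?thesis by (metis (no_types, lifting) ext mult_zero_right)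
  qed
  have az: "aug_chain z = 0" if "p = 0"
    using that hook_aug_eq_aug_chain[of u d] uM cyc by (simp add: z_def)
  obtain w where w: "chain (Suc p) d w" "exch w = (\<lambda>B M. 0)" "koszul w = z"
    using exch_kernel_exact[OF z kz az] by blast
  obtain y0 where y0: "y0 \<in> hook_module d (Suc (Suc p))" "coord y0 = w"
    using coord_surj[OF d_pos w(1,2)] by blast
  \<comment> \<open>This is the obstruction to \<open>y0\<close> lying in the submodule. It is a
    Koszul cycle, because the boundary \<open>z\<close> of \<open>w\<close> vanishes at every
    \<open>I s\<close>.\<close>
  define w' where "w' B M = (if M \<in> I ` {1..r} then w B M else 0)" for B M
  have "koszul w' = (\<lambda>B M. 0)"
  proof (intro ext)
    fix B M
    show "koszul w' B M = 0"
    proof (cases "M \<in> I ` {1..r}")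
      case True
      then have "koszul w' B M = koszul w B M" by (intro koszul_eq_at) (simp add: w'_def)
      then show ?thesis using True u0 w(3) by auto
    next
      case False
      then show ?thesis by (simp add: koszul_def w'_def)
    qed
  qed
  moreover have "chain (Suc p) d w'" using w(1) by (auto simp: chain_def w'_def)
  \<comment> \<open>The size \<open>Suc p\<close> is positive, so the premise of
    \<open>koszul_exact\<close> about size 0 holds vacuously.\<close>
  ultimately obtain v where v: "chain (Suc (Suc p)) d v" "koszul v = w'"
    using koszul_exact[of "Suc p" d w'] by auto
  obtain y1 where y1: "y1 \<in> hook_module d (Suc (Suc (Suc p)))"
    "\<And>s B. s \<in> {1..r} \<Longrightarrow> coord y1 B (I s) = v B (I s)"
    using facet_coord_surj[OF v(1)] by blast
  \<comment> \<open>By \<open>coord_hook_diff\<close>, the differential carries the sign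
    \<open>e\<close> on \<open>y0\<close> and \<open>- e\<close> on \<open>y1\<close>; the two
    factors \<open>e\<close> in \<open>y\<close> compensate for this.\<close>
  define e :: "('n, 'k) mpoly" where "e = (-1) ^ p"
  have e: "e * e = 1" by (simp add: e_def flip: power_mult_distrib)
  define y where "y = hook_scale e (y0 + hook_scale e (hook_diff y1))"
  have d1: "coord (hook_diff y1) B M = - e * koszul (coord y1) B M" for B M
    using coord_hook_diff[OF y1(1), of B M] by (simp add: e_def)
  have cy: "coord y B M = e * (w B M + (-1) * koszul (coord y1) B M)" for B M
    using e by (simp add: y_def coord_scale coord_add y0(2) d1 flip: mult.assoc)
  have yM: "y \<in> hook_module d (Suc (Suc p))"
    unfolding y_def using y0(1) hook_diff_mem_hook_module[OF y1(1)]
    by (intro hook.subspace_scale hook.subspace_add subspace_hook_module) auto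
  have "coord y B (I s) = 0" if s: "s \<in> {1..r}" for s B
  proof -
    have "koszul (coord y1) B (I s) = koszul v B (I s)" using y1(2) s by (intro koszul_eq_at) simp
    also have "\<dots> = w B (I s)" using s by (simp add: v w'_def)
    finally show ?thesis by (simp add: cy)
  qed
  then have yV: "y \<in> vanishing_module (Suc (Suc p))" using yM by (simp add: vanishing_module_def)
  have "coord (hook_diff y) B M = z B M" for B M
  proof -
    have "coord y = (\<lambda>B M. e * (w B M + (-1) * koszul (coord y1) B M))" by (intro ext cy)
    then have "koszul (coord y) B M = e * (koszul w B M + (-1) * koszul (koszul (coord y1)) B M)"
      by (simp only: koszul_scale koszul_add)
    then have "koszul (coord y) B M = e * z B M" by (simp add: koszul_koszul w)
    then show ?thesis using coord_hook_diff[OF yM, of B M] e by (simp add: e_def flip: mult.assoc)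
  qed
  then have "coord (hook_diff y - u) B M = 0" for B M by (simp add: coord_diff z_def)
  moreover have "hook_diff y - u \<in> hook_module d (Suc p)"
    using hook_diff_mem_hook_module[OF yM] uM by (intro hook.subspace_diff[OF subspace_hook_module]) auto
  ultimately have "hook_diff y - u = 0" by (intro eq_0_of_coord_eq_0[of _ d "Suc p"]) auto
  then have "u = hook_diff y" by simp
  with yV show ?thesis by blast
qed

lemma hook_diff_hook_diff:
  fixes u :: "('n, ('n, 'k::field) mpoly) hook"
  assumes u: "u \<in> hook_module d (Suc (Suc i))" and i: "1 \<le> i"
  shows "hook_diff (hook_diff u) = 0"
proof (rule eq_0_of_coord_eq_0)
  have du: "hook_diff u \<in> hook_module d (Suc i)" using u by (rule hook_diff_mem_hook_module) simp
  show "hook_diff (hook_diff u) \<in> hook_module d i" using du i by (rule hook_diff_mem_hook_module)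
  fix B M
  have "coord (hook_diff u) = (\<lambda>B M. (-1) ^ Suc (Suc i) * koszul (coord u) B M)"
    by (intro ext coord_hook_diff[OF u]) simp
  then have "koszul (coord (hook_diff u)) B M = (-1) ^ Suc (Suc i) * koszul (koszul (coord u)) B M"
    by (simp only: koszul_scale)
  then show "coord (hook_diff (hook_diff u)) B M = 0"
    using coord_hook_diff[OF du, of B M] i by (simp add: koszul_koszul)
qed (rule i)

text \<open>\<open>coord u\<close> lies in the kernel of \<open>exch\<close>, so
  \<open>aug_chain_koszul\<close> turns the augmentation of its Koszul boundary into that of
  0.\<close>

lemma hook_aug_hook_diff:
  fixes u :: "('n, ('n, 'k::field) mpoly) hook"
  assumes u: "u \<in> hook_module d 2"
  shows "hook_aug (hook_diff u) = 0"
proof -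
  have du: "hook_diff u \<in> hook_module d 1" using u by (intro hook_diff_mem_hook_module) (simp_all add: numeral_2_eq_2)
  have "coord (hook_diff u) = koszul (coord u)"
    by (intro ext) (simp add: coord_hook_diff[OF u])
  then show ?thesis
    using chain_coord(2)[OF d_pos, of u 1] u
    by (simp add: hook_aug_eq_aug_chain[OF du] aug_chain_koszul numeral_2_eq_2) (simp add: aug_chain_def)
qed

text \<open>For \<open>i = 1\<close> the set \<open>J\<close> is empty, and a single
  \<open>x\<close> above \<open>Min (I s)\<close> gives no standard symbol, so only facet-free
  symbols are left. Splitting off the minimum of \<open>W\<close> gives the standard symbol over
  \<open>W\<close>, and facet-free means that \<open>W\<close> is not in the family.\<close>

lemma hook_aug_sub_module:
  "hook_aug ` sub_module d r I 1 = (complement_ideal d r I :: ('n, 'k::field) mpoly set)"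
proof -
  interpret module_hom hook_scale "(*)" "hook_aug :: ('n, ('n, 'k) mpoly) hook \<Rightarrow> _"
    by (rule module_hom_hook_aug)
  have f: "hook_aug (f_symb {a} L) = (sqfree_mon (insert a L) :: ('n, 'k) mpoly)" if "a \<notin> L" for a L
    using that by (simp add: f_symb_def hook_aug_symb aug_symb_def sqfree_mon_insert)
  have G: "sub_generators d r I 1 = {f_symb A L | A L. (A, L) \<in> std_pairs d 1 \<and> facet_free A L}"
  proof -
    have "\<not> standard (insert x {}) (I s - {x})" if "s \<in> {1..r}" "x \<in> I s" "x \<noteq> Min (I s)" for s x
    proof -
      have "Min (I s) \<in> I s - {x}" using that Min_I by auto
      moreover from this have "Min (I s - {x}) \<le> Min (I s)" by (intro Min_le) auto
      moreover have "Min (I s) \<le> x" using that by simp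
      ultimately have "Min (I s - {x}) \<le> x" "I s - {x} \<noteq> {}" by (metis order_trans, blast)
      then show ?thesis unfolding standard_def by (metis Min_singleton not_less)
    qed
    then show ?thesis unfolding sub_generators_altdef by (auto simp: card_eq_0_iff)
  qed
  have "hook_aug ` sub_generators d r I 1 = {sqfree_mon A :: ('n, 'k) mpoly | A. card A = d \<and> A \<notin> I ` {1..r}}"
  proof (intro equalityI subsetI)
    fix p :: "('n, 'k) mpoly"
    assume "p \<in> hook_aug ` sub_generators d r I 1"
    then obtain A L where AL: "p = hook_aug (f_symb A L)" "(A, L) \<in> std_pairs d 1" "facet_free A L"
      unfolding G by blast
    then obtain a where a: "A = {a}" "card L = d - 1" "standard {a} L"
      by (auto simp: std_pairs_def card_1_singleton_iff)
    then have aL: "a \<notin> L" by (simp add: standard_def)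
    have "insert a L \<noteq> I s" if "s \<in> {1..r}" for s
    proof
      assume s: "insert a L = I s"
      then have "a \<in> I s" "L = I s - {a}" using aL by auto
      then show False using AL(3) that a by (auto simp: facet_free_def)
    qed
    then have "insert a L \<notin> I ` {1..r}" by blast
    moreover have "card (insert a L) = d" using aL a d_pos by simp
    ultimately show "p \<in> {sqfree_mon A | A. card A = d \<and> A \<notin> I ` {1..r}}"
      using AL(1) f[OF aL] a(1) by (intro CollectI exI[of _ "insert a L"]) auto
  next
    fix p :: "('n, 'k) mpoly"
    assume "p \<in> {sqfree_mon A | A. card A = d \<and> A \<notin> I ` {1..r}}"
    then obtain W where W: "p = sqfree_mon W" "card W = d" "W \<notin> I ` {1..r}" by blast
    define a where "a = Min W"
    define L where "L = W - {a}"
    have "W \<noteq> {}" using W d_pos by auto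
    then have "a \<in> W" unfolding a_def by (intro Min_in) auto
    then have aW: "a \<in> W" "a \<notin> L" "W = insert a L" by (auto simp: L_def)
    have "a < y" if "y \<in> L" for y using that by (auto simp: L_def a_def order.strict_iff_order)
    then have "standard {a} L" using aW by (cases "L = {}") (auto simp: standard_def)
    moreover have "card L = d - 1" using W(2) aW(1) by (simp add: L_def)
    ultimately have "({a}, L) \<in> std_pairs d 1" by (simp add: std_pairs_def)
    moreover have "facet_free {a} L"
      unfolding facet_free_def
    proof (intro ballI impI)
      fix s x assume "s \<in> {1..r}" "x \<in> I s" "L = I s - {x}"
      then have "x = a \<Longrightarrow> W = I s" using aW(3) by auto
      then show "x \<notin> {a}" using W(3) \<open>s \<in> {1..r}\<close> by blast
    qed
    ultimately have "f_symb {a} L \<in> sub_generators d r I 1" unfolding G by blast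
    moreover have "p = hook_aug (f_symb {a} L)" using f[OF aW(2)] aW(3) W(1) by simp
    ultimately show "p \<in> hook_aug ` sub_generators d r I 1" by blast
  qed
  then show ?thesis
    unfolding sub_module_def complement_ideal_def ideal_generated_def span_image[symmetric] by simp
qed

section \<open>Minimality, degrees and length\<close>

lemma subspace_irrelevant_ideal: "module.subspace (*) (irrelevant_ideal :: ('n, 'k::field) mpoly set)"
  unfolding irrelevant_ideal_def ideal_generated_def by (rule module.subspace_span[OF module_mult])

lemma X_mult_mem_irrelevant_ideal: "c * X b \<in> (irrelevant_ideal :: ('n, 'k::field) mpoly set)"
  unfolding irrelevant_ideal_def ideal_generated_def
  by (intro module.span_scale[OF module_mult] module.span_base[OF module_mult]) simp

lemma complement_ideal_subset: "complement_ideal d r I \<subseteq> (irrelevant_ideal :: ('n, 'k::field) mpoly set)"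
  unfolding complement_ideal_def ideal_generated_def
proof (intro module.span_minimal[OF module_mult] subspace_irrelevant_ideal, clarify)
  fix A :: "'n set" assume "d = card A"
  then obtain a where a: "a \<in> A" using d_pos by fastforce
  have "sqfree_mon A = (sqfree_mon (A - {a}) * X a :: ('n, 'k) mpoly)"
    using sqfree_mon_insert[of a "A - {a}", where 'k='k] a by (simp add: insert_absorb mult.commute)
  then show "sqfree_mon A \<in> (irrelevant_ideal :: ('n, 'k) mpoly set)"
    by (simp add: X_mult_mem_irrelevant_ideal)
qed

lemma koszul_mem_irrelevant_ideal: "koszul w B M \<in> (irrelevant_ideal :: ('n, 'k::field) mpoly set)"
  unfolding koszul_def
proof (rule module.subspace_sum[OF module_mult subspace_irrelevant_ideal])
  fix b
  have "sgn_in b B * X b * w (insert b B) M = (sgn_in b B * w (insert b B) M) * X b"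
    by (simp only: ac_simps)
  then show "sgn_in b B * X b * w (insert b B) M \<in> irrelevant_ideal"
    by (simp only: X_mult_mem_irrelevant_ideal)
qed

text \<open>The coefficients must be taken in the generators of the submodule. Their dual
  functionals are multiples of coordinates, and the coordinates of \<open>hook_diff u\<close> are,
  up to sign, values of the Koszul differential, which lie in the irrelevant ideal.\<close>

lemma hook_diff_minimal:
  fixes u :: "('n, ('n, 'k::field) mpoly) hook"
  assumes u: "u \<in> sub_module d r I (Suc i)" and i: "1 \<le> i"
  shows "hook_diff u \<in> hook.span {hook_scale c v | c v. c \<in> irrelevant_ideal \<and> v \<in> sub_module d r I i}"
proof -
  obtain c P where *: "\<And>g. module_hom hook_scale (*) (\<lambda>h. c g * lead_coord (P g) h :: ('n, 'k) mpoly)"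
    "\<And>g h. g \<in> sub_generators d r I i \<Longrightarrow> h \<in> sub_generators d r I i \<Longrightarrow>
      c g * lead_coord (P g) h = (if g = h then 1 else (0 :: ('n, 'k) mpoly))"
    using sub_generators_dual_family[OF i, where 'k='k] by blast
  let ?G = "sub_generators d r I i :: ('n, ('n, 'k) mpoly) hook set"
  have uV: "u \<in> vanishing_module (Suc i)" using u by (simp add: sub_module_eq_vanishing_module)
  have uM: "u \<in> hook_module d (Suc i)" using uV by (simp add: vanishing_module_def)
  have "hook_diff u \<in> hook.span ((\<lambda>g. g) ` ?G)"
    using hook_diff_vanishing_module[OF uV i] sub_module_eq_vanishing_module[OF i, where 'k='k]
    by (simp add: sub_module_def)
  then have "hook_diff u = (\<Sum>g\<in>?G. hook_scale (c g * lead_coord (P g) (hook_diff u)) g)"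
    by (intro dual_expansion[where \<phi> = "\<lambda>g h. c g * lead_coord (P g) h"] finite_sub_generators * )
  moreover have "c g * lead_coord (P g) (hook_diff u) \<in> irrelevant_ideal" for g
  proof -
    obtain A L where P: "P g = (A, L)" by force
    have "lead_coord (P g) (hook_diff u) = (-1) ^ Suc i * koszul (coord u) (A - {Min A}) (insert (Min A) L)"
      unfolding P lead_coord_def prod.case using i by (intro coord_hook_diff[OF uM]) simp
    then show ?thesis
      by (metis koszul_mem_irrelevant_ideal module.subspace_scale[OF module_mult subspace_irrelevant_ideal])
  qed
  moreover have "g \<in> sub_module d r I i" if "g \<in> ?G" for g
    using that unfolding sub_module_def by (rule hook.span_base)
  ultimately show ?thesis
    by (smt (verit, ccfv_SIG) hook.span_base hook.span_sum mem_Collect_eq)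
qed

lemma f_symb_homogeneous:
  "f_symb A L \<in> (hook_homogeneous (card A + card L) :: ('n, ('n, 'k::field) mpoly) hook set)"
  using hook_homogeneous_symb[of "sorted_list_of_set A" L] by (simp add: f_symb_def)

lemma sub_generators_homogeneous:
  assumes i: "1 \<le> i"
  shows "sub_generators d r I i \<subseteq> (hook_homogeneous (i + (d - 1)) :: ('n, ('n, 'k::field) mpoly) hook set)"
proof
  fix u :: "('n, ('n, 'k) mpoly) hook"
  have s: "(facet_symb s x J :: ('n, ('n, 'k) mpoly) hook) \<in> hook_homogeneous (i + (d - 1))"
    if "s \<in> {1..r}" "x \<in> I s" "card J = i - 1" "J \<inter> I s = {}" for s x J
  proof -
    have "x \<notin> J" using that by auto
    then have "card (insert x J) = i" "card (I s - {x}) = d - 1" using that card_I[OF that(1)] i by auto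
    then have "(f_symb (insert x J) (I s - {x}) :: ('n, ('n, 'k) mpoly) hook) \<in> hook_homogeneous (i + (d - 1))"
      using f_symb_homogeneous[of "insert x J" "I s - {x}", where 'k='k] by simp
    then show ?thesis unfolding facet_symb_def sgn_in_def
      by (cases "even (card {b \<in> J. b < x})") (simp_all add: hook_homogeneous_neg)
  qed
  assume "u \<in> sub_generators d r I i"
  then show "u \<in> hook_homogeneous (i + (d - 1))"
    unfolding sub_generators_altdef
  proof (elim UnE CollectE exE conjE)
    fix A L assume "u = f_symb A L" "(A, L) \<in> std_pairs d i"
    then show ?thesis using f_symb_homogeneous[of A L, where 'k='k] by (simp add: std_pairs_def)
  next
    fix t x J assume u: "u = facet_symb t x J - facet_symb t (Min (I t)) J" and
      t: "t \<in> {1..r}" "x \<in> I t" "card J = i - 1" "J \<inter> I t = {}"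
    have "- facet_symb t (Min (I t)) J \<in> (hook_homogeneous (i + (d - 1)) :: ('n, ('n, 'k) mpoly) hook set)"
      by (intro hook_homogeneous_neg s Min_I t)
    from hook_homogeneous_add[OF s[OF t] this] show ?thesis by (simp add: u)
  qed
qed

text \<open>A nonzero coordinate requires disjoint sets of sizes \<open>i - 1\<close> and
  \<open>d\<close>; beyond the bound there is no room for them.\<close>

lemma sub_module_eq_0:
  assumes "CARD('n) - d + 1 < i"
  shows "sub_module d r I i = ({0} :: ('n, ('n, 'k::field) mpoly) hook set)"
proof -
  obtain p where p: "i = Suc p" using assms by (cases i) auto
  have "u = 0" if u: "u \<in> hook_module d i" for u :: "('n, ('n, 'k) mpoly) hook"
  proof (rule eq_0_of_coord_eq_0[OF u])
    fix B M
    show "coord u B M = 0"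
    proof (rule ccontr)
      assume "coord u B M \<noteq> 0"
      from chainD[OF chain_coord(1)[OF d_pos, of u p] this] u p
      have "B \<inter> M = {}" "card B = p" "card M = d" by auto
      then have "card (B \<union> M) = p + d" by (simp add: card_Un_disjoint)
      moreover have "card (B \<union> M) \<le> CARD('n)" by (intro card_mono) auto
      ultimately show False using assms p by simp
    qed
  qed (use p in simp)
  moreover have "0 \<in> (sub_module d r I i :: ('n, ('n, 'k) mpoly) hook set)"
    by (simp add: sub_module_def hook.span_zero)
  ultimately show ?thesis
    using sub_module_eq_vanishing_module[of i, where 'k='k] p by (auto simp: vanishing_module_def)
qed

lemma minimal_free_resolution_sub_module:
  "minimal_free_resolution hook_scale hook_homogeneous
      (complement_ideal d r I :: ('n, 'k::field) mpoly set) (CARD('n) - d + 1)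
      (sub_module d r I) (\<lambda>i. hook_diff) hook_aug"
  unfolding minimal_free_resolution_def
proof (intro conjI allI impI)
  let ?F = "sub_module d r I :: nat \<Rightarrow> ('n, ('n, 'k) mpoly) hook set"
  have F: "?F i = vanishing_module i" if "1 \<le> i" for i
    using that by (rule sub_module_eq_vanishing_module)
  have FM: "u \<in> hook_module d i" if "u \<in> ?F i" "1 \<le> i" for u i
    using that F by (auto simp: vanishing_module_def)
  show "module (hook_scale :: ('n, 'k) mpoly \<Rightarrow> ('n, ('n, 'k) mpoly) hook \<Rightarrow> _)" by (rule hook.module_axioms)
  show "grading hook_scale (hook_homogeneous :: nat \<Rightarrow> ('n, ('n, 'k) mpoly) hook set)" by (rule grading_hook)
  show "graded_free hook_scale hook_homogeneous (?F i)" if "1 \<le> i" for i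
    unfolding graded_free_def sub_module_def
    using sub_generators_homogeneous[OF that] independent_sub_generators[OF that] by blast
  show "?F i = {0}" if "CARD('n) - d + 1 < i" for i using that by (rule sub_module_eq_0)
  show "module_hom hook_scale hook_scale (hook_diff :: ('n, ('n, 'k) mpoly) hook \<Rightarrow> _)"
    by (rule module_hom_hook_diff)
  show "module_hom hook_scale (*) (hook_aug :: ('n, ('n, 'k) mpoly) hook \<Rightarrow> _)" by (rule module_hom_hook_aug)
  have diff: "hook_diff u \<in> ?F (i - 1)" if "u \<in> ?F i" "2 \<le> i" for u i
    using that hook_diff_vanishing_module[of u "i - 1"] F by simp
  show "hook_diff ` (?F i \<inter> hook_homogeneous m) \<subseteq> ?F (i - 1) \<inter> hook_homogeneous m" if "2 \<le> i" for i m
    using diff[OF _ that] hook_diff_homogeneous by blast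
  show "hook_aug ` (?F 1 \<inter> hook_homogeneous m) \<subseteq> poly_homogeneous m" for m
    using hook_aug_homogeneous by blast
  show "hook_aug ` ?F 1 = complement_ideal d r I" by (rule hook_aug_sub_module)
  show "{u \<in> ?F 1. hook_aug u = 0} = hook_diff ` ?F 2"
  proof (intro equalityI subsetI)
    fix u assume "u \<in> {u \<in> ?F 1. hook_aug u = 0}"
    then show "u \<in> hook_diff ` ?F 2" using hook_diff_exact[of u 0] F by (simp add: numeral_2_eq_2)
  next
    fix u assume "u \<in> hook_diff ` ?F 2"
    then obtain v where v: "u = hook_diff v" "v \<in> ?F 2" by blast
    have "hook_aug u = 0" unfolding v(1) using FM[OF v(2)] by (intro hook_aug_hook_diff) simp
    then show "u \<in> {u \<in> ?F 1. hook_aug u = 0}" using diff[OF v(2)] v(1) by simp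
  qed
  show "{u \<in> ?F i. hook_diff u = 0} = hook_diff ` ?F (i + 1)" if i: "2 \<le> i" for i
  proof (intro equalityI subsetI)
    fix u assume "u \<in> {u \<in> ?F i. hook_diff u = 0}"
    then show "u \<in> hook_diff ` ?F (i + 1)" using hook_diff_exact[of u "i - 1"] F i by simp
  next
    fix u assume "u \<in> hook_diff ` ?F (i + 1)"
    then obtain v where v: "u = hook_diff v" "v \<in> ?F (i + 1)" by blast
    have "v \<in> hook_module d (Suc (Suc (i - 1)))" using FM[OF v(2)] i by simp
    then have "hook_diff u = 0" unfolding v(1) by (rule hook_diff_hook_diff) (use i in simp)
    then show "u \<in> {u \<in> ?F i. hook_diff u = 0}" using diff[OF v(2)] v(1) i by simp
  qed
  show "hook_diff ` ?F i \<subseteq> hook.span {hook_scale c u | c u. c \<in> irrelevant_ideal \<and> u \<in> ?F (i - 1)}"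
    if "2 \<le> i" for i
    using hook_diff_minimal[of _ "i - 1", where 'k='k] that by auto
  show "hook_aug ` ?F 1 \<subseteq> irrelevant_ideal"
    unfolding hook_aug_sub_module by (rule complement_ideal_subset)
qed

end

theorem theorem6p12:
  fixes I :: "nat \<Rightarrow> 'n::{finite,linorder} set" and d r :: nat
  assumes "1 \<le> d" "d \<le> CARD('n)"
    and "\<forall>s\<in>{1..r}. card (I s) = d"
    and "\<forall>s\<in>{1..r}. \<forall>t\<in>{1..r}. s \<noteq> t \<longrightarrow> card (I s \<inter> I t) + 2 \<le> d"
  shows "(\<forall>i\<in>{1..CARD('n) - d + 1}.
      hook.independent (sub_generators d r I i :: ('n, ('n, 'k::field) mpoly) hook set)) \<and>
    minimal_free_resolution hook_scale hook_homogeneous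
      (complement_ideal d r I :: ('n, 'k) mpoly set) (CARD('n) - d + 1)
      (sub_module d r I) (\<lambda>i. hook_diff) hook_aug"
proof -
  interpret separated_family I d r by unfold_locales (use assms in auto)
  show ?thesis
    by (intro conjI ballI independent_sub_generators minimal_free_resolution_sub_module) simp
qed

end
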